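(* Suppose that $S\subset\mathbb R^2$ is a generic compact semialgebraic set. Then there exist $\hbar>0$, $\nu_0>0$ and $\kappa_0\in(0,1]$, depending only on $S$, such that for every $0<\varepsilon<\hbar$ $$\mathrm{dist}(\mathcal J_S,\mathcal J_{S,\varepsilon})<\nu_0\,\varepsilon^{\kappa_0},$$ where $\mathrm{dist}$ is the Hausdorff distance.
   Context: **Jumping sets.** An $\varepsilon$-pixel is a square $[(m-1)\varepsilon,m\varepsilon]\times[(n-1)\varepsilon,n\varepsilon]$, $m,n\in\mathbb Z$, and $P_\varepsilon(S)$ is the union of all $\varepsilon$-pixels that intersect $S$. For $x_0\in\mathbb R$, $\boldsymbol n_S(x_0)$ is the number of connected components of $S\cap\{x=x_0\}$, and $\mathcal J_S$ is the (finite) set of discontinuities of $x\mapsto\boldsymbol n_S(x)$. Similarly $\boldsymbol n_{S,\varepsilon}(x_0)$ is the number of connected components of $P_\varepsilon(S)\cap\{x=x_0\}$, and $\mathcal J_{S,\varepsilon}$ is the (finite) set of discontinuities of $x\mapsto\boldsymbol n_{S,\varepsilon}(x)$. **Generic sets.** For $X\subset\mathbb R^2$ put $\partial_{\rm top}X:=\mathrm{cl}(X)\setminus X$. A good stratification $\mathcal F$ of a compact semialgebraic set $S\subset\mathbb R^2$ is a filtration by closed sets $F^{(0)}\subset F^{(1)}\subset F^{(2)}=S$ with $\dim F^{(i)}\le i$ ($F^{(0)}$ is a finite set, whose points are the vertices), such that the connected components of $F^{(1)}\setminus F^{(0)}$ (the arcs) are images of injective real analytic maps $(0,1)\to\mathbb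 R^2$, the connected components of $F^{(2)}\setminus F^{(1)}$ (the faces) are open subsets of $\mathbb R^2$, $\partial_{\rm top}(F^{(2)}\setminus F^{(1)})\subset F^{(1)}$ and $\partial_{\rm top}(F^{(1)}\setminus F^{(0)})\subset F^{(0)}$. For a vertex $v$, a line $L_\infty$ (one-dimensional subspace of $\mathbb R^2$) belongs to the tangent cone $C_\infty(v,S)$ iff there are an arc $A$ with $v\in \mathrm{cl}(A)$ and points $v_n\in A$, $v_n\to v$, with $T_{v_n}A\to L_\infty$. A point $p\in S$ is a critical point of $f|_S$ if $p$ is a vertex, or a critical point of the restriction of $f$ to an arc or a face containing $p$. It is nondegenerate if: (vertex) $df_p$ does not vanish along any $L_\infty\in C_\infty(p,S)$; (arc, resp. face) $p$ is a nondegenerate critical point of the restriction of $f$ to that arc, resp. face. $f$ is a stratified Morse function with respect to $(S,\mathcal F)$ if all critical points are nondegenerate and no two critical points lie on the same level set of $f$. $S$ is generic if it admits a good stratification $\mathcal F$ such that $(x,y)\mapsto x$ is a stratified Morse function with respect to $(S,\mathcal F)$.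
   Formalization: Arcs are required to be images of analytic embeddings of (0,1) (homeomorphic onto the image, nowhere vanishing derivative), not merely of injective analytic maps; with an arc whose end runs into itself (a nodal loop) the claim can fail. *)

theory Defs
  imports "HOL-Analysis.Analysis" "HOL-Computational_Algebra.Polynomial"
begin

type_synonym plane = "real \<times> real"

section \<open>Semialgebraic sets in the plane\<close>

text \<open>A polynomial in \<open>x, y\<close> is represented as a polynomial in \<open>y\<close> with coefficients in \<open>\<real>[x]\<close>.\<close>

definition eval_xy :: "real poly poly \<Rightarrow> plane \<Rightarrow> real" where
  "eval_xy P p = poly (poly P [:snd p:]) (fst p)"

definition basic_semialgebraic :: "real poly poly set \<Rightarrow> real poly poly set \<Rightarrow> plane set" where
  "basic_semialgebraic E G = {p. (\<forall>P\<in>E. eval_xy P p = 0) \<and> (\<forall>Q\<in>G. eval_xy Q p > 0)}"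

definition semialgebraic :: "plane set \<Rightarrow> bool" where
  "semialgebraic S \<longleftrightarrow>
     (\<exists>C. finite C \<and> (\<forall>(E, G)\<in>C. finite E \<and> finite G) \<and>
          S = (\<Union>(E, G)\<in>C. basic_semialgebraic E G))"

section \<open>Pixelations and jumping sets\<close>

definition pixel :: "real \<Rightarrow> int \<Rightarrow> int \<Rightarrow> plane set" where
  "pixel \<epsilon> m n = {(of_int m - 1) * \<epsilon> .. of_int m * \<epsilon>} \<times> {(of_int n - 1) * \<epsilon> .. of_int n * \<epsilon>}"

definition pixelation :: "real \<Rightarrow> plane set \<Rightarrow> plane set" where
  "pixelation \<epsilon> S = \<Union>{pixel \<epsilon> m n | m n. pixel \<epsilon> m n \<inter> S \<noteq> {}}"

text \<open>The component count uses \<open>card\<close>, which is \<open>0\<close> on infinite sets. For compact semialgebraic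
  sets and for their pixelations every vertical slice has finitely many components.\<close>

definition slice_components :: "plane set \<Rightarrow> real \<Rightarrow> nat" where
  "slice_components S x0 = card (components (S \<inter> {p. fst p = x0}))"

definition jumping_set :: "plane set \<Rightarrow> real set" where
  "jumping_set S = {x0. \<not> isCont (slice_components S) x0}"

text \<open>Hausdorff distance with values in \<open>[0, \<infinity>]\<close>: two empty sets are at distance \<open>0\<close>, and an
  empty set is at distance \<open>\<infinity>\<close> from a nonempty one.\<close>

definition hausdorff_distance :: "'a::metric_space set \<Rightarrow> 'a set \<Rightarrow> ennreal" where
  "hausdorff_distance A B =
     max (SUP a\<in>A. INF b\<in>B. ennreal (dist a b)) (SUP b\<in>B. INF a\<in>A. ennreal (dist a b))"

section \<open>Good stratifications\<close>

definition real_analytic_on :: "(real \<Rightarrow> 'a::real_normed_vector) \<Rightarrow> real set \<Rightarrow> bool" where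
  "real_analytic_on \<gamma> U \<longleftrightarrow>
     (\<forall>t\<in>U. \<exists>a r. r > 0 \<and> (\<forall>s. \<bar>s - t\<bar> < r \<longrightarrow> s \<in> U \<and> (\<lambda>n. (s - t) ^ n *\<^sub>R a n) sums \<gamma> s))"

text \<open>An arc is a stratum, i.e. a one-dimensional submanifold, so that its tangent lines and the
  critical points of functions restricted to it make sense. The injective analytic
  parametrization is therefore taken to be an embedding: a homeomorphism onto its image with
  nowhere vanishing derivative. (Without the homeomorphism condition a nodal loop could be an arc:
  the image of \<open>t \<mapsto> (t\<^sup>2 - 1, t (t\<^sup>2 - 1))\<close> for \<open>-1 < t < 2\<close>.)\<close>

definition arc_parametrization :: "(real \<Rightarrow> plane) \<Rightarrow> plane set \<Rightarrow> bool" where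
  "arc_parametrization \<gamma> A \<longleftrightarrow>
     real_analytic_on \<gamma> {0<..<1} \<and>
     (\<exists>g. homeomorphism {0<..<1} A \<gamma> g) \<and>
     (\<forall>t\<in>{0<..<1}. vector_derivative \<gamma> (at t) \<noteq> 0)"

definition top_boundary :: "plane set \<Rightarrow> plane set" where
  "top_boundary X = closure X - X"

definition arcs :: "(nat \<Rightarrow> plane set) \<Rightarrow> plane set set" where
  "arcs F = components (F 1 - F 0)"

definition faces :: "(nat \<Rightarrow> plane set) \<Rightarrow> plane set set" where
  "faces F = components (F 2 - F 1)"

definition good_stratification :: "plane set \<Rightarrow> (nat \<Rightarrow> plane set) \<Rightarrow> bool" where
  "good_stratification S F \<longleftrightarrow>
     F 0 \<subseteq> F 1 \<and> F 1 \<subseteq> F 2 \<and> F 2 = S \<and>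
     (\<forall>i\<le>2. closed (F i) \<and> top_of_set (F i) dim_le int i) \<and>
     finite (F 0) \<and>
     (\<forall>A\<in>arcs F. \<exists>\<gamma>. arc_parametrization \<gamma> A) \<and>
     (\<forall>U\<in>faces F. open U) \<and>
     top_boundary (F 2 - F 1) \<subseteq> F 1 \<and>
     top_boundary (F 1 - F 0) \<subseteq> F 0"

section \<open>Tangent cones\<close>

text \<open>All parametrizations of \<open>A\<close> have proportional derivatives at \<open>p\<close>, so for \<open>p \<in> A\<close> the span
  is a line.\<close>

definition tangent_line :: "plane set \<Rightarrow> plane \<Rightarrow> plane set" where
  "tangent_line A p =
     span {vector_derivative \<gamma> (at t) | \<gamma> t. arc_parametrization \<gamma> A \<and> t \<in> {0<..<1} \<and> \<gamma> t = p}"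

text \<open>Convergence in the projective line, viewed as the quotient of the unit circle by \<open>\<plusminus>1\<close>.\<close>

definition lines_tendsto :: "(nat \<Rightarrow> plane set) \<Rightarrow> plane set \<Rightarrow> bool" where
  "lines_tendsto T L \<longleftrightarrow>
     (\<exists>u l. (\<forall>n. u n \<in> T n \<and> norm (u n) = 1) \<and> l \<in> L \<and> norm l = 1 \<and> u \<longlonglongrightarrow> l)"

definition tangent_cone :: "(nat \<Rightarrow> plane set) \<Rightarrow> plane \<Rightarrow> plane set set" where
  "tangent_cone F v =
     {L. subspace L \<and> dim L = 1 \<and>
         (\<exists>A\<in>arcs F. v \<in> closure A \<and>
            (\<exists>w. (\<forall>n. w n \<in> A) \<and> w \<longlonglongrightarrow> v \<and> lines_tendsto (\<lambda>n. tangent_line A (w n)) L))}"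

section \<open>Stratified Morse functions\<close>

text \<open>The function \<open>f\<close> is understood to be smooth near \<open>F 2\<close>. Since arcs are parametrized by
  regular curves, the conditions on \<open>f \<circ> \<gamma>\<close> do not depend on the choice of \<open>\<gamma>\<close>.\<close>

definition arc_critical :: "(plane \<Rightarrow> real) \<Rightarrow> plane set \<Rightarrow> plane \<Rightarrow> bool" where
  "arc_critical f A p \<longleftrightarrow>
     (\<exists>\<gamma> t. arc_parametrization \<gamma> A \<and> t \<in> {0<..<1} \<and> \<gamma> t = p \<and>
            ((f \<circ> \<gamma>) has_real_derivative 0) (at t))"

definition arc_nondegenerate :: "(plane \<Rightarrow> real) \<Rightarrow> plane set \<Rightarrow> plane \<Rightarrow> bool" where
  "arc_nondegenerate f A p \<longleftrightarrow>
     (\<exists>\<gamma> t. arc_parametrization \<gamma> A \<and> t \<in> {0<..<1} \<and> \<gamma> t = p \<and>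
            ((f \<circ> \<gamma>) has_real_derivative 0) (at t) \<and> deriv (deriv (f \<circ> \<gamma>)) t \<noteq> 0)"

definition face_critical :: "(plane \<Rightarrow> real) \<Rightarrow> plane set \<Rightarrow> plane \<Rightarrow> bool" where
  "face_critical f U p \<longleftrightarrow> p \<in> U \<and> (f has_derivative (\<lambda>_. 0)) (at p)"

definition hessian :: "(plane \<Rightarrow> real) \<Rightarrow> plane \<Rightarrow> plane \<Rightarrow> plane \<Rightarrow> real" where
  "hessian f p u w = frechet_derivative (\<lambda>q. frechet_derivative f (at q) u) (at p) w"

definition face_nondegenerate :: "(plane \<Rightarrow> real) \<Rightarrow> plane set \<Rightarrow> plane \<Rightarrow> bool" where
  "face_nondegenerate f U p \<longleftrightarrow>
     face_critical f U p \<and> (\<forall>u. u \<noteq> 0 \<longrightarrow> (\<exists>w. hessian f p u w \<noteq> 0))"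

definition vertex_nondegenerate :: "(plane \<Rightarrow> real) \<Rightarrow> (nat \<Rightarrow> plane set) \<Rightarrow> plane \<Rightarrow> bool" where
  "vertex_nondegenerate f F v \<longleftrightarrow>
     (\<forall>L\<in>tangent_cone F v. \<exists>w\<in>L. frechet_derivative f (at v) w \<noteq> 0)"

definition critical_point :: "(plane \<Rightarrow> real) \<Rightarrow> (nat \<Rightarrow> plane set) \<Rightarrow> plane \<Rightarrow> bool" where
  "critical_point f F p \<longleftrightarrow>
     p \<in> F 0 \<or> (\<exists>A\<in>arcs F. arc_critical f A p) \<or> (\<exists>U\<in>faces F. face_critical f U p)"

definition nondegenerate_critical_point ::
    "(plane \<Rightarrow> real) \<Rightarrow> (nat \<Rightarrow> plane set) \<Rightarrow> plane \<Rightarrow> bool" where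
  "nondegenerate_critical_point f F p \<longleftrightarrow>
     (p \<in> F 0 \<and> vertex_nondegenerate f F p) \<or>
     (\<exists>A\<in>arcs F. arc_nondegenerate f A p) \<or>
     (\<exists>U\<in>faces F. face_nondegenerate f U p)"

definition stratified_morse :: "(plane \<Rightarrow> real) \<Rightarrow> (nat \<Rightarrow> plane set) \<Rightarrow> bool" where
  "stratified_morse f F \<longleftrightarrow>
     (\<forall>p. critical_point f F p \<longrightarrow> nondegenerate_critical_point f F p) \<and>
     (\<forall>p q. critical_point f F p \<and> critical_point f F q \<and> f p = f q \<longrightarrow> p = q)"

definition generic :: "plane set \<Rightarrow> bool" where
  "generic S \<longleftrightarrow> (\<exists>F. good_stratification S F \<and> stratified_morse fst F)"

end

theory Submission
  imports Defs "HOL-Computational_Algebra.Field_as_Ring" "HOL-Computational_Algebra.Polynomial_Factorial"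
begin

text \<open>Let \<open>Q\<close> be the product of the distinct irreducible factors of positive degree in \<open>y\<close> of the
  polynomials describing \<open>S\<close>. A Bezout identity \<open>U Q + V Q\<^sub>y = r(x)\<close> with \<open>r \<noteq> 0\<close> shows that off a
  finite set \<open>C\<close> of abscissae all roots of \<open>Q(x, \<cdot>)\<close> are simple; hence over an interval missing \<open>C\<close>
  the set \<open>S\<close> is a disjoint union of bands between continuous root functions. The same identity
  bounds \<open>\<bar>Q\<^sub>y\<bar>\<close> at the roots below by a power of the distance \<open>d\<close> to \<open>C\<close>. So the bands stay apart,
  and hardly move across a column, as soon as \<open>\<epsilon>\<close> is smaller than a multiple of a power of \<open>d\<close>: there
  pixelation does not change the number of components of the slices.

  It does not change this number on a fixed line \<open>x = c\<close> either when \<open>\<epsilon>\<close> is small, because all of \<open>S\<close>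
  near the line is connected to its slice. Hence every jump of \<open>S\<close> is close to one of the
  pixelation. Conversely, let \<open>c \<in> C\<close> not be a jump of \<open>S\<close>. A component of the slice at \<open>c\<close> that is
  not a limit of bands from one side contains a critical point, and so does a component where two
  bands merge. Since there is at most one critical point over \<open>c\<close> and the numbers of components
  agree, bands and components of the slice correspond bijectively, so the pixelation has no jump near
  \<open>c\<close>.\<close>

section \<open>Signs of polynomials on connected sets\<close>


text \<open>The exponent comes from the rate at which roots may approach each other towards
  \<open>C\<close>. At distance \<open>d\<close> the derivative bound is
  \<open>\<mu> = m * d ^ p\<close>; gaps between roots are of order \<mu>, and a root moves by at
  most a quarter of the gap across a column once \<epsilon> is below a multiple of
  \<open>\<mu>\<^sup>2\<close>. So \<epsilon> has to be compared with a power \<open>d ^ q\<close>,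
  and inverting this relation gives windows around \<open>C\<close> of radius of order
  \<open>\<epsilon> powr (1 / q)\<close>. Inside the windows no such estimate is available, since
  two bands may tend to the same point and their gap falls below \<epsilon>. The argument there is
  qualitative. A window at a jump of \<open>S\<close> needs little control: whatever the pixelation
  does inside is close to that jump. The obstacle is a window at an abscissa where a merger of two
  bands and the birth of a new component compensate each other: the count of \<open>S\<close> is
  continuous there, yet the pixelation may jump, with no jump of \<open>S\<close> nearby. Genericity
  excludes this.\<close>

lemma eval_xy_simps [simp]:
  "eval_xy 0 z = 0" "eval_xy 1 z = 1"
  "eval_xy (P + Q) z = eval_xy P z + eval_xy Q z"
  "eval_xy (P * Q) z = eval_xy P z * eval_xy Q z"
  "eval_xy [:r:] z = poly r (fst z)"
  "eval_xy (pCons a P) z = poly a (fst z) + snd z * eval_xy P z"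
  by (simp_all add: eval_xy_def)

lemma eval_xy_prod [simp]: "eval_xy (\<Prod>P\<in>A. h P) z = (\<Prod>P\<in>A. eval_xy (h P) z)"
  by (induction A rule: infinite_finite_induct) auto

lemma eval_xy_prod_mset [simp]: "eval_xy (prod_mset A) z = prod_mset (image_mset (\<lambda>P. eval_xy P z) A)"
  by (induction A) auto

lemma continuous_on_eval_xy [continuous_intros]:
  assumes "continuous_on X f"
  shows "continuous_on X (\<lambda>t. eval_xy P (f t))"
  by (induction P) (auto intro!: continuous_intros assms)

section \<open>Prime factors and a Bezout identity over \<open>\<real>[x]\<close>\<close>

lemma eval_xy_dvd: "P dvd Q \<Longrightarrow> eval_xy P z = 0 \<Longrightarrow> eval_xy Q z = 0"
  by (auto elim!: dvdE)

text \<open>The prime factors recover \<open>P\<close> only up to a unit; the two divisibilities are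
  all that the comparison of zero sets requires.\<close>

lemma prod_prime_factors_dvd:
  fixes P :: "real poly poly"
  assumes "P \<noteq> 0"
  shows "P dvd prod_mset (prime_factorization P)" "prod_mset (prime_factorization P) dvd P"
  using prod_mset_prime_factorization_weak[OF assms] by (auto simp: associated_iff_dvd)

lemma eval_xy_eq_0_iff_prime_factor:
  assumes "P \<noteq> (0 :: real poly poly)"
  shows "eval_xy P z = 0 \<longleftrightarrow> (\<exists>p\<in>prime_factors P. eval_xy p z = 0)"
proof -
  have "eval_xy P z = 0 \<longleftrightarrow> eval_xy (prod_mset (prime_factorization P)) z = 0"
    using prod_prime_factors_dvd[OF assms] eval_xy_dvd by blast
  then show ?thesis by (auto simp: prod_mset_zero_iff)
qed

text \<open>The ideal of \<open>A\<close> and \<open>B\<close> need not be principal, since the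
  coefficients do not form a field. By pseudo-division a nonzero element \<open>D\<close> of least
  degree in \<open>y\<close> still divides every element up to a nonzero factor \<open>a\<close>
  free of \<open>y\<close>. A prime of positive degree that divides \<open>D\<close> cannot divide
  \<open>[:a:]\<close>, so it would divide both \<open>A\<close> and \<open>B\<close>; hence
  \<open>D\<close> is free of \<open>y\<close> and serves as \<open>r\<close>.\<close>

lemma bezout_over_coefficients:
  fixes A B :: "real poly poly"
  assumes "A \<noteq> 0" and coprime: "\<And>p. prime p \<Longrightarrow> degree p > 0 \<Longrightarrow> p dvd A \<Longrightarrow> p dvd B \<Longrightarrow> False"
  shows "\<exists>U V r. r \<noteq> 0 \<and> U * A + V * B = [:r:]"
proof -
  define I where "I = {U * A + V * B | U V. True}"
  have A: "A \<in> I" unfolding I_def by (intro CollectI exI[of _ 1] exI[of _ 0]) simp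
  have B: "B \<in> I" unfolding I_def by (intro CollectI exI[of _ 0] exI[of _ 1]) simp
  have lin: "s * X + t * Y \<in> I" if "X \<in> I" "Y \<in> I" for s t X Y
  proof -
    from that obtain U V U' V' where "X = U * A + V * B" "Y = U' * A + V' * B"
      by (auto simp: I_def)
    then have "s * X + t * Y = (s * U + t * U') * A + (s * V + t * V') * B"
      by (simp add: algebra_simps)
    then show ?thesis unfolding I_def by blast
  qed
  obtain D where D: "D \<in> I" "D \<noteq> 0" and least: "\<And>X. X \<in> I \<Longrightarrow> X \<noteq> 0 \<Longrightarrow> degree D \<le> degree X"
    using ex_has_least_nat[of "\<lambda>X. X \<in> I \<and> X \<noteq> 0" A degree] A assms(1) by blast
  have dvd: "\<exists>a. a \<noteq> 0 \<and> D dvd [:a:] * X" if X: "X \<in> I" for X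
  proof -
    obtain a q where aq: "a \<noteq> 0" "smult a X = D * q + pseudo_mod X D"
      using pseudo_mod(1)[OF D(2)] by blast
    have "pseudo_mod X D = [:a:] * X + (- q) * D" using aq by (simp add: algebra_simps)
    then have "pseudo_mod X D \<in> I" using lin[OF X D(1), of "[:a:]" "- q"] by metis
    then have "pseudo_mod X D = 0"
      using least pseudo_mod(2)[OF D(2), of X] by fastforce
    with aq have "D dvd [:a:] * X" by simp
    with aq(1) show ?thesis by blast
  qed
  have "degree D = 0"
  proof (rule ccontr)
    assume deg: "degree D \<noteq> 0"
    \<comment> \<open>If all prime factors were free of \<open>y\<close>, so would be their product,
      and \<open>D\<close> divides that product.\<close>
    have "\<exists>p\<in>prime_factors D. degree p > 0"
    proof (rule ccontr)
      assume neg: "\<not> ?thesis"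
      have "degree (prod_mset N) = 0" if "set_mset N \<subseteq> prime_factors D" for N
        using that neg
      proof (induction N)
        case (add x N)
        then show ?case using degree_mult_le[of x "prod_mset N"] by simp
      qed simp
      then have "degree (prod_mset (prime_factorization D)) = 0" by simp
      moreover have "prod_mset (prime_factorization D) \<noteq> 0"
        by (auto simp: prod_mset_zero_iff)
      ultimately show False
        using deg dvd_imp_degree_le[OF prod_prime_factors_dvd(1)[OF D(2)]] by simp
    qed
    then obtain p where p: "prime p" "p dvd D" "degree p > 0" by blast
    have "p dvd X" if X: "X \<in> I" for X
    proof -
      obtain a where a: "a \<noteq> 0" "D dvd [:a:] * X" using dvd[OF X] by blast
      have "\<not> p dvd [:a:]"
        using a(1) p(3) dvd_imp_degree_le[of p "[:a:]"] by auto
      moreover have "p dvd [:a:] * X" using a(2) p(2) dvd_trans by blast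
      ultimately show ?thesis using p(1) prime_dvd_multD by blast
    qed
    from this[OF A] this[OF B] show False using coprime p by blast
  qed
  then obtain r where "D = [:r:]" by (rule degree_eq_zeroE)
  moreover obtain U V where "D = U * A + V * B" using D(1) by (auto simp: I_def)
  ultimately show ?thesis using D(2) by (metis pCons_0_0)
qed

text \<open>By the product rule, a prime \<open>p = t\<close> that divides \<open>t * R\<close> and
  its derivative divides \<open>R * pderiv t\<close>. In characteristic zero a nonconstant
  \<open>t\<close> does not divide its own derivative, and \<open>R\<close> is a product of other
  primes.\<close>

lemma squarefree_product_bezout:
  fixes T :: "real poly poly set"
  assumes fin: "finite T" and T: "\<And>p. p \<in> T \<Longrightarrow> prime p \<and> degree p > 0"
  shows "\<exists>U V r. r \<noteq> 0 \<and> U * \<Prod>T + V * pderiv (\<Prod>T) = [:r:]"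
proof (rule bezout_over_coefficients)
  show "\<Prod>T \<noteq> 0" using fin T by (subst prod_zero_iff) (auto dest: T)
  fix p :: "real poly poly"
  assume p: "prime p" "degree p > 0" "p dvd \<Prod>T" "p dvd pderiv (\<Prod>T)"
  obtain t where t: "t \<in> T" "p dvd t"
    using p(1,3) fin by (metis prime_dvd_prod_iff)
  have pt: "p = t" using t T p(1) primes_dvd_imp_eq by blast
  define R where "R = \<Prod>(T - {t})"
  have Q: "\<Prod>T = t * R" using fin t(1) by (simp add: R_def prod.remove)
  have "p dvd t * pderiv R + R * pderiv t" using p(4) by (simp add: Q pderiv_mult)
  then have "p dvd R * pderiv t" using pt by (simp add: dvd_add_right_iff)
  moreover have "\<not> p dvd pderiv t" using p(2) pt not_dvd_pderiv by blast
  ultimately have "p dvd R" using p(1) prime_dvd_multD by blast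
  then obtain s where "s \<in> T - {t}" "p dvd s"
    using p(1) fin by (metis R_def finite_Diff prime_dvd_prod_iff)
  then show False using T p(1) pt primes_dvd_imp_eq by blast
qed


text \<open>A polynomial without zeros on a connected set has constant sign there by the
  intermediate value property, so each defining condition is constant on \<open>X\<close>. The
  hypothesis on \<open>X\<close> speaks only of vanishing because vanishing, unlike the sign, can be
  read off from the irreducible factors.\<close>

lemma semialgebraic_sign_determined:
  assumes "semialgebraic S"
  obtains \<P> where "finite \<P>" "0 \<notin> \<P>"
    "\<And>X. connected X \<Longrightarrow> (\<And>P. P \<in> \<P> \<Longrightarrow> (\<forall>z\<in>X. eval_xy P z = 0) \<or> (\<forall>z\<in>X. eval_xy P z \<noteq> 0))
      \<Longrightarrow> X \<subseteq> S \<or> X \<inter> S = {}"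
proof -
  obtain \<C> where \<C>: "finite \<C>" "\<And>E G. (E, G) \<in> \<C> \<Longrightarrow> finite E \<and> finite G"
    and S: "S = (\<Union>(E, G)\<in>\<C>. basic_semialgebraic E G)"
    using assms unfolding semialgebraic_def by fast
  \<comment> \<open>The zero polynomial has constant sign everywhere; it is dropped because the
    members of \<open>\<P>\<close> will be factored.\<close>
  define \<P> where "\<P> = (\<Union>(E, G)\<in>\<C>. E \<union> G) - {0}"
  have "X \<subseteq> S \<or> X \<inter> S = {}"
    if conn: "connected X"
      and dich: "\<And>P. P \<in> \<P> \<Longrightarrow> (\<forall>z\<in>X. eval_xy P z = 0) \<or> (\<forall>z\<in>X. eval_xy P z \<noteq> 0)" for X
  proof -
    have sgn: "sgn (eval_xy P z) = sgn (eval_xy P w)"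
      if P: "P \<in> E \<union> G" "(E, G) \<in> \<C>" and zw: "z \<in> X" "w \<in> X" for P E G z w
    proof (cases "P = 0")
      case False
      then have "P \<in> \<P>" using P by (auto simp: \<P>_def)
      from dich[OF this] show ?thesis
      proof
        assume nz: "\<forall>z\<in>X. eval_xy P z \<noteq> 0"
        have "connected ((\<lambda>z. eval_xy P z) ` X)"
          using conn by (intro connected_continuous_image continuous_intros)
        then have iv: "\<And>a b c. a \<in> eval_xy P ` X \<Longrightarrow> b \<in> eval_xy P ` X \<Longrightarrow> a \<le> c \<Longrightarrow> c \<le> b \<Longrightarrow> c \<in> eval_xy P ` X"
          unfolding connected_iff_interval by blast
        have "0 \<notin> eval_xy P ` X" using nz by auto
        with iv[of "eval_xy P z" "eval_xy P w" 0] iv[of "eval_xy P w" "eval_xy P z" 0] zw nz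
        show ?thesis by (force simp: sgn_if)
      qed (use zw in auto)
    qed simp
    have "w \<in> S" if "z \<in> X" "w \<in> X" "z \<in> S" for z w
    proof -
      obtain E G where EG: "(E, G) \<in> \<C>" "z \<in> basic_semialgebraic E G" using \<open>z \<in> S\<close> S by auto
      have "eval_xy P w = 0" if "P \<in> E" for P
        using sgn[of P E G z w] EG that \<open>z \<in> X\<close> \<open>w \<in> X\<close>
        by (simp add: basic_semialgebraic_def sgn_0_0)
      moreover have "eval_xy P w > 0" if "P \<in> G" for P
        using sgn[of P E G z w] EG that \<open>z \<in> X\<close> \<open>w \<in> X\<close>
        by (simp add: basic_semialgebraic_def) (metis sgn_1_pos)
      ultimately show ?thesis using EG S by (auto simp: basic_semialgebraic_def)
    qed
    then show ?thesis by blast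
  qed
  moreover have "finite \<P>" using \<C> by (auto simp: \<P>_def)
  ultimately show thesis using that[of \<P>] by (auto simp: \<P>_def)
qed

section \<open>Restriction to a vertical line\<close>

definition specialize :: "real \<Rightarrow> real poly poly \<Rightarrow> real poly" where
  "specialize x P = map_poly (\<lambda>a. poly a x) P"

lemma eval_xy_specialize: "eval_xy P (x, y) = poly (specialize x P) y"
proof (induction P)
  case (pCons a P)
  then show ?case by (simp add: specialize_def map_poly_pCons)
qed (simp add: specialize_def)

lemma coeff_specialize: "coeff (specialize x P) i = poly (coeff P i) x"
  by (simp add: specialize_def coeff_map_poly)

lemma pderiv_specialize: "pderiv (specialize x P) = specialize x (pderiv P)"
  by (rule poly_eqI) (simp add: coeff_pderiv coeff_specialize)

text \<open>On a vertical line a defining polynomial either vanishes identically, and then has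
  constant sign, or has finitely many roots. This covers exceptional abscissae as well, where no
  root functions are available.\<close>

lemma semialgebraic_vertical_slice:
  assumes "semialgebraic S"
  obtains Z where "finite Z" "\<And>X. connected X \<Longrightarrow> X \<subseteq> {c} \<times> (- Z) \<Longrightarrow> X \<subseteq> S \<or> X \<inter> S = {}"
proof -
  obtain \<P> where \<P>: "finite \<P>" "0 \<notin> \<P>"
    "\<And>X. connected X \<Longrightarrow> (\<And>P. P \<in> \<P> \<Longrightarrow> (\<forall>z\<in>X. eval_xy P z = 0) \<or> (\<forall>z\<in>X. eval_xy P z \<noteq> 0))
      \<Longrightarrow> X \<subseteq> S \<or> X \<inter> S = {}"
    using semialgebraic_sign_determined[OF assms] by metis
  define Z where "Z = (\<Union>P\<in>{P\<in>\<P>. specialize c P \<noteq> 0}. {y. poly (specialize c P) y = 0})"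
  have "finite Z" using \<P>(1) by (auto simp: Z_def poly_roots_finite)
  moreover have "X \<subseteq> S \<or> X \<inter> S = {}" if X: "connected X" "X \<subseteq> {c} \<times> (- Z)" for X
  proof (rule \<P>(3)[OF X(1)])
    fix P assume P: "P \<in> \<P>"
    show "(\<forall>z\<in>X. eval_xy P z = 0) \<or> (\<forall>z\<in>X. eval_xy P z \<noteq> 0)"
    proof (cases "specialize c P = 0")
      case True
      have "eval_xy P z = 0" if "z \<in> X" for z
      proof -
        have "z = (c, snd z)" using that X(2) by auto
        then show ?thesis using True eval_xy_specialize[of P c "snd z"] by simp
      qed
      then show ?thesis by blast
    next
      case False
      have "eval_xy P z \<noteq> 0" if "z \<in> X" for z
      proof -
        have "z = (c, snd z)" "snd z \<notin> Z" using that X(2) by auto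
        then show ?thesis using False P eval_xy_specialize[of P c "snd z"] by (auto simp: Z_def)
      qed
      then show ?thesis by blast
    qed
  qed
  ultimately show thesis by (rule that)
qed

text \<open>Away from \<open>C\<close> the leading coefficient keeps the roots bounded and the
  Bezout identity makes them simple. The identity itself is recorded, not only the simplicity,
  because its right-hand side \<open>r\<close> later yields quantitative bounds. The last two
  clauses treat the two kinds of pieces over an interval: strips between roots and graphs of
  roots.\<close>

definition adapted :: "plane set \<Rightarrow> real poly poly \<Rightarrow> real set \<Rightarrow> bool" where
  "adapted S Q C \<longleftrightarrow> finite C \<and> (\<forall>x. x \<notin> C \<longrightarrow> poly (lead_coeff Q) x \<noteq> 0) \<and>
     (\<exists>U V r. (\<forall>x. x \<notin> C \<longrightarrow> poly r x \<noteq> 0) \<and> U * Q + V * pderiv Q = [:r:]) \<and>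
     (\<forall>X. connected X \<and> fst ` X \<inter> C = {} \<and> (\<forall>z\<in>X. eval_xy Q z \<noteq> 0) \<longrightarrow> X \<subseteq> S \<or> X \<inter> S = {}) \<and>
     (\<forall>I f. connected I \<and> I \<inter> C = {} \<and> continuous_on I f \<and> (\<forall>x\<in>I. eval_xy Q (x, f x) = 0)
        \<longrightarrow> (\<forall>x\<in>I. (x, f x) \<in> S) \<or> (\<forall>x\<in>I. (x, f x) \<notin> S))"

text \<open>Prime factors free of \<open>y\<close> vanish on whole vertical lines, whose abscissae
  go into \<open>C\<close>. Off these lines a defining polynomial vanishes exactly where one of its
  factors in \<open>T\<close> does, so the zero set of \<open>Q\<close> contains all places where a
  sign can change.\<close>

lemma semialgebraic_adapted:
  assumes "semialgebraic S"
  obtains Q C where "adapted S Q C"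
proof -
  obtain \<P> where \<P>: "finite \<P>" "0 \<notin> \<P>"
    and sign: "\<And>X. connected X \<Longrightarrow> (\<And>P. P \<in> \<P> \<Longrightarrow> (\<forall>z\<in>X. eval_xy P z = 0) \<or> (\<forall>z\<in>X. eval_xy P z \<noteq> 0))
      \<Longrightarrow> X \<subseteq> S \<or> X \<inter> S = {}"
    using semialgebraic_sign_determined[OF assms] by metis
  define T0 where "T0 = (\<Union>P\<in>\<P>. prime_factors P)"
  define T where "T = {p\<in>T0. degree p > 0}"
  define Q where "Q = \<Prod>T"
  have fin: "finite T0" "finite T" using \<P>(1) by (auto simp: T0_def T_def)
  have prime: "prime p" if "p \<in> T0" for p using that by (auto simp: T0_def)
  have Tp: "prime p \<and> degree p > 0" if "p \<in> T" for p using that prime by (simp add: T_def)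
  obtain U V r where r: "r \<noteq> 0" and bezout: "U * Q + V * pderiv Q = [:r:]"
    using squarefree_product_bezout[OF fin(2) Tp] unfolding Q_def by auto
  have "0 \<notin> T" using Tp by fastforce
  then have Q0: "Q \<noteq> 0" using fin by (simp add: Q_def)
  \<comment> \<open>Off the roots of \<open>r\<close> the roots of a fibre of \<open>Q\<close> are
    simple; off those of the leading coefficient none escapes to infinity. The last set removes the
    lines on which a factor free of \<open>y\<close> vanishes.\<close>
  define C where "C = {x. poly r x = 0} \<union> {x. poly (lead_coeff Q) x = 0}
    \<union> (\<Union>p\<in>{p\<in>T0. degree p = 0}. {x. poly (lead_coeff p) x = 0})"
  have "lead_coeff p \<noteq> 0" if "p \<in> T0" for p
    using prime[OF that] by (auto simp only: leading_coeff_0_iff not_prime_0)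
  then have finC: "finite C"
    unfolding C_def using r Q0 fin
    by (intro finite_UnI finite_UN_I poly_roots_finite) (blast | simp)+
  have deg0: "eval_xy p z \<noteq> 0" if "p \<in> T0" "degree p = 0" "fst z \<notin> C" for p z
  proof -
    obtain a where a: "p = [:a:]" using \<open>degree p = 0\<close> by (rule degree_eq_zeroE)
    then show ?thesis using that by (force simp: C_def)
  qed
  have zero_iff: "eval_xy P z = 0 \<longleftrightarrow> (\<exists>p\<in>T \<inter> prime_factors P. eval_xy p z = 0)"
    if "P \<in> \<P>" "fst z \<notin> C" for P z
  proof -
    have "P \<noteq> 0" using that \<P>(2) by auto
    then show ?thesis using eval_xy_eq_0_iff_prime_factor[of P z] deg0[OF _ _ that(2)] that(1)
      by (auto simp: T_def T0_def)
  qed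
  have cell: "X \<subseteq> S \<or> X \<inter> S = {}"
    if "connected X" "fst ` X \<inter> C = {}" "\<forall>z\<in>X. eval_xy Q z \<noteq> 0" for X
  proof (rule sign[OF that(1)])
    fix P assume P: "P \<in> \<P>"
    have "eval_xy P z \<noteq> 0" if z: "z \<in> X" for z
    proof -
      have "eval_xy p z \<noteq> 0" if "p \<in> T" for p
        using \<open>\<forall>z\<in>X. eval_xy Q z \<noteq> 0\<close> z that fin by (auto simp: Q_def)
      then show ?thesis using zero_iff[OF P, of z] z \<open>fst ` X \<inter> C = {}\<close> by blast
    qed
    then show "(\<forall>z\<in>X. eval_xy P z = 0) \<or> (\<forall>z\<in>X. eval_xy P z \<noteq> 0)" by blast
  qed
  have graph: "(\<forall>x\<in>I. (x, f x) \<in> S) \<or> (\<forall>x\<in>I. (x, f x) \<notin> S)"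
    if I: "connected I" "I \<inter> C = {}" and f: "continuous_on I f" and Qf: "\<forall>x\<in>I. eval_xy Q (x, f x) = 0" for I f
  proof -
    define X where "X = (\<lambda>x. (x, f x)) ` I"
    have "X \<subseteq> S \<or> X \<inter> S = {}"
    proof (rule sign)
      show "connected X" unfolding X_def by (intro connected_continuous_image continuous_intros f I(1))
      fix P assume P: "P \<in> \<P>"
      show "(\<forall>z\<in>X. eval_xy P z = 0) \<or> (\<forall>z\<in>X. eval_xy P z \<noteq> 0)"
      proof (rule disjCI)
        assume "\<not> (\<forall>z\<in>X. eval_xy P z \<noteq> 0)"
        then obtain x0 where x0: "x0 \<in> I" "eval_xy P (x0, f x0) = 0" by (auto simp: X_def)
        then obtain p where p: "p \<in> T" "p \<in> prime_factors P" "eval_xy p (x0, f x0) = 0"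
          using zero_iff[OF P, of "(x0, f x0)"] I(2) by auto
        \<comment> \<open>A common zero of \<open>p\<close> and the cofactor \<open>R\<close> would
          be a zero of \<open>Q\<close> and of its derivative. So along the graph the zero sets of
          \<open>p\<close> and \<open>R\<close> are closed, disjoint and cover the connected
          \<open>I\<close>: once \<open>p\<close> vanishes at one point of the graph, it vanishes on
          all of it.\<close>
        define R where "R = \<Prod>(T - {p})"
        have QR: "Q = p * R" using fin p by (simp add: Q_def R_def prod.remove)
        have simple: "\<not> (eval_xy p (x, f x) = 0 \<and> eval_xy R (x, f x) = 0)" if "x \<in> I" for x
        proof
          assume 0: "eval_xy p (x, f x) = 0 \<and> eval_xy R (x, f x) = 0"
          have "eval_xy (U * Q + V * pderiv Q) (x, f x) = 0"
            using 0 by (simp add: QR pderiv_mult)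
          then show False using bezout that I(2) by (auto simp: C_def)
        qed
        have cl: "closedin (top_of_set I) (I \<inter> (\<lambda>x. eval_xy A (x, f x)) -` {0})" for A
          by (intro continuous_closedin_preimage closed_singleton continuous_intros f)
        let ?E = "\<lambda>A. I \<inter> (\<lambda>x. eval_xy A (x, f x)) -` {0}"
        have "?E p \<union> ?E R = I" using Qf by (auto simp: QR)
        moreover have "?E p \<inter> ?E R = {}" using simple by auto
        moreover have "?E p \<noteq> {}" using x0(1) p(3) by auto
        ultimately have "?E R = {}"
          using I(1) cl[of p] cl[of R] unfolding connected_closedin_eq by metis
        then have p0: "eval_xy p (x, f x) = 0" if "x \<in> I" for x using Qf that by (auto simp: QR)
        have "eval_xy P (x, f x) = 0" if "x \<in> I" for x
          using zero_iff[OF P, of "(x, f x)"] p p0[OF that] I(2) that by auto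
        then show "\<forall>z\<in>X. eval_xy P z = 0" by (auto simp: X_def)
      qed
    qed
    then show ?thesis by (auto simp: X_def)
  qed
  have "\<forall>x. x \<notin> C \<longrightarrow> poly r x \<noteq> 0" "\<forall>x. x \<notin> C \<longrightarrow> poly (lead_coeff Q) x \<noteq> 0"
    by (auto simp: C_def)
  then have "adapted S Q C"
    unfolding adapted_def using finC bezout cell graph by (intro conjI allI impI) blast+
  then show thesis by (rule that)
qed

section \<open>Root functions and bands\<close>


text \<open>Cauchy's bound: for \<open>\<bar>y\<bar> > 1\<close> the lower terms together are at
  most the coefficient sum times \<open>\<bar>y\<bar> ^ (d - 1)\<close>, and at a root they balance
  the leading term.\<close>

lemma poly_root_bound:
  fixes p :: "real poly"
  assumes "p \<noteq> 0" "poly p y = 0"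
  shows "\<bar>y\<bar> \<le> 1 + (\<Sum>i<degree p. \<bar>coeff p i\<bar>) / \<bar>lead_coeff p\<bar>"
proof (cases "\<bar>y\<bar> \<le> 1")
  case True
  then show ?thesis by (simp add: add_increasing2 sum_nonneg)
next
  case False
  define d where "d = degree p"
  define s where "s = (\<Sum>i<d. \<bar>coeff p i\<bar>)"
  have lc: "lead_coeff p \<noteq> 0" using assms(1) by simp
  have d: "d > 0" using assms lc by (cases "d = 0") (auto simp: d_def elim!: degree_eq_zeroE)
  have "(\<Sum>i\<le>d. coeff p i * y ^ i) = 0" using assms(2) by (simp add: poly_altdef d_def)
  then have "coeff p d * y ^ d = - (\<Sum>i<d. coeff p i * y ^ i)"
    by (simp add: lessThan_Suc_atMost[symmetric])
  then have "\<bar>coeff p d\<bar> * \<bar>y\<bar> ^ d = \<bar>\<Sum>i<d. coeff p i * y ^ i\<bar>"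
    by (metis abs_minus_cancel abs_mult power_abs)
  also have "\<dots> \<le> (\<Sum>i<d. \<bar>coeff p i * y ^ i\<bar>)" by (rule sum_abs)
  also have "\<dots> \<le> (\<Sum>i<d. \<bar>coeff p i\<bar> * \<bar>y\<bar> ^ (d - 1))"
    using False by (intro sum_mono) (auto simp: abs_mult power_abs intro!: mult_left_mono power_increasing)
  also have "\<dots> = s * \<bar>y\<bar> ^ (d - 1)" by (simp add: s_def sum_distrib_right)
  finally have "(\<bar>coeff p d\<bar> * \<bar>y\<bar>) * \<bar>y\<bar> ^ (d - 1) \<le> s * \<bar>y\<bar> ^ (d - 1)"
    using d by (cases d) (simp_all add: mult.assoc)
  then have "\<bar>coeff p d\<bar> * \<bar>y\<bar> \<le> s" using False by (elim mult_right_le_imp_le) auto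
  then have "\<bar>y\<bar> \<le> s / \<bar>lead_coeff p\<bar>" using lc by (simp add: d_def field_simps)
  then show ?thesis by (simp add: s_def d_def)
qed

section \<open>Continuity of the ordered roots\<close>

definition fibre_roots :: "real poly poly \<Rightarrow> real \<Rightarrow> real set" where
  "fibre_roots Q x = {y. eval_xy Q (x, y) = 0}"

definition root_fun :: "real poly poly \<Rightarrow> nat \<Rightarrow> real \<Rightarrow> real" where
  "root_fun Q k x = sorted_list_of_set (fibre_roots Q x) ! k"

definition regular_fibre :: "real poly poly \<Rightarrow> real \<Rightarrow> bool" where
  "regular_fibre Q x \<longleftrightarrow> poly (lead_coeff Q) x \<noteq> 0 \<and>
     (\<forall>y. eval_xy Q (x, y) = 0 \<longrightarrow> eval_xy (pderiv Q) (x, y) \<noteq> 0)"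

lemma degree_specialize:
  assumes "poly (lead_coeff Q) x \<noteq> 0"
  shows "degree (specialize x Q) = degree Q" "specialize x Q \<noteq> 0"
proof -
  show "degree (specialize x Q) = degree Q"
    using assms by (intro antisym le_degree degree_le) (auto simp: coeff_specialize coeff_eq_0)
  show "specialize x Q \<noteq> 0"
    using assms by (metis coeff_0 coeff_specialize)
qed

lemma finite_fibre_roots:
  assumes "regular_fibre Q x" shows "finite (fibre_roots Q x)"
  using degree_specialize[of Q x] assms
  by (auto simp: regular_fibre_def fibre_roots_def eval_xy_specialize poly_roots_finite)

text \<open>Cauchy's bound is continuous in \<open>x\<close> where the leading coefficient does not
  vanish, so no root comes in from infinity.\<close>

lemma eventually_fibre_roots_bounded:
  assumes "poly (lead_coeff Q) x0 \<noteq> 0"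
  shows "\<exists>M. \<forall>\<^sub>F x in nhds x0. \<forall>y\<in>fibre_roots Q x. \<bar>y\<bar> \<le> M"
proof -
  define B where "B = (\<lambda>x. 1 + (\<Sum>i<degree Q. \<bar>poly (coeff Q i) x\<bar>) / \<bar>poly (lead_coeff Q) x\<bar>)"
  have "isCont B x0" unfolding B_def using assms by (auto intro!: continuous_intros)
  then have "\<forall>\<^sub>F x in nhds x0. B x < B x0 + 1"
    by (intro order_tendstoD(2)[of B "B x0"]) (simp_all add: isCont_def tendsto_at_iff_tendsto_nhds)
  moreover have "isCont (poly (lead_coeff Q)) x0" by simp
  then have "\<forall>\<^sub>F x in nhds x0. poly (lead_coeff Q) x \<noteq> 0"
    using assms by (metis isCont_def tendsto_at_iff_tendsto_nhds tendsto_imp_eventually_ne)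
  ultimately have "\<forall>\<^sub>F x in nhds x0. \<forall>y\<in>fibre_roots Q x. \<bar>y\<bar> \<le> B x0 + 1"
  proof eventually_elim
    case (elim x)
    show ?case
    proof
      fix y assume "y \<in> fibre_roots Q x"
      then have "poly (specialize x Q) y = 0" by (simp add: fibre_roots_def eval_xy_specialize)
      from poly_root_bound[OF _ this] degree_specialize[OF elim(2)] have "\<bar>y\<bar> \<le> B x"
        by (simp add: B_def coeff_specialize)
      then show "\<bar>y\<bar> \<le> B x0 + 1" using elim(1) by simp
    qed
  qed
  then show ?thesis by blast
qed

text \<open>The zeros over a compact range of abscissae with heights in \<open>K\<close> project to
  a compact, hence closed, set that misses \<open>x0\<close>.\<close>

lemma eventually_no_roots_in_compact:
  assumes "compact K" "K \<inter> fibre_roots Q x0 = {}"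
  shows "\<forall>\<^sub>F x in nhds x0. K \<inter> fibre_roots Q x = {}"
proof -
  define P where "P = fst ` ({z. eval_xy Q z = 0} \<inter> (cball x0 1 \<times> K))"
  have "closed {z. eval_xy Q z = 0}"
    by (intro closed_Collect_eq continuous_on_eval_xy continuous_intros)
  then have "compact P" unfolding P_def
    by (intro compact_continuous_image continuous_intros closed_Int_compact compact_Times compact_cball assms)
  moreover have "x0 \<notin> P" using assms(2) by (auto simp: P_def fibre_roots_def)
  ultimately have "\<forall>\<^sub>F x in nhds x0. x \<in> - P"
    by (intro eventually_nhds_in_open) (auto simp: compact_imp_closed open_Compl)
  moreover have "\<forall>\<^sub>F x in nhds x0. x \<in> ball x0 1"
    by (intro eventually_nhds_in_open) auto
  ultimately show ?thesis
  proof eventually_elim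
    case (elim x)
    have "x \<in> P" if "y \<in> K" "y \<in> fibre_roots Q x" for y
      unfolding P_def using that elim(2)
      by (intro image_eqI[of _ _ "(x, y)"]) (auto simp: fibre_roots_def)
    then show ?case using elim(1) by blast
  qed
qed

text \<open>An implicit function theorem by monotonicity: near the point \<open>Q\<close> is
  strictly monotone in \<open>y\<close>, and its opposite signs at \<open>y0 - \<eta>\<close> and
  \<open>y0 + \<eta>\<close> persist for nearby \<open>x\<close>. Stating it for all small \<eta>
  allows one \<eta> to serve finitely many roots at once.\<close>

lemma eventually_unique_root_near_simple_root:
  assumes y0: "eval_xy Q (x0, y0) = 0" and D: "eval_xy (pderiv Q) (x0, y0) \<noteq> 0"
  shows "\<forall>\<^sub>F \<eta> in at_right 0. \<forall>\<^sub>F x in nhds x0. \<exists>!y. \<bar>y - y0\<bar> < \<eta> \<and> y \<in> fibre_roots Q x"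
proof -
  \<comment> \<open>Multiplying \<open>Q\<close> by its derivative \<open>d\<close> at the point
    turns the decreasing case into the increasing one.\<close>
  define d where "d = eval_xy (pderiv Q) (x0, y0)"
  have "open {z. d * eval_xy (pderiv Q) z > 0}"
    by (intro open_Collect_less continuous_intros continuous_on_eval_xy)
  moreover have "(x0, y0) \<in> {z. d * eval_xy (pderiv Q) z > 0}"
    using D by (auto simp: d_def zero_less_mult_iff)
  ultimately obtain e where e: "e > 0" "ball (x0, y0) e \<subseteq> {z. d * eval_xy (pderiv Q) z > 0}"
    using open_contains_ball by blast
  have pos: "d * eval_xy (pderiv Q) (x, y) > 0" if "\<bar>x - x0\<bar> < e / 2" "\<bar>y - y0\<bar> < e / 2" for x y
  proof -
    have "dist (x0, y0) (x, y) \<le> \<bar>x - x0\<bar> + \<bar>y - y0\<bar>"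
      by (simp add: dist_Pair_Pair dist_real_def abs_minus_commute sqrt_sum_squares_le_sum_abs)
    then show ?thesis using that e(2) by (auto simp: subset_iff)
  qed
  have mono: "d * eval_xy Q (x, y) < d * eval_xy Q (x, y')"
    if x: "\<bar>x - x0\<bar> < e / 2" and y: "y < y'" "\<bar>y - y0\<bar> < e / 2" "\<bar>y' - y0\<bar> < e / 2" for x y y'
  proof -
    obtain \<xi> where \<xi>: "y < \<xi>" "\<xi> < y'"
      "poly (specialize x Q) y' - poly (specialize x Q) y = (y' - y) * poly (pderiv (specialize x Q)) \<xi>"
      using poly_MVT[OF y(1)] by blast
    have "d * (poly (specialize x Q) y' - poly (specialize x Q) y) = (y' - y) * (d * poly (pderiv (specialize x Q)) \<xi>)"
      by (simp add: \<xi>(3))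
    also have "\<dots> > 0"
    proof (rule mult_pos_pos)
      have "\<bar>\<xi> - y0\<bar> < e / 2" using \<xi>(1,2) y by linarith
      then show "d * poly (pderiv (specialize x Q)) \<xi> > 0"
        using pos[OF x, of \<xi>] by (simp add: pderiv_specialize eval_xy_specialize)
    qed (use y in simp)
    finally show ?thesis by (simp add: eval_xy_specialize algebra_simps)
  qed
  have "\<forall>\<^sub>F x in nhds x0. \<exists>!y. \<bar>y - y0\<bar> < \<eta> \<and> y \<in> fibre_roots Q x" if \<eta>: "0 < \<eta>" "\<eta> < e / 2" for \<eta>
  proof -
    have cont: "isCont (\<lambda>x. d * eval_xy Q (x, y)) x0" for y
      by (intro continuous_intros continuous_on_eval_xy continuous_on_interior[of UNIV] ) auto
    have "d * eval_xy Q (x0, y0 + \<eta>) > 0" using mono[of x0 y0 "y0 + \<eta>"] \<eta> e y0 by simp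
    then have up: "\<forall>\<^sub>F x in nhds x0. d * eval_xy Q (x, y0 + \<eta>) > 0"
      using cont by (metis isCont_def tendsto_at_iff_tendsto_nhds order_tendstoD(1))
    have "d * eval_xy Q (x0, y0 - \<eta>) < 0" using mono[of x0 "y0 - \<eta>" y0] \<eta> e y0 by simp
    then have lo: "\<forall>\<^sub>F x in nhds x0. d * eval_xy Q (x, y0 - \<eta>) < 0"
      using cont by (metis isCont_def tendsto_at_iff_tendsto_nhds order_tendstoD(2))
    have "\<forall>\<^sub>F x in nhds x0. x \<in> ball x0 (e / 2)"
      using e by (intro eventually_nhds_in_open) auto
    with up lo show ?thesis
    proof eventually_elim
      case (elim x)
      have x: "\<bar>x - x0\<bar> < e / 2" using elim(3) by (simp add: dist_real_def abs_minus_commute)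
      have "continuous_on {y0 - \<eta>..y0 + \<eta>} (\<lambda>y. d * eval_xy Q (x, y))"
        by (intro continuous_intros)
      then obtain y where y: "y0 - \<eta> \<le> y" "y \<le> y0 + \<eta>" "d * eval_xy Q (x, y) = 0"
        using IVT'[of "\<lambda>y. d * eval_xy Q (x, y)" "y0 - \<eta>" 0 "y0 + \<eta>"] elim \<eta>(1) by auto
      have "y \<noteq> y0 - \<eta>" "y \<noteq> y0 + \<eta>" using y(3) elim by auto
      then have *: "\<bar>y - y0\<bar> < \<eta> \<and> y \<in> fibre_roots Q x"
        using y D by (auto simp: fibre_roots_def d_def)
      show ?case
      proof (rule ex1I[of _ y])
        show "\<bar>y - y0\<bar> < \<eta> \<and> y \<in> fibre_roots Q x" by (rule *)
        fix y' assume y': "\<bar>y' - y0\<bar> < \<eta> \<and> y' \<in> fibre_roots Q x"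
        then show "y' = y"
          using mono[OF x, of y y'] mono[OF x, of y' y] * \<eta>
          by (cases y y' rule: linorder_cases) (auto simp: fibre_roots_def)
      qed
    qed
  qed
  then show ?thesis
    using e(1) by (auto simp: eventually_at_right_field intro!: exI[of _ "e / 2"])
qed

text \<open>Each root over \<open>x0\<close> has exactly one root over \<open>x\<close> in its
  \<eta>-ball, and there are no others, since a bounded root outside the balls would lie in the
  compact \<open>K\<close>. The balls are disjoint, so this bijection preserves the order and with
  it the index \<open>k\<close>.\<close>

lemma eventually_root_fun_near:
  assumes reg: "regular_fibre Q x0" and e: "e > 0"
  shows "\<forall>\<^sub>F x in nhds x0. finite (fibre_roots Q x) \<and> card (fibre_roots Q x) = card (fibre_roots Q x0) \<and>
           (\<forall>k<card (fibre_roots Q x0). \<bar>root_fun Q k x - root_fun Q k x0\<bar> < e)"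
proof -
  let ?Z = "fibre_roots Q"
  have fin: "finite (?Z x0)" using reg by (rule finite_fibre_roots)
  have uniq: "\<forall>\<^sub>F \<eta> in at_right 0. \<forall>y0\<in>?Z x0. \<forall>\<^sub>F x in nhds x0. \<exists>!y. \<bar>y - y0\<bar> < \<eta> \<and> y \<in> ?Z x"
    using reg by (intro eventually_ball_finite fin ballI eventually_unique_root_near_simple_root)
      (auto simp: regular_fibre_def fibre_roots_def)
  have sep: "\<forall>\<^sub>F \<eta> in at_right 0. \<forall>y0\<in>?Z x0. \<forall>y1\<in>?Z x0. y0 < y1 \<longrightarrow> y0 + \<eta> < y1 - \<eta>"
  proof (intro eventually_ball_finite fin ballI)
    fix y0 y1 :: real
    show "\<forall>\<^sub>F \<eta> in at_right 0. y0 < y1 \<longrightarrow> y0 + \<eta> < y1 - \<eta>"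
    proof (cases "y0 < y1")
      case True
      then show ?thesis
        by (auto simp: eventually_at_right_field intro!: exI[of _ "(y1 - y0) / 2"])
    qed simp
  qed
  have "\<forall>\<^sub>F \<eta> in at_right (0::real). \<eta> < e"
    using e by (auto simp: eventually_at_right_field)
  moreover have "\<forall>\<^sub>F \<eta> in at_right (0::real). 0 < \<eta>" by (rule eventually_at_right_less)
  ultimately have "\<forall>\<^sub>F \<eta> in at_right 0. 0 < \<eta> \<and> \<eta> < e \<and>
      (\<forall>y0\<in>?Z x0. \<forall>\<^sub>F x in nhds x0. \<exists>!y. \<bar>y - y0\<bar> < \<eta> \<and> y \<in> ?Z x) \<and>
      (\<forall>y0\<in>?Z x0. \<forall>y1\<in>?Z x0. y0 < y1 \<longrightarrow> y0 + \<eta> < y1 - \<eta>)"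
    using uniq sep by eventually_elim blast
  from eventually_happens'[OF trivial_limit_at_right_real this] obtain \<eta> where \<eta>: "0 < \<eta>" "\<eta> < e"
    and uniq: "\<And>y0. y0 \<in> ?Z x0 \<Longrightarrow> \<forall>\<^sub>F x in nhds x0. \<exists>!y. \<bar>y - y0\<bar> < \<eta> \<and> y \<in> ?Z x"
    and sep: "\<And>y0 y1. y0 \<in> ?Z x0 \<Longrightarrow> y1 \<in> ?Z x0 \<Longrightarrow> y0 < y1 \<Longrightarrow> y0 + \<eta> < y1 - \<eta>"
    by blast
  have uniq': "\<forall>\<^sub>F x in nhds x0. \<forall>y0\<in>?Z x0. \<exists>!y. \<bar>y - y0\<bar> < \<eta> \<and> y \<in> ?Z x"
    by (intro eventually_ball_finite fin ballI uniq)
  obtain M where M: "\<forall>\<^sub>F x in nhds x0. \<forall>y\<in>?Z x. \<bar>y\<bar> \<le> M"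
    using eventually_fibre_roots_bounded reg unfolding regular_fibre_def by blast
  define K where "K = {-M..M} - (\<Union>y0\<in>?Z x0. ball y0 \<eta>)"
  have "compact K" unfolding K_def by (intro compact_diff open_UN ballI open_ball compact_Icc)
  moreover have "K \<inter> ?Z x0 = {}" using \<eta>(1) by (auto simp: K_def)
  ultimately have "\<forall>\<^sub>F x in nhds x0. K \<inter> ?Z x = {}" by (rule eventually_no_roots_in_compact)
  with uniq' M show ?thesis
  proof eventually_elim
    case (elim x)
    define z where "z = (\<lambda>y0. THE y. \<bar>y - y0\<bar> < \<eta> \<and> y \<in> ?Z x)"
    have z: "\<bar>z y0 - y0\<bar> < \<eta>" "z y0 \<in> ?Z x" if "y0 \<in> ?Z x0" for y0
      using theI'[of "\<lambda>y. \<bar>y - y0\<bar> < \<eta> \<and> y \<in> ?Z x"] elim(1) that by (auto simp: z_def)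
    have "y \<in> z ` ?Z x0" if y: "y \<in> ?Z x" for y
    proof -
      have "y \<in> {-M..M}" using elim(2) y by force
      moreover have "y \<notin> K" using elim(3) y by blast
      ultimately obtain y0 where y0: "y0 \<in> ?Z x0" "\<bar>y - y0\<bar> < \<eta>"
        by (auto simp: K_def dist_real_def abs_minus_commute)
      then have "z y0 = y" unfolding z_def using elim(1) y by (intro the1_equality) auto
      then show ?thesis using y0 by blast
    qed
    then have Z: "?Z x = z ` ?Z x0" using z by blast
    have mono: "z y0 < z y1" if "y0 \<in> ?Z x0" "y1 \<in> ?Z x0" "y0 < y1" for y0 y1
      using z(1)[OF that(1)] z(1)[OF that(2)] sep[OF that] by linarith
    then have inj: "inj_on z (?Z x0)" by (intro linorder_inj_onI) force+
    then have card: "card (?Z x) = card (?Z x0)" using Z card_image by metis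
    define l where "l = sorted_list_of_set (?Z x0)"
    have l: "sorted_wrt (<) l" "set l = ?Z x0" "length l = card (?Z x0)" using fin by (auto simp: l_def)
    have "sorted_wrt (<) (map z l)"
      using l(1) mono unfolding sorted_wrt_map l(2)[symmetric]
      by (rule sorted_wrt_mono_rel[rotated])
    then have "sorted_list_of_set (?Z x) = map z l"
      using l Z card fin by (intro sorted_list_of_set_unique[THEN iffD1]) auto
    then have nth: "root_fun Q k x = z (l ! k)" if "k < card (?Z x0)" for k
      using that l(3) by (simp add: root_fun_def)
    have "\<bar>root_fun Q k x - root_fun Q k x0\<bar> < e" if "k < card (?Z x0)" for k
    proof -
      have "l ! k \<in> ?Z x0" using that l by (metis nth_mem)
      from z(1)[OF this] show ?thesis
        using nth[OF that] \<eta>(2) by (simp add: root_fun_def l_def)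
    qed
    moreover have "finite (?Z x)" using Z fin by simp
    ultimately show ?case using card by blast
  qed
qed

text \<open>The number of roots is locally constant, hence constant on the connected
  \<open>I\<close>, which gives the index \<open>k\<close> a meaning over all of
  \<open>I\<close>.\<close>

lemma root_functions:
  assumes I: "connected I" and reg: "\<And>x. x \<in> I \<Longrightarrow> regular_fibre Q x"
  obtains N :: nat and f where "\<And>k. k < N \<Longrightarrow> continuous_on I (f k)"
    "\<And>x i j. x \<in> I \<Longrightarrow> i < j \<Longrightarrow> j < N \<Longrightarrow> f i x < f j x"
    "\<And>x. x \<in> I \<Longrightarrow> fibre_roots Q x = (\<lambda>k. f k x) ` {..<N}"
proof -
  obtain N where N: "\<And>x. x \<in> I \<Longrightarrow> card (fibre_roots Q x) = N"
  proof (cases "I = {}")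
    case False
    then obtain a where a: "a \<in> I" by blast
    have "card (fibre_roots Q b) = card (fibre_roots Q a)" if "b \<in> I" for b
    proof (rule connected_local_const[OF I that a])
      show "\<forall>x\<in>I. \<forall>\<^sub>F y in at x within I. card (fibre_roots Q x) = card (fibre_roots Q y)"
      proof
        fix x assume "x \<in> I"
        have "\<forall>\<^sub>F y in nhds x. card (fibre_roots Q y) = card (fibre_roots Q x)"
          using eventually_root_fun_near[OF reg[OF \<open>x \<in> I\<close>] zero_less_one] by eventually_elim simp
        then show "\<forall>\<^sub>F y in at x within I. card (fibre_roots Q x) = card (fibre_roots Q y)"
          unfolding eventually_at_filter by eventually_elim simp
      qed
    qed
    then show ?thesis using that by blast
  qed (use that in blast)
  show thesis
  proof (rule that[of N "root_fun Q"])
    fix k assume k: "k < N"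
    show "continuous_on I (root_fun Q k)"
      unfolding continuous_on_def
    proof
      fix x assume x: "x \<in> I"
      have "\<forall>\<^sub>F y in nhds x. dist (root_fun Q k y) (root_fun Q k x) < e" if "e > 0" for e
        using eventually_root_fun_near[OF reg[OF x] that]
        by eventually_elim (use k N[OF x] in \<open>auto simp: dist_real_def\<close>)
      then have "(root_fun Q k \<longlongrightarrow> root_fun Q k x) (nhds x)" by (simp add: tendsto_iff)
      then show "(root_fun Q k \<longlongrightarrow> root_fun Q k x) (at x within I)"
        by (rule tendsto_mono[rotated]) (simp add: at_within_def)
    qed
  next
    fix x i j assume "x \<in> I" "i < j" "j < N"
    then show "root_fun Q i x < root_fun Q j x"
      unfolding root_fun_def using N[of x] finite_fibre_roots[OF reg]
      by (intro sorted_wrt_nth_less[of "(<)"]) auto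
  next
    fix x assume x: "x \<in> I"
    have "fibre_roots Q x = set (sorted_list_of_set (fibre_roots Q x))"
      using finite_fibre_roots[OF reg[OF x]] by simp
    also have "\<dots> = (\<lambda>k. root_fun Q k x) ` {..<N}"
      using N[OF x] finite_fibre_roots[OF reg[OF x]]
      by (auto simp: set_conv_nth root_fun_def image_iff Bex_def)
    finally show "fibre_roots Q x = (\<lambda>k. root_fun Q k x) ` {..<N}" .
  qed
qed


section \<open>Decomposition into bands over an interval\<close>

lemma adapted_regular_fibre:
  assumes "adapted S Q C" "x \<notin> C" shows "regular_fibre Q x"
proof -
  from assms(1) have "\<exists>U V r. (\<forall>x. x \<notin> C \<longrightarrow> poly r x \<noteq> 0) \<and> U * Q + V * pderiv Q = [:r:]"
    unfolding adapted_def by (elim conjE)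
  with assms(2) obtain U V r where r: "poly r x \<noteq> 0" "U * Q + V * pderiv Q = [:r:]" by blast
  have "eval_xy (pderiv Q) (x, y) \<noteq> 0" if "eval_xy Q (x, y) = 0" for y
  proof
    assume "eval_xy (pderiv Q) (x, y) = 0"
    then have "eval_xy (U * Q + V * pderiv Q) (x, y) = 0" using that by simp
    then show False using r by simp
  qed
  then show ?thesis using assms by (auto simp: regular_fibre_def adapted_def)
qed

lemma adapted_fibre_interval:
  assumes "adapted S Q C" "x \<notin> C" "connected T" "T \<inter> fibre_roots Q x = {}"
    "(x, y) \<in> S" "y \<in> T"
  shows "{x} \<times> T \<subseteq> S"
proof -
  have "connected ({x} \<times> T)" using assms(3) by (simp add: connected_Times)
  moreover have "fst ` ({x} \<times> T) \<inter> C = {}" using assms(2) by auto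
  moreover have "\<forall>z\<in>{x} \<times> T. eval_xy Q z \<noteq> 0" using assms(4) by (auto simp: fibre_roots_def)
  ultimately have "{x} \<times> T \<subseteq> S \<or> ({x} \<times> T) \<inter> S = {}"
    using assms(1) unfolding adapted_def by blast
  then show ?thesis using assms(5,6) by blast
qed

text \<open>Otherwise a vertical ray free of roots would be contained in the bounded set
  \<open>S\<close>.\<close>

lemma adapted_roots_around:
  assumes "adapted S Q C" "x \<notin> C" "bounded S" "(x, y) \<in> S"
  shows "\<exists>r\<in>fibre_roots Q x. r \<le> y" "\<exists>r\<in>fibre_roots Q x. y \<le> r"
proof -
  have bdd: "bounded T" if "{x} \<times> T \<subseteq> S" for T
  proof -
    have "bounded ({x} \<times> T)" using that assms(3) bounded_subset by blast
    then have "bounded (snd ` ({x} \<times> T))" by (rule bounded_snd)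
    then show ?thesis by simp
  qed
  have "\<exists>z\<in>{..y}. \<exists>z'\<in>{y..}. \<bar>z\<bar> > B \<and> \<bar>z'\<bar> > B" for B
    by (intro bexI[of _ "min y (- B - 1)"] bexI[of _ "max y (B + 1)"]) auto
  then have "\<not> bounded {..y}" "\<not> bounded {y..}"
    unfolding bounded_iff real_norm_def by (meson not_less)+
  then have "{..y} \<inter> fibre_roots Q x \<noteq> {}" "{y..} \<inter> fibre_roots Q x \<noteq> {}"
    using adapted_fibre_interval[OF assms(1,2), of "{..y}" y] adapted_fibre_interval[OF assms(1,2), of "{y..}" y]
      assms(4) bdd by auto
  then show "\<exists>r\<in>fibre_roots Q x. r \<le> y" "\<exists>r\<in>fibre_roots Q x. y \<le> r" by auto
qed

text \<open>Each root graph and each open strip between consecutive graphs lies in \<open>S\<close>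
  or misses it; \<open>G\<close> and \<open>B\<close> index those inside \<open>S\<close>. Since
  \<open>S\<close> is closed, both edges of a strip in \<open>S\<close> are in \<open>S\<close>. A
  band is a maximal run of strips, or a single graph, and is indexed by its top root: an index in
  \<open>G\<close> whose strip above is not in \<open>B\<close>.\<close>

lemma band_decomposition:
  assumes ad: "adapted S Q C" and S: "compact S" and I: "connected I" "I \<inter> C = {}"
  obtains J :: "nat set" and a b where "finite J"
    "\<And>j. j \<in> J \<Longrightarrow> continuous_on I (a j)" "\<And>j. j \<in> J \<Longrightarrow> continuous_on I (b j)"
    "\<And>j x. j \<in> J \<Longrightarrow> x \<in> I \<Longrightarrow> a j x \<le> b j x"
    "\<And>i j x. i \<in> J \<Longrightarrow> j \<in> J \<Longrightarrow> i < j \<Longrightarrow> x \<in> I \<Longrightarrow> b i x < a j x"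
    "\<And>j x. j \<in> J \<Longrightarrow> x \<in> I \<Longrightarrow> eval_xy Q (x, a j x) = 0"
    "\<And>j x. j \<in> J \<Longrightarrow> x \<in> I \<Longrightarrow> eval_xy Q (x, b j x) = 0"
    "\<And>x y. x \<in> I \<Longrightarrow> (x, y) \<in> S \<longleftrightarrow> (\<exists>j\<in>J. a j x \<le> y \<and> y \<le> b j x)"
proof -
  obtain N :: nat and f where f: "\<And>k. k < N \<Longrightarrow> continuous_on I (f k)"
    "\<And>x i j. x \<in> I \<Longrightarrow> i < j \<Longrightarrow> j < N \<Longrightarrow> f i x < f j x"
    "\<And>x. x \<in> I \<Longrightarrow> fibre_roots Q x = (\<lambda>k. f k x) ` {..<N}"
    using root_functions[OF I(1), of Q] adapted_regular_fibre[OF ad] I(2) by blast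
  have f_le: "f i x \<le> f j x" if "x \<in> I" "i \<le> j" "j < N" for i j x
    using f(2)[OF that(1), of i j] that by (cases "i = j") auto
  define G where "G = {k. k < N \<and> (\<forall>x\<in>I. (x, f k x) \<in> S)}"
  define X where "X = (\<lambda>k. (\<lambda>(x, t). (x, (1 - t) * f k x + t * f (Suc k) x)) ` (I \<times> {0<..<1}))"
  define B where "B = {k. Suc k < N \<and> X k \<subseteq> S}"
  have G: "k \<in> G" if "k < N" "x \<in> I" "(x, f k x) \<in> S" for k x
  proof -
    have "\<forall>x\<in>I. eval_xy Q (x, f k x) = 0"
      using f(3) that(1) by (auto simp: fibre_roots_def set_eq_iff)
    then have "(\<forall>x\<in>I. (x, f k x) \<in> S) \<or> (\<forall>x\<in>I. (x, f k x) \<notin> S)"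
      using ad I f(1)[OF that(1)] unfolding adapted_def by blast
    then show ?thesis using that by (auto simp: G_def)
  qed
  have memX: "(x, y) \<in> X k" if "Suc k < N" "x \<in> I" "f k x < y" "y < f (Suc k) x" for k x y
  proof -
    define t where "t = (y - f k x) / (f (Suc k) x - f k x)"
    have "t \<in> {0<..<1}" using that by (simp add: t_def)
    then have mem: "(x, t) \<in> I \<times> {0<..<1}" using that(2) by blast
    have "t * (f (Suc k) x - f k x) = y - f k x" using that by (simp add: t_def)
    then have eq: "y = (1 - t) * f k x + t * f (Suc k) x"
      by (simp add: algebra_simps)
    show ?thesis unfolding X_def
      by (rule image_eqI[where x = "(x, t)", OF _ mem]) (simp only: eq[symmetric] case_prod_conv)
  qed
  have X_between: "x \<in> I \<and> f k x < y \<and> y < f (Suc k) x" if "(x, y) \<in> X k" "Suc k < N" for k x y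
  proof -
    from that(1)[unfolded X_def]
    obtain p where p: "(x, y) = (\<lambda>(x, t). (x, (1 - t) * f k x + t * f (Suc k) x)) p" "p \<in> I \<times> {0<..<1}"
      by (rule imageE)
    obtain x' t where "p = (x', t)" by (cases p)
    with p have t: "0 < t" "t < 1" and x: "x \<in> I" and y: "y = (1 - t) * f k x + t * f (Suc k) x"
      by auto
    have d: "f (Suc k) x - f k x > 0" using f(2)[OF x, of k "Suc k"] that(2) by simp
    have "y - f k x = t * (f (Suc k) x - f k x)" "f (Suc k) x - y = (1 - t) * (f (Suc k) x - f k x)"
      by (simp_all add: y algebra_simps)
    moreover have "t * (f (Suc k) x - f k x) > 0" "(1 - t) * (f (Suc k) x - f k x) > 0"
      using t d by simp_all
    ultimately show ?thesis using x by linarith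
  qed
  have B: "k \<in> B" if k: "Suc k < N" and x: "x \<in> I" "(x, y) \<in> S" "f k x < y" "y < f (Suc k) x" for k x y
  proof -
    have "connected (X k)" unfolding X_def split_def
      by (intro connected_continuous_image connected_Times I(1) connected_Ioo continuous_intros
          continuous_on_compose2[OF f(1)]) (use k in auto)
    moreover have "fst ` X k \<inter> C = {}" using I(2) by (auto simp: X_def)
    moreover have "eval_xy Q z \<noteq> 0" if z: "z \<in> X k" for z
    proof
      assume "eval_xy Q z = 0"
      moreover have *: "fst z \<in> I \<and> f k (fst z) < snd z \<and> snd z < f (Suc k) (fst z)"
        using X_between[of "fst z" "snd z" k] z k by simp
      ultimately have "snd z \<in> (\<lambda>k. f k (fst z)) ` {..<N}"
        using f(3)[of "fst z"] by (auto simp: fibre_roots_def)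
      then obtain i where i: "i < N" "snd z = f i (fst z)" by auto
      then show False
        using * f_le[of "fst z" i k] f_le[of "fst z" "Suc k" i] k by (cases "i \<le> k") auto
    qed
    ultimately have "X k \<subseteq> S \<or> X k \<inter> S = {}" using ad unfolding adapted_def by blast
    then show ?thesis using memX[OF k x(1,3,4)] x(2) k by (auto simp: B_def)
  qed
  have BG: "k \<in> G \<and> Suc k \<in> G" if "k \<in> B" for k
  proof -
    have k: "Suc k < N" "X k \<subseteq> S" using that by (auto simp: B_def)
    have "(x, f k x) \<in> S \<and> (x, f (Suc k) x) \<in> S" if x: "x \<in> I" for x
    proof -
      have "closed (Pair x -` S)"
        by (intro closed_vimage compact_imp_closed S continuous_intros)
      moreover have "{f k x<..<f (Suc k) x} \<subseteq> Pair x -` S"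
        using memX[OF k(1) x] subsetD[OF k(2)] by (intro subsetI) simp
      ultimately have "closure {f k x<..<f (Suc k) x} \<subseteq> Pair x -` S" by (rule closure_minimal[rotated])
      moreover have "f k x < f (Suc k) x" using f(2)[OF x] k by simp
      ultimately show ?thesis by (auto simp: subset_iff)
    qed
    then show ?thesis using k by (auto simp: G_def)
  qed
  \<comment> \<open>The bottom root of the band with top \<open>l\<close>; it is \<open>l\<close>
    itself when the band is a single graph.\<close>
  define a where "a = (\<lambda>l. LEAST k. {k..<l} \<subseteq> B)"
  have a: "a l \<le> l" "{a l..<l} \<subseteq> B" "\<And>k. {k..<l} \<subseteq> B \<Longrightarrow> a l \<le> k" for l
  proof -
    have "{l..<l} \<subseteq> B" by simp
    then show "a l \<le> l" unfolding a_def by (rule Least_le[of "\<lambda>k. {k..<l} \<subseteq> B"])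
    show "{a l..<l} \<subseteq> B" unfolding a_def by (rule LeastI[of "\<lambda>k. {k..<l} \<subseteq> B" l]) simp
    show "a l \<le> k" if "{k..<l} \<subseteq> B" for k
      unfolding a_def using that by (rule Least_le[of "\<lambda>k. {k..<l} \<subseteq> B"])
  qed
  have lessN: "k < N" if "k \<in> G" for k using that by (simp add: G_def)
  show thesis
  proof (rule that[of "G - B" "\<lambda>l. f (a l)" f])
    show "finite (G - B)" by (rule finite_subset[of _ "{..<N}"]) (auto simp: G_def)
    show "continuous_on I (f (a l))" if "l \<in> G - B" for l
      using that a(1)[of l] lessN[of l] by (intro f(1)) auto
    show "continuous_on I (f l)" if "l \<in> G - B" for l using that lessN by (intro f(1)) auto
    show "f (a l) x \<le> f l x" if "l \<in> G - B" "x \<in> I" for l x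
      using that a(1) lessN by (intro f_le) auto
    show "f i x < f (a j) x" if "i \<in> G - B" "j \<in> G - B" "i < j" "x \<in> I" for i j x
    proof -
      have "i \<notin> {a j..<j}" using a(2) that(1) by blast
      then have "i < a j" using that(3) by auto
      then show ?thesis using f(2)[OF that(4)] a(1)[of j] lessN[of j] that(2) by auto
    qed
    have root: "eval_xy Q (x, f k x) = 0" if "k < N" "x \<in> I" for k x
      using f(3)[OF that(2)] that(1) by (auto simp: fibre_roots_def set_eq_iff)
    show "eval_xy Q (x, f (a l) x) = 0" if "l \<in> G - B" "x \<in> I" for l x
      using that a(1)[of l] lessN[of l] by (intro root) auto
    show "eval_xy Q (x, f l x) = 0" if "l \<in> G - B" "x \<in> I" for l x
      using that lessN by (intro root) auto
    show "(x, y) \<in> S \<longleftrightarrow> (\<exists>l\<in>G - B. f (a l) x \<le> y \<and> y \<le> f l x)" if x: "x \<in> I" for x y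
    proof
      assume xy: "(x, y) \<in> S"
      have "x \<notin> C" using x I(2) by auto
      note around = adapted_roots_around[OF ad this compact_imp_bounded[OF S] xy, unfolded f(3)[OF x]]
      define k where "k = Max {k. k < N \<and> f k x \<le> y}"
      have fin: "finite {k. k < N \<and> f k x \<le> y}" by simp
      have "{k. k < N \<and> f k x \<le> y} \<noteq> {}" using around(1) by auto
      from Max_in[OF fin this] have k: "k < N" "f k x \<le> y" by (auto simp: k_def)
      have kmax: "i \<le> k" if "i < N" "f i x \<le> y" for i
        unfolding k_def using that fin by (intro Max_ge) auto
      have next_gt: "Suc k < N \<and> y < f (Suc k) x" if "y \<noteq> f k x"
      proof -
        obtain i where i: "i < N" "y \<le> f i x" using around(2) by auto
        have "k < i" using i k that f_le[OF x, of i k] by (cases "k < i") auto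
        then show ?thesis using kmax[of "Suc k"] i by force
      qed
      have kG: "k \<in> G \<and> (y = f k x \<or> k \<in> B \<and> y \<le> f (Suc k) x)"
      proof (cases "y = f k x")
        case True
        then show ?thesis using G[OF k(1) x] xy by simp
      next
        case False
        then have "k \<in> B" using B[OF _ x xy, of k] next_gt k by auto
        then show ?thesis using BG next_gt[OF False] by auto
      qed
      \<comment> \<open>Climbing from \<open>k\<close> through strips inside \<open>S\<close> leads
        to the top of the band. The climb stops because \<open>N\<close>, the number of roots, is
        never in \<open>B\<close>.\<close>
      define l where "l = (LEAST l. k \<le> l \<and> l \<notin> B)"
      have "k \<le> N \<and> N \<notin> B" using k by (auto simp: B_def)
      then have l: "k \<le> l" "l \<notin> B" unfolding l_def by (metis (mono_tags, lifting) LeastI)+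
      have between: "i \<in> B" if "k \<le> i" "i < l" for i
        using not_less_Least[of i "\<lambda>l. k \<le> l \<and> l \<notin> B"] that by (auto simp: l_def)
      have lG: "l \<in> G"
      proof (cases "l = k")
        case False
        then have "l - 1 \<in> B" using l between[of "l - 1"] by auto
        then show ?thesis using BG[of "l - 1"] False l by (cases l) auto
      qed (use kG in simp)
      have "{k..<l} \<subseteq> B" using between by auto
      then have "a l \<le> k" by (rule a(3))
      then have "f (a l) x \<le> y" using f_le[OF x, of "a l" k] k by linarith
      moreover have "y \<le> f l x"
      proof (cases "y = f k x")
        case True
        then show ?thesis using f_le[OF x, of k l] l lessN[OF lG] by simp
      next
        case False
        then have "k \<in> B" "y \<le> f (Suc k) x" using kG by auto
        moreover have "Suc k \<le> l" using \<open>k \<in> B\<close> l by (metis Suc_leI le_neq_implies_less)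
        ultimately show ?thesis using f_le[OF x, of "Suc k" l] lessN[OF lG] by simp
      qed
      ultimately show "\<exists>l\<in>G - B. f (a l) x \<le> y \<and> y \<le> f l x" using lG l by blast
    next
      assume "\<exists>l\<in>G - B. f (a l) x \<le> y \<and> y \<le> f l x"
      then obtain l where l: "l \<in> G" "f (a l) x \<le> y" "y \<le> f l x" by blast
      define k where "k = Max {k. k \<le> l \<and> f k x \<le> y}"
      have fin: "finite {k. k \<le> l \<and> f k x \<le> y}" by simp
      have ne: "{k. k \<le> l \<and> f k x \<le> y} \<noteq> {}" using l(2) a(1) by blast
      from Max_in[OF fin ne] have k: "k \<le> l" "f k x \<le> y" by (auto simp: k_def)
      have kmax: "i \<le> k" if "i \<le> l" "f i x \<le> y" for i
        unfolding k_def using that fin by (intro Max_ge) auto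
      have "a l \<le> k" using kmax[of "a l"] l a(1) by blast
      show "(x, y) \<in> S"
      proof (cases "k = l")
        case True
        then show ?thesis using l k x by (auto simp: G_def)
      next
        case False
        then have kB: "k \<in> B" using a(2)[of l] \<open>a l \<le> k\<close> k by auto
        have "y < f (Suc k) x" using kmax[of "Suc k"] False k by force
        moreover have "(x, f k x) \<in> S" using BG[OF kB] x by (simp add: G_def)
        ultimately show ?thesis
          using k(2) memX[of k x y] kB x by (cases "y = f k x") (auto simp: B_def)
      qed
    qed
  qed
qed

section \<open>Components of pixelated slices\<close>


text \<open>As the family is finite, the union of all members but one is closed, so a connected set
  that contains one member cannot reach another.\<close>

lemma components_closed_unique:
  assumes fin: "finite \<A>" and disj: "disjoint \<A>" and X: "\<Union>\<A> = X"
    and cl: "\<And>A. A \<in> \<A> \<Longrightarrow> closed A \<and> connected A \<and> A \<noteq> {}"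
  shows "components X = \<A>"
proof -
  have comp: "A \<in> components X" if A: "A \<in> \<A>" for A
    unfolding in_components_maximal
  proof (intro conjI allI impI)
    show "A \<noteq> {}" "A \<subseteq> X" "connected A" using cl[OF A] A X by auto
    fix D assume D: "D \<noteq> {} \<and> A \<subseteq> D \<and> D \<subseteq> X \<and> connected D"
    define R where "R = \<Union>(\<A> - {A})"
    have "closed R" unfolding R_def using fin cl by (intro closed_Union) auto
    moreover have "A \<inter> R = {}" using disj A unfolding R_def disjoint_def by blast
    moreover have "D \<subseteq> A \<union> R" using D X by (auto simp: R_def)
    ultimately have "A \<inter> D = {} \<or> R \<inter> D = {}"
      using D cl[OF A] connected_closedD[of D A R] by blast
    then have "R \<inter> D = {}" using D cl[OF A] by blast
    then show "D = A" using D \<open>D \<subseteq> A \<union> R\<close> by blast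
  qed
  have "K \<in> \<A>" if K: "K \<in> components X" for K
  proof -
    obtain z where z: "z \<in> K" using in_components_nonempty[OF K] by blast
    then obtain A where A: "A \<in> \<A>" "z \<in> A" using in_components_subset[OF K] X by blast
    have "K = A" using components_eq[OF K comp[OF A(1)]] z A(2) by blast
    then show ?thesis using A(1) by simp
  qed
  with comp show ?thesis by blast
qed

lemma card_components_closed_family:
  assumes "finite J" "X = (\<Union>j\<in>J. T j)"
    and "\<And>j. j \<in> J \<Longrightarrow> closed (T j) \<and> connected (T j) \<and> T j \<noteq> {}"
    and disj: "\<And>i j. i \<in> J \<Longrightarrow> j \<in> J \<Longrightarrow> i \<noteq> j \<Longrightarrow> T i \<inter> T j = {}"
  shows "card (components X) = card J"
proof -
  have "components X = T ` J"
    using assms by (intro components_closed_unique) (auto simp: disjoint_def)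
  moreover have "inj_on T J" using assms(3) disj unfolding inj_on_def by blast
  ultimately show ?thesis by (simp add: card_image)
qed

section \<open>Pixelated slices as one-dimensional pixelations\<close>

definition grid_interval :: "real \<Rightarrow> int \<Rightarrow> real set" where
  "grid_interval \<epsilon> n = {(of_int n - 1) * \<epsilon> .. of_int n * \<epsilon>}"

text \<open>The union of all grid intervals that contain \<open>x\<close>: a single one in general,
  two when \<open>x\<close> is on the grid, where floor and ceiling agree.\<close>

definition grid_column :: "real \<Rightarrow> real \<Rightarrow> real set" where
  "grid_column \<epsilon> x = {(of_int \<lceil>x / \<epsilon>\<rceil> - 1) * \<epsilon> .. (of_int \<lfloor>x / \<epsilon>\<rfloor> + 1) * \<epsilon>}"

definition line_pixelation :: "real \<Rightarrow> real set \<Rightarrow> real set" where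
  "line_pixelation \<epsilon> Y = \<Union>{grid_interval \<epsilon> n | n. grid_interval \<epsilon> n \<inter> Y \<noteq> {}}"

lemma line_pixelation_iff:
  "y \<in> line_pixelation \<epsilon> Y \<longleftrightarrow> (\<exists>n. y \<in> grid_interval \<epsilon> n \<and> (\<exists>v\<in>Y. v \<in> grid_interval \<epsilon> n))"
  unfolding line_pixelation_def by auto

lemma pixelation_iff:
  "z \<in> pixelation \<epsilon> S \<longleftrightarrow> (\<exists>m n. z \<in> pixel \<epsilon> m n \<and> (\<exists>w\<in>S. w \<in> pixel \<epsilon> m n))"
  unfolding pixelation_def by auto

lemma ceiling_floor_times:
  fixes \<epsilon> x :: real
  assumes "\<epsilon> > 0"
  shows "(of_int \<lceil>x / \<epsilon>\<rceil> - 1) * \<epsilon> \<le> x" "x \<le> (of_int \<lfloor>x / \<epsilon>\<rfloor> + 1) * \<epsilon>"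
    "x \<le> of_int \<lceil>x / \<epsilon>\<rceil> * \<epsilon>" "of_int \<lfloor>x / \<epsilon>\<rfloor> * \<epsilon> \<le> x"
proof -
  have "of_int \<lceil>x / \<epsilon>\<rceil> - 1 \<le> x / \<epsilon>" "x / \<epsilon> \<le> of_int \<lfloor>x / \<epsilon>\<rfloor> + 1"
    "x / \<epsilon> \<le> of_int \<lceil>x / \<epsilon>\<rceil>" "of_int \<lfloor>x / \<epsilon>\<rfloor> \<le> x / \<epsilon>" by linarith+
  then show "(of_int \<lceil>x / \<epsilon>\<rceil> - 1) * \<epsilon> \<le> x" "x \<le> (of_int \<lfloor>x / \<epsilon>\<rfloor> + 1) * \<epsilon>"
    "x \<le> of_int \<lceil>x / \<epsilon>\<rceil> * \<epsilon>" "of_int \<lfloor>x / \<epsilon>\<rfloor> * \<epsilon> \<le> x"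
    by (simp_all only: pos_le_divide_eq[OF assms] pos_divide_le_eq[OF assms])
qed

lemma grid_column_bounds:
  assumes "\<epsilon> > 0" shows "x \<in> grid_column \<epsilon> x" "grid_column \<epsilon> x \<subseteq> {x - \<epsilon>..x + \<epsilon>}"
proof -
  show "x \<in> grid_column \<epsilon> x" "grid_column \<epsilon> x \<subseteq> {x - \<epsilon>..x + \<epsilon>}"
    using ceiling_floor_times[OF assms, of x] by (auto simp: grid_column_def algebra_simps)
qed

text \<open>Pixels are products, and those that meet the line over \<open>x\<close> are the ones in
  its column. So the slice depends only on the heights of the points of \<open>S\<close> over the
  column, wherever in the column they lie.\<close>

lemma pixelation_slice:
  assumes "\<epsilon> > 0"
  shows "pixelation \<epsilon> S \<inter> {p. fst p = x} = {x} \<times> line_pixelation \<epsilon> (snd ` (S \<inter> grid_column \<epsilon> x \<times> UNIV))"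
proof -
  have pix: "pixel \<epsilon> m n = grid_interval \<epsilon> m \<times> grid_interval \<epsilon> n" for m n
    by (simp add: pixel_def grid_interval_def)
  have 1: "grid_interval \<epsilon> m \<subseteq> grid_column \<epsilon> x" if "x \<in> grid_interval \<epsilon> m" for m
  proof -
    have "of_int m - 1 \<le> x / \<epsilon>" "x / \<epsilon> \<le> of_int m"
      using that assms by (simp_all add: grid_interval_def field_simps)
    then have "\<lceil>x / \<epsilon>\<rceil> \<le> m" "m \<le> \<lfloor>x / \<epsilon>\<rfloor> + 1" by linarith+
    then have "(of_int \<lceil>x / \<epsilon>\<rceil> - 1) * \<epsilon> \<le> (of_int m - 1) * \<epsilon>" "of_int m * \<epsilon> \<le> (of_int \<lfloor>x / \<epsilon>\<rfloor> + 1) * \<epsilon>"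
      using assms by (intro mult_right_mono; linarith)+
    then show ?thesis by (auto simp: grid_interval_def grid_column_def)
  qed
  \<comment> \<open>The column is covered by the grid intervals with indices
    \<open>\<lceil>x / \<epsilon>\<rceil>\<close> and
    \<open>\<lfloor>x / \<epsilon>\<rfloor> + 1\<close>, both of which contain
    \<open>x\<close>.\<close>
  have 2: "\<exists>m. x \<in> grid_interval \<epsilon> m \<and> x' \<in> grid_interval \<epsilon> m" if "x' \<in> grid_column \<epsilon> x" for x'
  proof -
    note b = ceiling_floor_times[OF assms, of x]
    show ?thesis
    proof (cases "x' \<le> of_int \<lceil>x / \<epsilon>\<rceil> * \<epsilon>")
      case True
      then show ?thesis using b that
        by (intro exI[of _ "\<lceil>x / \<epsilon>\<rceil>"]) (simp add: grid_interval_def grid_column_def)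
    next
      case False
      then show ?thesis using b that
        by (intro exI[of _ "\<lfloor>x / \<epsilon>\<rfloor> + 1"]) (simp add: grid_interval_def grid_column_def)
    qed
  qed
  have "(x', y) \<in> pixelation \<epsilon> S \<and> x' = x \<longleftrightarrow>
      x' = x \<and> y \<in> line_pixelation \<epsilon> (snd ` (S \<inter> grid_column \<epsilon> x \<times> UNIV))" for x' y
  proof (intro iffI conjI)
    assume *: "(x', y) \<in> pixelation \<epsilon> S \<and> x' = x"
    then obtain m n w where mn: "x \<in> grid_interval \<epsilon> m" "y \<in> grid_interval \<epsilon> n"
      "w \<in> S" "fst w \<in> grid_interval \<epsilon> m" "snd w \<in> grid_interval \<epsilon> n"
      unfolding pixelation_iff pix by (metis mem_Times_iff fst_conv snd_conv)
    then have "w \<in> S \<inter> grid_column \<epsilon> x \<times> UNIV" using 1[OF mn(1)] by (auto simp: mem_Times_iff)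
    then show "y \<in> line_pixelation \<epsilon> (snd ` (S \<inter> grid_column \<epsilon> x \<times> UNIV))"
      unfolding line_pixelation_iff using mn(2,5) by blast
    show "x' = x" using * by simp
  next
    assume *: "x' = x \<and> y \<in> line_pixelation \<epsilon> (snd ` (S \<inter> grid_column \<epsilon> x \<times> UNIV))"
    then obtain n v where n: "y \<in> grid_interval \<epsilon> n" "v \<in> grid_interval \<epsilon> n"
      "v \<in> snd ` (S \<inter> grid_column \<epsilon> x \<times> UNIV)"
      unfolding line_pixelation_iff by blast
    then obtain w where w: "w \<in> S" "fst w \<in> grid_column \<epsilon> x" "v = snd w" by (auto simp: mem_Times_iff)
    obtain m where m: "x \<in> grid_interval \<epsilon> m" "fst w \<in> grid_interval \<epsilon> m" using 2[OF w(2)] by blast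
    show "(x', y) \<in> pixelation \<epsilon> S"
      unfolding pixelation_iff pix mem_Times_iff using m n w * by auto
    show "x' = x" using * by simp
  qed
  then show ?thesis by (auto simp: set_eq_iff)
qed

lemma subset_line_pixelation:
  assumes "\<epsilon> > 0" shows "Y \<subseteq> line_pixelation \<epsilon> Y"
proof
  fix y assume y: "y \<in> Y"
  have "y \<in> grid_interval \<epsilon> \<lceil>y / \<epsilon>\<rceil>"
    using ceiling_floor_times[OF assms, of y] by (simp add: grid_interval_def)
  then show "y \<in> line_pixelation \<epsilon> Y" using y unfolding line_pixelation_def by blast
qed

lemma connected_line_pixelation:
  assumes "\<epsilon> > 0" "connected Y" shows "connected (line_pixelation \<epsilon> Y)"
proof (cases "Y = {}")
  case False
  then obtain y where y: "y \<in> Y" by blast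
  let ?A = "{Y \<union> grid_interval \<epsilon> n | n. grid_interval \<epsilon> n \<inter> Y \<noteq> {}}"
  have "connected (\<Union>?A)"
  proof (rule connected_Union)
    show "\<Inter>?A \<noteq> {}" using y by blast
    show "connected s" if s: "s \<in> ?A" for s
    proof -
      from s obtain n where n: "s = Y \<union> grid_interval \<epsilon> n" "grid_interval \<epsilon> n \<inter> Y \<noteq> {}" by blast
      show ?thesis unfolding n(1)
        by (rule connected_Un[OF assms(2)]) (use n(2) in \<open>auto simp: grid_interval_def\<close>)
    qed
  qed
  moreover have "\<Union>?A = line_pixelation \<epsilon> Y"
  proof
    show "\<Union>?A \<subseteq> line_pixelation \<epsilon> Y"
      using subset_line_pixelation[OF assms(1), of Y] unfolding line_pixelation_def by blast
    show "line_pixelation \<epsilon> Y \<subseteq> \<Union>?A" unfolding line_pixelation_def by blast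
  qed
  ultimately show ?thesis by simp
qed (simp add: line_pixelation_def)

lemma closed_line_pixelation:
  assumes "\<epsilon> > 0" "bounded Y" shows "closed (line_pixelation \<epsilon> Y)"
proof -
  obtain B where B: "\<And>y. y \<in> Y \<Longrightarrow> \<bar>y\<bar> \<le> B" using assms(2) unfolding bounded_iff by auto
  have "n \<in> {\<lfloor>- B / \<epsilon>\<rfloor>..\<lceil>B / \<epsilon>\<rceil> + 1}" if n: "grid_interval \<epsilon> n \<inter> Y \<noteq> {}" for n
  proof -
    obtain y where y: "y \<in> Y" "(of_int n - 1) * \<epsilon> \<le> y" "y \<le> of_int n * \<epsilon>"
      using n by (auto simp: grid_interval_def)
    then have "(of_int n - 1) * \<epsilon> \<le> B" "- B \<le> of_int n * \<epsilon>" using B[OF y(1)] by linarith+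
    then have "of_int n - 1 \<le> B / \<epsilon>" "- B / \<epsilon> \<le> of_int n" using assms(1) by (simp_all add: field_simps)
    then show ?thesis by simp linarith
  qed
  then have "{n. grid_interval \<epsilon> n \<inter> Y \<noteq> {}} \<subseteq> {\<lfloor>- B / \<epsilon>\<rfloor>..\<lceil>B / \<epsilon>\<rceil> + 1}" by blast
  then have "finite {n. grid_interval \<epsilon> n \<inter> Y \<noteq> {}}" by (rule finite_subset) simp
  then have "finite {grid_interval \<epsilon> n | n. grid_interval \<epsilon> n \<inter> Y \<noteq> {}}" by simp
  then show ?thesis unfolding line_pixelation_def
    by (rule closed_Union) (auto simp: grid_interval_def)
qed

text \<open>Every point of a pixelated piece is within \<epsilon> of the piece in height, so pieces
  more than \<open>2 * \<epsilon>\<close> apart stay disjoint, while connected pieces stay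
  connected. The pieces are connected as subsets of the plane over the column; over \<open>x\<close>
  itself a piece may be disconnected or empty.\<close>

lemma slice_components_pixelation:
  assumes "\<epsilon> > 0" "bounded S" "finite J"
    and conn: "\<And>j. j \<in> J \<Longrightarrow> connected (T j) \<and> T j \<noteq> {}"
    and sep: "\<And>i j z w. i \<in> J \<Longrightarrow> j \<in> J \<Longrightarrow> i \<noteq> j \<Longrightarrow> z \<in> T i \<Longrightarrow> w \<in> T j \<Longrightarrow> \<bar>snd z - snd w\<bar> > 2 * \<epsilon>"
    and S: "S \<inter> grid_column \<epsilon> x \<times> UNIV = (\<Union>j\<in>J. T j)"
  shows "slice_components (pixelation \<epsilon> S) x = card J"
proof -
  have "pixelation \<epsilon> S \<inter> {p. fst p = x} = {x} \<times> line_pixelation \<epsilon> (\<Union>j\<in>J. snd ` T j)"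
    by (simp add: pixelation_slice[OF assms(1)] S image_UN)
  also have "\<dots> = (\<Union>j\<in>J. {x} \<times> line_pixelation \<epsilon> (snd ` T j))"
    unfolding line_pixelation_def by blast
  finally have eq: "pixelation \<epsilon> S \<inter> {p. fst p = x} = (\<Union>j\<in>J. {x} \<times> line_pixelation \<epsilon> (snd ` T j))" .
  have "card (components (pixelation \<epsilon> S \<inter> {p. fst p = x})) = card J"
  proof (rule card_components_closed_family[OF \<open>finite J\<close> eq])
    fix j assume j: "j \<in> J"
    have "T j \<subseteq> S" using S j by blast
    then have "bounded (snd ` T j)" using assms(2) bounded_subset bounded_snd by blast
    moreover have "connected (snd ` T j)"
      using conn[OF j] by (intro connected_continuous_image continuous_intros) auto
    moreover have "line_pixelation \<epsilon> (snd ` T j) \<noteq> {}"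
      using subset_line_pixelation[OF assms(1), of "snd ` T j"] conn[OF j] by blast
    ultimately show "closed ({x} \<times> line_pixelation \<epsilon> (snd ` T j)) \<and>
         connected ({x} \<times> line_pixelation \<epsilon> (snd ` T j)) \<and> {x} \<times> line_pixelation \<epsilon> (snd ` T j) \<noteq> {}"
      using assms(1) by (simp add: closed_Times connected_Times closed_line_pixelation connected_line_pixelation)
  next
    fix i j assume ij: "i \<in> J" "j \<in> J" "i \<noteq> j"
    have False if v: "v \<in> line_pixelation \<epsilon> (snd ` T i)" "v \<in> line_pixelation \<epsilon> (snd ` T j)" for v
    proof -
      have near: "\<exists>z\<in>T k. \<bar>v - snd z\<bar> \<le> \<epsilon>" if k: "v \<in> line_pixelation \<epsilon> (snd ` T k)" for k
      proof -
        obtain n z where "v \<in> grid_interval \<epsilon> n" "z \<in> T k" "snd z \<in> grid_interval \<epsilon> n"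
          using k unfolding line_pixelation_iff by blast
        then show ?thesis by (intro bexI[of _ z]) (auto simp: grid_interval_def algebra_simps)
      qed
      obtain z w where "z \<in> T i" "w \<in> T j" "\<bar>v - snd z\<bar> \<le> \<epsilon>" "\<bar>v - snd w\<bar> \<le> \<epsilon>"
        using near v by meson
      with sep[OF ij this(1,2)] show False by linarith
    qed
    then show "{x} \<times> line_pixelation \<epsilon> (snd ` T i) \<inter> {x} \<times> line_pixelation \<epsilon> (snd ` T j) = {}" by blast
  qed
  then show ?thesis by (simp add: slice_components_def)
qed

section \<open>Slices away from the exceptional abscissae\<close>


text \<open>Only the continuity of the remainder factor \<open>T\<close> is recorded: on a compact
  box it gives a bound uniform in all three variables.\<close>

lemma eval_xy_taylor:
  "\<exists>T :: real \<times> real \<times> real \<Rightarrow> real. continuous_on UNIV T \<and>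
     (\<forall>x y s. eval_xy Q (x, y + s) = eval_xy Q (x, y) + s * eval_xy (pderiv Q) (x, y) + s\<^sup>2 * T (x, y, s))"
proof (induction Q)
  case 0
  show ?case by (intro exI[of _ "\<lambda>_. 0"]) auto
next
  case (pCons a Q)
  then obtain T where T: "continuous_on UNIV T"
    "\<And>x y s. eval_xy Q (x, y + s) = eval_xy Q (x, y) + s * eval_xy (pderiv Q) (x, y) + s\<^sup>2 * T (x, y, s)"
    by blast
  show ?case
  proof (intro exI conjI allI)
    \<comment> \<open>The new remainder collects the terms with \<open>s\<^sup>2\<close> when
      \<open>(y + s) * eval_xy Q (x, y + s)\<close> is expanded by the induction hypothesis.\<close>
    show "continuous_on UNIV (\<lambda>w. eval_xy (pderiv Q) (fst w, fst (snd w)) + (fst (snd w) + snd (snd w)) * T w)"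
      by (intro continuous_intros T(1))
    show "eval_xy (pCons a Q) (x, y + s) = eval_xy (pCons a Q) (x, y) + s * eval_xy (pderiv (pCons a Q)) (x, y) +
        s\<^sup>2 * (eval_xy (pderiv Q) (fst (x, y, s), fst (snd (x, y, s))) +
          (fst (snd (x, y, s)) + snd (snd (x, y, s))) * T (x, y, s))" for x y s
    proof -
      have "eval_xy (pCons a Q) (x, y + s) = poly a x + (y + s) * eval_xy Q (x, y + s)" by simp
      then show ?thesis unfolding T(2)[of x y s]
        by (simp add: pderiv_pCons algebra_simps power2_eq_square)
    qed
  qed
qed

lemma poly_difference_quotient:
  fixes a :: "real poly"
  shows "\<exists>k :: real \<times> real \<Rightarrow> real. continuous_on UNIV k \<and> (\<forall>x x'. poly a x' - poly a x = (x' - x) * k (x, x'))"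
proof (induction a)
  case 0
  show ?case by (intro exI[of _ "\<lambda>_. 0"]) auto
next
  case (pCons c a)
  then obtain k where k: "continuous_on UNIV k" "\<And>x x'. poly a x' - poly a x = (x' - x) * k (x, x')" by blast
  show ?case
  proof (intro exI conjI allI)
    show "continuous_on UNIV (\<lambda>w. poly a (fst w) + snd w * k w)" by (intro continuous_intros k(1))
    have "x' * poly a x' - x * poly a x = x' * (poly a x' - poly a x) + (x' - x) * poly a x" for x x'
      by (simp add: algebra_simps)
    then show "poly (pCons c a) x' - poly (pCons c a) x = (x' - x) * (poly a (fst (x, x')) + snd (x, x') * k (x, x'))" for x x'
      by (simp add: k(2) algebra_simps)
  qed
qed

lemma eval_xy_difference_quotient:
  "\<exists>K :: real \<times> real \<times> real \<Rightarrow> real. continuous_on UNIV K \<and>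
     (\<forall>x x' y. eval_xy Q (x', y) - eval_xy Q (x, y) = (x' - x) * K (x, x', y))"
proof (induction Q)
  case 0
  show ?case by (intro exI[of _ "\<lambda>_. 0"]) auto
next
  case (pCons a Q)
  then obtain K where K: "continuous_on UNIV K"
    "\<And>x x' y. eval_xy Q (x', y) - eval_xy Q (x, y) = (x' - x) * K (x, x', y)" by blast
  obtain k where k: "continuous_on UNIV k" "\<And>x x'. poly a x' - poly a x = (x' - x) * k (x, x')"
    using poly_difference_quotient by blast
  have ck: "continuous_on UNIV (\<lambda>w::real \<times> real \<times> real. k (fst w, fst (snd w)))"
    by (rule continuous_on_compose2[OF k(1)]) (auto intro!: continuous_intros)
  show ?case
  proof (intro exI conjI allI)
    show "continuous_on UNIV (\<lambda>w. k (fst w, fst (snd w)) + snd (snd w) * K w)"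
      by (intro continuous_intros K(1) ck)
    fix x x' y
    have "eval_xy (pCons a Q) (x', y) - eval_xy (pCons a Q) (x, y)
        = (poly a x' - poly a x) + y * (eval_xy Q (x', y) - eval_xy Q (x, y))"
      by (simp add: algebra_simps)
    then show "eval_xy (pCons a Q) (x', y) - eval_xy (pCons a Q) (x, y) =
        (x' - x) * (k (fst (x, x', y), fst (snd (x, x', y))) + snd (snd (x, x', y)) * K (x, x', y))"
      by (simp add: k(2) K(2) algebra_simps)
  qed
qed

lemma compact_continuous_abs_bound:
  fixes f :: "'a::topological_space \<Rightarrow> real"
  assumes "compact X" "continuous_on X f"
  obtains M where "M \<ge> 1" "\<And>x. x \<in> X \<Longrightarrow> \<bar>f x\<bar> \<le> M"
proof -
  have "bounded (f ` X)" using assms compact_continuous_image compact_imp_bounded by blast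
  then obtain M where "\<And>x. x \<in> X \<Longrightarrow> \<bar>f x\<bar> \<le> M" by (auto simp: bounded_iff)
  then show thesis by (intro that[of "max 1 M"]) (auto intro: max.coboundedI2)
qed

lemma eval_xy_local_bounds:
  obtains M where "M \<ge> 1"
    "\<And>x y s. \<bar>x\<bar> \<le> R \<Longrightarrow> \<bar>y\<bar> \<le> R \<Longrightarrow> \<bar>s\<bar> \<le> 1 \<Longrightarrow>
       \<bar>eval_xy Q (x, y + s) - eval_xy Q (x, y) - s * eval_xy (pderiv Q) (x, y)\<bar> \<le> M * s\<^sup>2"
    "\<And>x x' y. \<bar>x\<bar> \<le> R \<Longrightarrow> \<bar>x'\<bar> \<le> R \<Longrightarrow> \<bar>y\<bar> \<le> R \<Longrightarrow>
       \<bar>eval_xy Q (x', y) - eval_xy Q (x, y)\<bar> \<le> M * \<bar>x' - x\<bar>"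
proof -
  obtain T where T: "continuous_on UNIV T"
    "\<And>x y s. eval_xy Q (x, y + s) = eval_xy Q (x, y) + s * eval_xy (pderiv Q) (x, y) + s\<^sup>2 * T (x, y, s)"
    using eval_xy_taylor by blast
  obtain K where K: "continuous_on UNIV K"
    "\<And>x x' y. eval_xy Q (x', y) - eval_xy Q (x, y) = (x' - x) * K (x, x', y)"
    using eval_xy_difference_quotient by blast
  have "compact ({-R..R} \<times> {-R..R} \<times> {-1..1::real})" by (intro compact_Times compact_Icc)
  then obtain M1 where M1: "M1 \<ge> 1" "\<And>w. w \<in> {-R..R} \<times> {-R..R} \<times> {-1..1} \<Longrightarrow> \<bar>T w\<bar> \<le> M1"
    by (rule compact_continuous_abs_bound[OF _ continuous_on_subset[OF T(1)]]) auto
  have "compact ({-R..R} \<times> {-R..R} \<times> {-R..R})" by (intro compact_Times compact_Icc)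
  then obtain M2 where M2: "M2 \<ge> 1" "\<And>w. w \<in> {-R..R} \<times> {-R..R} \<times> {-R..R} \<Longrightarrow> \<bar>K w\<bar> \<le> M2"
    by (rule compact_continuous_abs_bound[OF _ continuous_on_subset[OF K(1)]]) auto
  show thesis
  proof (rule that[of "max M1 M2"])
    show "max M1 M2 \<ge> 1" using M1(1) by simp
    fix x y s :: real assume *: "\<bar>x\<bar> \<le> R" "\<bar>y\<bar> \<le> R" "\<bar>s\<bar> \<le> 1"
    have "\<bar>eval_xy Q (x, y + s) - eval_xy Q (x, y) - s * eval_xy (pderiv Q) (x, y)\<bar> = \<bar>T (x, y, s)\<bar> * s\<^sup>2"
      by (simp add: T(2) abs_mult)
    also have "\<dots> \<le> max M1 M2 * s\<^sup>2"
      using M1(2)[of "(x, y, s)"] * by (intro mult_right_mono max.coboundedI1) (auto simp: abs_le_iff)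
    finally show "\<bar>eval_xy Q (x, y + s) - eval_xy Q (x, y) - s * eval_xy (pderiv Q) (x, y)\<bar> \<le> max M1 M2 * s\<^sup>2" .
  next
    fix x x' y :: real assume *: "\<bar>x\<bar> \<le> R" "\<bar>x'\<bar> \<le> R" "\<bar>y\<bar> \<le> R"
    have "\<bar>eval_xy Q (x', y) - eval_xy Q (x, y)\<bar> = \<bar>K (x, x', y)\<bar> * \<bar>x' - x\<bar>"
      by (simp add: K(2) abs_mult)
    also have "\<dots> \<le> max M1 M2 * \<bar>x' - x\<bar>"
      using M2(2)[of "(x, x', y)"] * by (intro mult_right_mono max.coboundedI2) (auto simp: abs_le_iff)
    finally show "\<bar>eval_xy Q (x', y) - eval_xy Q (x, y)\<bar> \<le> max M1 M2 * \<bar>x' - x\<bar>" .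
  qed
qed

text \<open>A one-variable Lojasiewicz inequality. All real roots of \<open>r\<close> are in
  \<open>C\<close>, so each linear factor is at least \<open>d\<close> in absolute value and raises
  the exponent by one; a factor without real roots has a positive minimum on the compact
  interval.\<close>

lemma poly_lower_bound_away_from_roots:
  fixes r :: "real poly"
  assumes "\<And>x. x \<notin> C \<Longrightarrow> poly r x \<noteq> 0" "r \<noteq> 0"
  shows "\<exists>m>0. \<exists>p. \<forall>x d. \<bar>x\<bar> \<le> R \<longrightarrow> 0 \<le> d \<longrightarrow> (\<forall>c\<in>C. d \<le> \<bar>x - c\<bar>) \<longrightarrow> m * d ^ p \<le> \<bar>poly r x\<bar>"
  using assms
proof (induction "degree r" arbitrary: r rule: less_induct)
  case less
  show ?case
  proof (cases "\<exists>c. poly r c = 0")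
    case True
    then obtain c r' where c: "poly r c = 0" and r: "r = [:- c, 1:] * r'"
      by (auto simp: poly_eq_0_iff_dvd elim!: dvdE)
    have "r' \<noteq> 0" using less.prems(2) r by auto
    then have "degree r' < degree r" by (simp add: r degree_mult_eq del: mult_pCons_left)
    moreover have "poly r' x \<noteq> 0" if "x \<notin> C" for x using less.prems(1)[OF that] by (auto simp: r)
    ultimately obtain m p where m: "m > 0"
      "\<And>x d. \<bar>x\<bar> \<le> R \<Longrightarrow> 0 \<le> d \<Longrightarrow> (\<forall>c\<in>C. d \<le> \<bar>x - c\<bar>) \<Longrightarrow> m * d ^ p \<le> \<bar>poly r' x\<bar>"
      using less.hyps[of r'] \<open>r' \<noteq> 0\<close> by meson
    have "m * d ^ Suc p \<le> \<bar>poly r x\<bar>" if x: "\<bar>x\<bar> \<le> R" "0 \<le> d" "\<forall>c\<in>C. d \<le> \<bar>x - c\<bar>" for x d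
    proof -
      have "c \<in> C" using less.prems(1) c by blast
      then have "d * (m * d ^ p) \<le> \<bar>x - c\<bar> * \<bar>poly r' x\<bar>"
        using x m(2)[OF x] m(1) by (intro mult_mono) auto
      also have "\<dots> = \<bar>poly r x\<bar>" by (simp add: r abs_mult[symmetric] algebra_simps)
      finally show ?thesis by (simp add: algebra_simps)
    qed
    with m(1) show ?thesis by blast
  next
    case False
    have "continuous_on {-R..R} (\<lambda>x. \<bar>poly r x\<bar>)" by (intro continuous_intros)
    then consider "R < 0" | x0 where "\<And>x. \<bar>x\<bar> \<le> R \<Longrightarrow> \<bar>poly r x0\<bar> \<le> \<bar>poly r x\<bar>"
      using continuous_attains_inf[of "{-R..R}" "\<lambda>x. \<bar>poly r x\<bar>"] by fastforce
    then show ?thesis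
    proof cases
      case 1
      then show ?thesis by (intro exI[of _ 1]) auto
    next
      case 2
      then show ?thesis using False by (intro exI[of _ "\<bar>poly r x0\<bar>"] conjI exI[of _ 0]) auto
    qed
  qed
qed

text \<open>At a zero of \<open>Q\<close> the Bezout identity reduces to
  \<open>V * pderiv Q = r\<close>, and \<open>V\<close> is bounded on the box. Capping
  \<open>m\<close> at 1 ensures \<open>m * d ^ p \<le> 1\<close> for \<open>d \<le> 1\<close>, as
  the Taylor estimate covers only steps of length at most 1.\<close>

lemma root_derivative_lower_bound:
  assumes "adapted S Q C"
  obtains m p where "0 < m" "m \<le> 1"
    "\<And>x y d. \<bar>x\<bar> \<le> R \<Longrightarrow> \<bar>y\<bar> \<le> R \<Longrightarrow> 0 < d \<Longrightarrow> (\<forall>c\<in>C. d \<le> \<bar>x - c\<bar>) \<Longrightarrow> eval_xy Q (x, y) = 0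
       \<Longrightarrow> m * d ^ p \<le> \<bar>eval_xy (pderiv Q) (x, y)\<bar>"
proof -
  from assms have "\<exists>U V r. (\<forall>x. x \<notin> C \<longrightarrow> poly r x \<noteq> 0) \<and> U * Q + V * pderiv Q = [:r:]"
    unfolding adapted_def by (elim conjE)
  then obtain U V r where r: "\<And>x. x \<notin> C \<Longrightarrow> poly r x \<noteq> 0" "U * Q + V * pderiv Q = [:r:]" by blast
  have "finite C" using assms by (simp add: adapted_def)
  then obtain x1 where "x1 \<notin> C" using ex_new_if_finite infinite_UNIV_char_0 by blast
  then have "r \<noteq> 0" using r(1) by auto
  then obtain m p where m: "m > 0"
      "\<And>x d. \<bar>x\<bar> \<le> R \<Longrightarrow> 0 \<le> d \<Longrightarrow> (\<forall>c\<in>C. d \<le> \<bar>x - c\<bar>) \<Longrightarrow> m * d ^ p \<le> \<bar>poly r x\<bar>"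
    using poly_lower_bound_away_from_roots[of C r R] r(1) by blast
  have "compact ({-R..R} \<times> {-R..R})" by (intro compact_Times compact_Icc)
  then obtain M where M: "M \<ge> 1" "\<And>w. w \<in> {-R..R} \<times> {-R..R} \<Longrightarrow> \<bar>eval_xy V w\<bar> \<le> M"
    by (rule compact_continuous_abs_bound[OF _ continuous_on_eval_xy[OF continuous_on_id]]) auto
  have bound: "m / M * d ^ p \<le> \<bar>eval_xy (pderiv Q) (x, y)\<bar>"
    if *: "\<bar>x\<bar> \<le> R" "\<bar>y\<bar> \<le> R" "0 < d" "\<forall>c\<in>C. d \<le> \<bar>x - c\<bar>" "eval_xy Q (x, y) = 0" for x y d
  proof -
    have "poly r x = eval_xy (U * Q + V * pderiv Q) (x, y)" by (simp add: r(2))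
    also have "\<dots> = eval_xy V (x, y) * eval_xy (pderiv Q) (x, y)" using * by simp
    finally have "m * d ^ p \<le> \<bar>eval_xy V (x, y)\<bar> * \<bar>eval_xy (pderiv Q) (x, y)\<bar>"
      using m(2)[OF *(1) _ *(4)] *(3) by (simp add: abs_mult)
    also have "\<dots> \<le> M * \<bar>eval_xy (pderiv Q) (x, y)\<bar>"
      using M(2)[of "(x, y)"] * by (intro mult_right_mono) (auto simp: abs_le_iff)
    finally show ?thesis using M(1) by (simp add: field_simps)
  qed
  show thesis
  proof (rule that[of "min 1 (m / M)" p])
    show "0 < min 1 (m / M)" "min 1 (m / M) \<le> 1" using m M by auto
    fix x y d assume *: "\<bar>x\<bar> \<le> R" "\<bar>y\<bar> \<le> R" "0 < d" "\<forall>c\<in>C. d \<le> \<bar>x - c\<bar>" "eval_xy Q (x, y) = 0"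
    have "min 1 (m / M) * d ^ p \<le> m / M * d ^ p" using *(3) by (intro mult_right_mono) auto
    with bound[OF *] show "min 1 (m / M) * d ^ p \<le> \<bar>eval_xy (pderiv Q) (x, y)\<bar>" by linarith
  qed
qed


section \<open>Separation of roots and their motion across a pixel column\<close>

lemma connected_band:
  assumes "connected W" "continuous_on W a" "continuous_on W b" "\<And>x. x \<in> W \<Longrightarrow> a x \<le> b x"
  shows "connected {(x, y). x \<in> W \<and> a x \<le> y \<and> y \<le> (b x :: real)}"
proof -
  let ?F = "\<lambda>p. (fst p, (1 - snd p) * a (fst p) + snd p * b (fst p))"
  have "connected (?F ` (W \<times> {0..1}))"
    by (intro connected_continuous_image connected_Times assms(1) connected_Icc continuous_intros
        continuous_on_compose2[OF assms(2)] continuous_on_compose2[OF assms(3)]) auto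
  also have "?F ` (W \<times> {0..1}) = {(x, y). x \<in> W \<and> a x \<le> y \<and> y \<le> b x}"
  proof (intro set_eqI iffI)
    fix z assume "z \<in> ?F ` (W \<times> {0..1})"
    then obtain x t where xt: "x \<in> W" "0 \<le> t" "t \<le> 1" "z = (x, (1 - t) * a x + t * b x)" by auto
    have "t * a x \<le> t * b x" "(1 - t) * a x \<le> (1 - t) * b x"
      using xt assms(4) by (intro mult_left_mono; simp)+
    then have "a x \<le> (1 - t) * a x + t * b x" "(1 - t) * a x + t * b x \<le> b x"
      by (simp_all add: algebra_simps)
    then show "z \<in> {(x, y). x \<in> W \<and> a x \<le> y \<and> y \<le> b x}" using xt by simp
  next
    fix z assume "z \<in> {(x, y). x \<in> W \<and> a x \<le> y \<and> y \<le> b x}"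
    then obtain x y where z: "z = (x, y)" "x \<in> W" "a x \<le> y" "y \<le> b x" by blast
    show "z \<in> ?F ` (W \<times> {0..1})"
    proof (cases "a x = b x")
      case True
      then show ?thesis using z by (intro image_eqI[where x = "(x, 0)"]) auto
    next
      case False
      define t where "t = (y - a x) / (b x - a x)"
      have "a x < b x" using False assms(4)[OF z(2)] by simp
      then have t: "0 \<le> t" "t \<le> 1" "t * (b x - a x) = y - a x" using z by (simp_all add: t_def)
      then have "y = (1 - t) * a x + t * b x" by (simp add: algebra_simps)
      then show ?thesis using z(1,2) t(1,2) by (intro image_eqI[where x = "(x, t)"]) auto
    qed
  qed
  finally show ?thesis .
qed

text \<open>With \<open>s = y' - y\<close> the Taylor estimate gives
  \<open>\<bar>s\<bar> * \<mu> \<le> M * s\<^sup>2\<close>; steps longer than 1 exceed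
  \<open>\<mu> / M\<close> anyway.\<close>

lemma root_separation:
  fixes \<mu> M :: real
  assumes M: "M \<ge> 1" "0 < \<mu>" "\<mu> \<le> 1"
    and taylor: "\<And>s. \<bar>s\<bar> \<le> 1 \<Longrightarrow> \<bar>eval_xy Q (x, y + s) - eval_xy Q (x, y) - s * D\<bar> \<le> M * s\<^sup>2"
    and D: "\<mu> \<le> \<bar>D\<bar>" and 0: "eval_xy Q (x, y) = 0" "eval_xy Q (x, y') = 0" "y' \<noteq> y"
  shows "\<bar>y' - y\<bar> \<ge> \<mu> / M"
proof (cases "\<bar>y' - y\<bar> \<le> 1")
  case True
  define s where "s = y' - y"
  have "\<bar>s\<bar> * \<mu> \<le> \<bar>s\<bar> * \<bar>D\<bar>" using D by (intro mult_left_mono) auto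
  also have "\<dots> \<le> M * s\<^sup>2" using taylor[of s] True 0 by (simp add: s_def abs_mult)
  also have "\<dots> = \<bar>s\<bar> * (M * \<bar>s\<bar>)" by (simp add: power2_eq_square abs_mult_self_eq)
  finally have "\<mu> \<le> M * \<bar>s\<bar>" using 0(3) by (simp add: s_def)
  then show ?thesis using M by (simp add: s_def field_simps)
next
  case False
  have "\<mu> / M \<le> 1" using M by simp
  then show ?thesis using False by linarith
qed

text \<open>A root that moved by more than \<open>h\<close> would by continuity pass through
  distance exactly \<open>h\<close>. There the linear term is at least \<open>h * \<mu>\<close>, the
  quadratic remainder takes at most a quarter of it, and the horizontal variation, at most
  \<open>M * \<epsilon>\<close>, is too small to balance the other three quarters.\<close>

lemma root_trap:
  fixes \<mu> M :: real
  assumes M: "M \<ge> 1" "0 < \<mu>" "\<mu> \<le> 1"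
    and W: "connected W" "x \<in> W" "continuous_on W g" "\<And>t. t \<in> W \<Longrightarrow> eval_xy Q (t, g t) = 0"
    and taylor: "\<And>s. \<bar>s\<bar> \<le> 1 \<Longrightarrow> \<bar>eval_xy Q (x, g x + s) - eval_xy Q (x, g x) - s * D\<bar> \<le> M * s\<^sup>2"
    and D: "\<mu> \<le> \<bar>D\<bar>"
    and lip: "\<And>t s. t \<in> W \<Longrightarrow> \<bar>s\<bar> \<le> 1 \<Longrightarrow> \<bar>eval_xy Q (t, g x + s) - eval_xy Q (x, g x + s)\<bar> \<le> M * \<epsilon>"
    and eps: "\<epsilon> < \<mu>\<^sup>2 / (8 * M\<^sup>2)"
    and x': "x' \<in> W"
  shows "\<bar>g x' - g x\<bar> \<le> \<mu> / (4 * M)"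
proof (rule ccontr)
  \<comment> \<open>A quarter of the root separation \<open>\<mu> / M\<close>: two roots that each
    move by at most \<open>h\<close> keep half of their distance.\<close>
  define h where "h = \<mu> / (4 * M)"
  have hM: "h * M = \<mu> / 4" using M by (simp add: h_def)
  have h: "0 < h" "h \<le> 1" using M by (simp_all add: h_def)
  assume "\<not> ?thesis"
  then have gt: "h < \<bar>g x' - g x\<bar>" by (simp add: h_def)
  have "connected ((\<lambda>t. \<bar>g t - g x\<bar>) ` W)"
    by (intro connected_continuous_image continuous_intros W)
  moreover have "0 \<in> (\<lambda>t. \<bar>g t - g x\<bar>) ` W" using W(2) by (intro image_eqI[of _ _ x]) auto
  moreover have "\<bar>g x' - g x\<bar> \<in> (\<lambda>t. \<bar>g t - g x\<bar>) ` W" using x' by blast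
  ultimately have "h \<in> (\<lambda>t. \<bar>g t - g x\<bar>) ` W"
    using gt h unfolding connected_iff_interval by (meson less_imp_le)
  then obtain t where t: "t \<in> W" "\<bar>g t - g x\<bar> = h" by blast
  define s where "s = g t - g x"
  have s: "\<bar>s\<bar> = h" "\<bar>s\<bar> \<le> 1" using t h by (simp_all add: s_def)
  have s2: "s\<^sup>2 = h\<^sup>2" using s(1) by (metis power2_abs)
  have "eval_xy Q (t, g x + s) = 0" using W(4)[OF t(1)] by (simp add: s_def)
  then have "\<bar>eval_xy Q (x, g x + s)\<bar> \<le> M * \<epsilon>" using lip[OF t(1) s(2)] by simp
  moreover have "\<bar>s * D\<bar> \<le> \<bar>eval_xy Q (x, g x + s)\<bar> + M * h\<^sup>2"
    using taylor[OF s(2)] W(4)[OF W(2)] s2 by (simp add: abs_le_iff) linarith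
  moreover have "h * \<mu> \<le> \<bar>s * D\<bar>" using D h by (simp add: abs_mult s(1))
  ultimately have "h * \<mu> - h * (h * M) \<le> M * \<epsilon>" by (simp add: power2_eq_square algebra_simps)
  then have "h * \<mu> - h * (\<mu> / 4) \<le> M * \<epsilon>" by (simp add: hM)
  then have "h * \<mu> * (3 / 4) \<le> M * \<epsilon>" by (simp add: algebra_simps)
  then have "\<mu>\<^sup>2 * 3 / (16 * M) \<le> M * \<epsilon>" by (simp add: h_def power2_eq_square algebra_simps)
  moreover have "M * \<epsilon> < \<mu>\<^sup>2 / (8 * M)"
    using eps M mult_strict_left_mono[OF eps, of M] by (simp add: power2_eq_square)
  moreover have "\<mu>\<^sup>2 / (8 * M) \<le> \<mu>\<^sup>2 * 3 / (16 * M)"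
    using M by (simp add: field_simps)
  ultimately show False by linarith
qed

lemma slice_components_bands:
  assumes "finite J" "\<And>j. j \<in> J \<Longrightarrow> a j \<le> b j" "\<And>i j. i \<in> J \<Longrightarrow> j \<in> J \<Longrightarrow> i < j \<Longrightarrow> b i < a (j::nat)"
    "\<And>y. (x, y) \<in> S \<longleftrightarrow> (\<exists>j\<in>J. a j \<le> y \<and> y \<le> (b j :: real))"
  shows "slice_components S x = card J"
  unfolding slice_components_def
proof (rule card_components_closed_family[of _ _ "\<lambda>j. {x} \<times> {a j..b j}"])
  show "S \<inter> {p. fst p = x} = (\<Union>j\<in>J. {x} \<times> {a j..b j})" using assms(4) by auto
  show "closed ({x} \<times> {a j..b j}) \<and> connected ({x} \<times> {a j..b j}) \<and> {x} \<times> {a j..b j} \<noteq> {}" if "j \<in> J" for j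
    using assms(2)[OF that] by (simp add: closed_Times connected_Times)
  show "{x} \<times> {a i..b i} \<inter> {x} \<times> {a j..b j} = {}" if "i \<in> J" "j \<in> J" "i \<noteq> j" for i j
    using that assms(3)[of i j] assms(3)[of j i] by (cases i j rule: linorder_cases) fastforce+
qed (rule assms(1))

text \<open>Over \<open>x\<close> the bands are at least \<open>4 * h\<close> apart, and across the
  column each edge moves by at most \<open>h\<close>; what remains is
  \<open>2 * h > 2 * \<epsilon>\<close>. In the exponent \<open>2 * p + 1\<close>, the part
  \<open>2 * p\<close> comes from \<open>\<mu>\<^sup>2\<close> in the trapping condition, and the
  extra power of \<open>d\<close> gives \<open>\<epsilon> < d\<close>, so that the column avoids
  \<open>C\<close>.\<close>

lemma pixelation_slice_components_away:
  assumes S: "compact S" and ad: "adapted S Q C"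
  shows "\<exists>c0>0. \<exists>q\<ge>1. \<forall>x d \<epsilon>. 0 < d \<longrightarrow> d \<le> 1 \<longrightarrow> (\<forall>c\<in>C. d \<le> \<bar>x - c\<bar>) \<longrightarrow> 0 < \<epsilon> \<longrightarrow> \<epsilon> < c0 * d ^ q
           \<longrightarrow> slice_components (pixelation \<epsilon> S) x = slice_components S x"
proof -
  obtain R where R: "\<And>z. z \<in> S \<Longrightarrow> norm z \<le> R" "R > 0"
    using compact_imp_bounded[OF S] unfolding bounded_pos by blast
  have R': "\<bar>x\<bar> \<le> R \<and> \<bar>y\<bar> \<le> R" if "(x, y) \<in> S" for x y
    using R(1)[OF that] norm_fst_le[of x y] norm_snd_le[of y x] by simp
  \<comment> \<open>The margin 2 is needed because abscissae up to \<open>R + 1\<close> are treated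
    and the column reaches less than 1 further.\<close>
  obtain M where M: "M \<ge> 1"
    and taylor: "\<And>x y s. \<bar>x\<bar> \<le> R + 2 \<Longrightarrow> \<bar>y\<bar> \<le> R + 2 \<Longrightarrow> \<bar>s\<bar> \<le> 1 \<Longrightarrow>
       \<bar>eval_xy Q (x, y + s) - eval_xy Q (x, y) - s * eval_xy (pderiv Q) (x, y)\<bar> \<le> M * s\<^sup>2"
    and lip: "\<And>x x' y. \<bar>x\<bar> \<le> R + 2 \<Longrightarrow> \<bar>x'\<bar> \<le> R + 2 \<Longrightarrow> \<bar>y\<bar> \<le> R + 2 \<Longrightarrow>
       \<bar>eval_xy Q (x', y) - eval_xy Q (x, y)\<bar> \<le> M * \<bar>x' - x\<bar>"
    by (rule eval_xy_local_bounds[of "R + 2" Q]) blast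
  obtain m p where m: "0 < m" "m \<le> 1"
    and mp: "\<And>x y d. \<bar>x\<bar> \<le> R + 2 \<Longrightarrow> \<bar>y\<bar> \<le> R + 2 \<Longrightarrow> 0 < d \<Longrightarrow> (\<forall>c\<in>C. d \<le> \<bar>x - c\<bar>) \<Longrightarrow>
       eval_xy Q (x, y) = 0 \<Longrightarrow> m * d ^ p \<le> \<bar>eval_xy (pderiv Q) (x, y)\<bar>"
    by (rule root_derivative_lower_bound[OF ad, of "R + 2"]) blast
  define c0 where "c0 = m\<^sup>2 / (8 * M\<^sup>2)"
  have "M\<^sup>2 \<ge> 1" "m\<^sup>2 \<le> 1" using M m by (simp_all add: power_le_one)
  then have "m\<^sup>2 \<le> 8 * M\<^sup>2" by linarith
  then have c0: "c0 > 0" "c0 \<le> 1" using M m by (simp_all add: c0_def)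
  have "slice_components (pixelation \<epsilon> S) x = slice_components S x"
    if d: "0 < d" "d \<le> 1" "\<forall>c\<in>C. d \<le> \<bar>x - c\<bar>" and \<epsilon>: "0 < \<epsilon>" "\<epsilon> < c0 * d ^ (2 * p + 1)" for x d \<epsilon>
  proof -
    define \<mu> where "\<mu> = m * d ^ p"
    have \<mu>: "0 < \<mu>" "\<mu> \<le> 1" using m d by (simp_all add: \<mu>_def mult_le_one power_le_one)
    have "c0 * d ^ (2 * p + 1) \<le> c0 * d ^ (2 * p)"
      using d c0 by (intro mult_left_mono power_decreasing) auto
    also have "\<dots> = \<mu>\<^sup>2 / (8 * M\<^sup>2)" by (simp add: c0_def \<mu>_def power_mult_distrib power_mult[symmetric] mult.commute)
    finally have \<epsilon>\<mu>: "\<epsilon> < \<mu>\<^sup>2 / (8 * M\<^sup>2)" using \<epsilon> by linarith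
    have "c0 * d ^ (2 * p + 1) \<le> 1 * d ^ 1"
      using d c0 by (intro mult_mono power_decreasing) auto
    then have \<epsilon>d: "\<epsilon> < d" using \<epsilon> by simp
    define h where "h = \<mu> / (4 * M)"
    have "\<mu>\<^sup>2 / (8 * M\<^sup>2) \<le> h"
    proof -
      have "\<mu>\<^sup>2 \<le> \<mu>" "M \<le> M\<^sup>2" using \<mu> M by (simp_all add: power2_eq_square mult_left_le)
      then have "\<mu>\<^sup>2 / (8 * M\<^sup>2) \<le> \<mu> / (8 * M)" using \<mu> M by (intro frac_le) auto
      also have "\<dots> \<le> h" using \<mu> M by (simp add: h_def field_simps)
      finally show ?thesis .
    qed
    then have \<epsilon>h: "\<epsilon> < h" using \<epsilon>\<mu> by linarith
    have h: "h > 0" using \<mu> M by (simp add: h_def)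
    let ?W = "grid_column \<epsilon> x"
    note W = grid_column_bounds[OF \<epsilon>(1), of x]
    have connW: "connected ?W" by (simp add: grid_column_def)
    show ?thesis
    proof (cases "\<bar>x\<bar> \<le> R + 1")
      case False
      have no: "(x', y) \<notin> S" if "x' \<in> ?W" for x' y
      proof
        assume "(x', y) \<in> S"
        then have "\<bar>x'\<bar> \<le> R" using R' by blast
        moreover have "\<bar>x' - x\<bar> \<le> \<epsilon>" using that W(2) by (auto simp: abs_le_iff)
        ultimately show False using False \<epsilon>d d by linarith
      qed
      have "slice_components (pixelation \<epsilon> S) x = card ({} :: nat set)"
        by (rule slice_components_pixelation[OF \<epsilon>(1) compact_imp_bounded[OF S], where T = "\<lambda>_. {}"])
          (use no in auto)
      moreover have "S \<inter> {p. fst p = x} = {}" using no[OF W(1)] by auto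
      ultimately show ?thesis by (simp add: slice_components_def)
    next
      case xR: True
      have WC: "?W \<inter> C = {}"
      proof -
        have "\<bar>x - c\<bar> < d" if "c \<in> ?W" for c using that W(2) \<epsilon>d by force
        then show ?thesis using d(3) by force
      qed
      obtain J :: "nat set" and a b where J: "finite J"
        and cont: "\<And>j. j \<in> J \<Longrightarrow> continuous_on ?W (a j)" "\<And>j. j \<in> J \<Longrightarrow> continuous_on ?W (b j)"
        and ab: "\<And>j t. j \<in> J \<Longrightarrow> t \<in> ?W \<Longrightarrow> a j t \<le> b j t"
        and ba: "\<And>i j t. i \<in> J \<Longrightarrow> j \<in> J \<Longrightarrow> i < j \<Longrightarrow> t \<in> ?W \<Longrightarrow> b i t < a j t"
        and root: "\<And>j t. j \<in> J \<Longrightarrow> t \<in> ?W \<Longrightarrow> eval_xy Q (t, a j t) = 0"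
            "\<And>j t. j \<in> J \<Longrightarrow> t \<in> ?W \<Longrightarrow> eval_xy Q (t, b j t) = 0"
        and SJ: "\<And>t y. t \<in> ?W \<Longrightarrow> (t, y) \<in> S \<longleftrightarrow> (\<exists>j\<in>J. a j t \<le> y \<and> y \<le> b j t)"
        by (rule band_decomposition[OF ad S connW WC]) blast
      have bR: "\<bar>b j x\<bar> \<le> R" "\<bar>a j x\<bar> \<le> R" if "j \<in> J" for j
        using R'[of x "b j x"] R'[of x "a j x"] SJ[OF W(1)] ab[OF that W(1)] that by blast+
      have trap: "\<bar>g t - g x\<bar> \<le> h"
        if g: "continuous_on ?W g" "\<And>t. t \<in> ?W \<Longrightarrow> eval_xy Q (t, g t) = 0" "\<bar>g x\<bar> \<le> R" and t: "t \<in> ?W" for g t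
        unfolding h_def
      proof (rule root_trap[OF M \<mu> connW W(1) g(1,2) _ _ _ \<epsilon>\<mu> t])
        show "\<bar>eval_xy Q (x, g x + s) - eval_xy Q (x, g x) - s * eval_xy (pderiv Q) (x, g x)\<bar> \<le> M * s\<^sup>2"
          if "\<bar>s\<bar> \<le> 1" for s using taylor[of x "g x" s] xR g(3) that by simp
        show "\<mu> \<le> \<bar>eval_xy (pderiv Q) (x, g x)\<bar>"
          unfolding \<mu>_def using mp[of x "g x" d] xR g(3) d g(2)[OF W(1)] by simp
        show "\<bar>eval_xy Q (t, g x + s) - eval_xy Q (x, g x + s)\<bar> \<le> M * \<epsilon>"
          if t: "t \<in> ?W" and s: "\<bar>s\<bar> \<le> 1" for t s
        proof -
          have tx: "\<bar>t - x\<bar> \<le> \<epsilon>" using t W(2) by (auto simp: abs_le_iff)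
          have "\<bar>eval_xy Q (t, g x + s) - eval_xy Q (x, g x + s)\<bar> \<le> M * \<bar>t - x\<bar>"
            using tx xR g(3) s \<epsilon>d d by (intro lip) linarith+
          also have "\<dots> \<le> M * \<epsilon>" using tx M by (intro mult_left_mono) auto
          finally show ?thesis .
        qed
      qed
      have gap: "a j x - b i x \<ge> 4 * h" if ij: "i \<in> J" "j \<in> J" "i < j" for i j
      proof -
        have "\<bar>a j x - b i x\<bar> \<ge> \<mu> / M"
        proof (rule root_separation[OF M \<mu>])
          show "\<bar>eval_xy Q (x, b i x + s) - eval_xy Q (x, b i x) - s * eval_xy (pderiv Q) (x, b i x)\<bar> \<le> M * s\<^sup>2"
            if "\<bar>s\<bar> \<le> 1" for s using taylor[of x "b i x" s] xR bR[OF ij(1)] that by simp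
          show "\<mu> \<le> \<bar>eval_xy (pderiv Q) (x, b i x)\<bar>"
            unfolding \<mu>_def using mp[of x "b i x" d] xR bR[OF ij(1)] d root(2)[OF ij(1) W(1)] by simp
        qed (use root ij W(1) ba[OF ij W(1)] in auto)
        then show ?thesis using ba[OF ij W(1)] by (simp add: h_def)
      qed
      have "slice_components (pixelation \<epsilon> S) x = card J"
      proof (rule slice_components_pixelation[OF \<epsilon>(1) compact_imp_bounded[OF S] J,
            where T = "\<lambda>j. {(t, y). t \<in> ?W \<and> a j t \<le> y \<and> y \<le> b j t}"])
        show "connected {(t, y). t \<in> ?W \<and> a j t \<le> y \<and> y \<le> b j t} \<and> {(t, y). t \<in> ?W \<and> a j t \<le> y \<and> y \<le> b j t} \<noteq> {}"
          if "j \<in> J" for j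
          using connected_band[OF connW cont(1)[OF that] cont(2)[OF that]] ab[OF that] W(1) by blast
        have lt: "snd z + 2 * \<epsilon> < snd w"
          if ij: "i \<in> J" "j \<in> J" "i < j" and z: "fst z \<in> ?W" "snd z \<le> b i (fst z)"
            and w: "fst w \<in> ?W" "a j (fst w) \<le> snd w" for i j z w
        proof -
          have "b i (fst z) \<le> b i x + h"
            using trap[OF cont(2)[OF ij(1)] root(2)[OF ij(1)] bR(1)[OF ij(1)] z(1)] by linarith
          moreover have "a j (fst w) \<ge> a j x - h"
            using trap[OF cont(1)[OF ij(2)] root(1)[OF ij(2)] bR(2)[OF ij(2)] w(1)] by linarith
          ultimately show ?thesis using gap[OF ij] \<epsilon>h h z w by linarith
        qed
        show "\<bar>snd z - snd w\<bar> > 2 * \<epsilon>"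
          if "i \<in> J" "j \<in> J" "i \<noteq> j" "z \<in> {(t, y). t \<in> ?W \<and> a i t \<le> y \<and> y \<le> b i t}"
            "w \<in> {(t, y). t \<in> ?W \<and> a j t \<le> y \<and> y \<le> b j t}" for i j z w
        proof (cases "i < j")
          case True
          have "snd z + 2 * \<epsilon> < snd w" using that True by (intro lt[of i j]) auto
          then show ?thesis by linarith
        next
          case False
          have "snd w + 2 * \<epsilon> < snd z" using that False by (intro lt[of j i]) auto
          then show ?thesis by linarith
        qed
        show "S \<inter> ?W \<times> UNIV = (\<Union>j\<in>J. {(t, y). t \<in> ?W \<and> a j t \<le> y \<and> y \<le> b j t})"
          using SJ by auto
      qed
      moreover have "slice_components S x = card J"
        by (rule slice_components_bands[OF J, of "\<lambda>j. a j x" "\<lambda>j. b j x"]) (use ab ba SJ W(1) in auto)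
      ultimately show ?thesis by simp
    qed
  qed
  then show ?thesis using c0(1) by (intro exI[of _ c0] conjI exI[of _ "2 * p + 1"]) auto
qed

section \<open>Slices near an exceptional abscissa\<close>


text \<open>The lowest point of a component has its height in \<open>Z\<close>: otherwise
  \<open>S\<close> would contain a vertical interval around it, which belongs to the same component
  and goes lower. The component is determined by this point.\<close>

lemma finite_slice_components:
  assumes S: "compact S" and sa: "semialgebraic S"
  shows "finite (components (S \<inter> {p. fst p = c}))"
proof -
  obtain Z where Z: "finite Z"
    and cell: "\<And>X. connected X \<Longrightarrow> X \<subseteq> {c} \<times> (- Z) \<Longrightarrow> X \<subseteq> S \<or> X \<inter> S = {}"
    using semialgebraic_vertical_slice[OF sa] by metis
  let ?X = "S \<inter> {p. fst p = c}"
  have "closed {p::plane. fst p = c}" by (intro closed_Collect_eq continuous_intros)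
  then have cX: "compact ?X" using S by (rule compact_Int_closed[rotated])
  have "K \<in> (\<lambda>y. connected_component_set ?X (c, y)) ` Z" if K: "K \<in> components ?X" for K
  proof -
    have "compact K" using compact_components[OF cX K] .
    then obtain k where k: "k \<in> K" and low: "\<And>w. w \<in> K \<Longrightarrow> snd k \<le> snd w"
      using continuous_attains_inf[of K snd] in_components_nonempty[OF K] continuous_on_snd[OF continuous_on_id]
      by blast
    have kX: "k \<in> ?X" using k in_components_subset[OF K] by blast
    have k_eq: "k = (c, snd k)" using kX by (auto simp: prod_eq_iff)
    have "snd k \<in> Z"
    proof (rule ccontr)
      assume "snd k \<notin> Z"
      then have "open (- Z)" "snd k \<in> - Z" using Z by (auto simp: finite_imp_closed open_Compl)
      then obtain r where r: "r > 0" "ball (snd k) r \<subseteq> - Z" using open_contains_ball by blast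
      let ?Y = "{c} \<times> ball (snd k) r"
      have conn: "connected ?Y" by (simp add: connected_Times)
      have kY: "k \<in> ?Y" using r(1) k_eq by (metis SigmaI centre_in_ball singletonI)
      have "?Y \<subseteq> S" using cell[OF conn] r(2) kY kX by blast
      then have "?Y \<subseteq> ?X" by auto
      then have "?Y \<subseteq> K" using components_maximal[OF K conn] k kY by blast
      moreover have "(c, snd k - r / 2) \<in> ?Y" using r(1) by (simp add: dist_real_def)
      ultimately have "snd k \<le> snd k - r / 2" using low by fastforce
      then show False using r(1) by simp
    qed
    moreover have "K = connected_component_set ?X (c, snd k)"
      using K k k_eq by (metis componentsE connected_component_eq)
    ultimately show ?thesis by blast
  qed
  then have "components ?X \<subseteq> (\<lambda>y. connected_component_set ?X (c, y)) ` Z" by blast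
  then show ?thesis using Z by (meson finite_imageI finite_subset)
qed

lemma connected_via_hub:
  assumes "connected K" "K \<subseteq> T" "K \<noteq> {}"
    and "\<And>z. z \<in> T \<Longrightarrow> \<exists>X. connected X \<and> z \<in> X \<and> X \<subseteq> T \<and> X \<inter> K \<noteq> {}"
  shows "connected T"
proof -
  let ?A = "{X \<union> K | X. connected X \<and> X \<subseteq> T \<and> X \<inter> K \<noteq> {}}"
  have "connected (\<Union>?A)"
  proof (rule connected_Union)
    show "connected s" if s: "s \<in> ?A" for s
    proof -
      from s obtain X where X: "s = X \<union> K" "connected X" "X \<inter> K \<noteq> {}" by blast
      show ?thesis unfolding X(1) by (rule connected_Un[OF X(2) assms(1) X(3)])
    qed
    show "\<Inter>?A \<noteq> {}" using assms(3) by blast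
  qed
  moreover have "\<Union>?A = T"
  proof
    show "\<Union>?A \<subseteq> T" using assms(2) by blast
    show "T \<subseteq> \<Union>?A"
    proof
      fix z assume "z \<in> T"
      from assms(4)[OF this] obtain X where "connected X \<and> z \<in> X \<and> X \<subseteq> T \<and> X \<inter> K \<noteq> {}" ..
      then show "z \<in> \<Union>?A" by (intro UnionI[of "X \<union> K"]) auto
    qed
  qed
  ultimately show ?thesis by simp
qed

lemma connected_in_disjoint_opens:
  assumes "connected X" "X \<subseteq> (\<Union>K\<in>\<K>. N K)" "\<And>K. K \<in> \<K> \<Longrightarrow> open (N K)"
    "\<And>K L. K \<in> \<K> \<Longrightarrow> L \<in> \<K> \<Longrightarrow> K \<noteq> L \<Longrightarrow> N K \<inter> N L = {}"
    "K \<in> \<K>" "X \<inter> N K \<noteq> {}"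
  shows "X \<subseteq> N K"
proof -
  define R where "R = (\<Union>L\<in>\<K> - {K}. N L)"
  have "open R" unfolding R_def using assms(3) by blast
  moreover have "N K \<inter> R = {}" unfolding R_def using assms(4,5) by blast
  moreover have "X \<subseteq> N K \<union> R" using assms(2) by (auto simp: R_def)
  ultimately have "R \<inter> X = {}"
    using connectedD[OF assms(1), of "N K" R] assms(3)[OF assms(5)] assms(6) by blast
  then show ?thesis using \<open>X \<subseteq> N K \<union> R\<close> by blast
qed

text \<open>The scales at which \<open>S\<close> is controlled by its slice over \<open>c\<close>. A
  distance of more than \<open>3 * \<eta>\<close> between components leaves more than \<eta> between
  their \<eta>-neighbourhoods, which is then compared with \<open>2 * \<epsilon>\<close>. The
  abscissa \<open>c\<close> itself may or may not belong to \<open>C\<close>.\<close>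

locale isolated_fibre =
  fixes S :: "plane set" and Q :: "real poly poly" and C :: "real set" and c \<eta> \<delta> :: real
    and comps :: "plane set set" and nbhd :: "plane set \<Rightarrow> plane set"
  defines "comps \<equiv> components (S \<inter> {p. fst p = c})"
    and "nbhd \<equiv> \<lambda>K. (\<Union>k\<in>K. ball k \<eta>)"
  assumes compact: "compact S" and adapted: "adapted S Q C"
    and finite_comps: "finite comps"
    and pos: "\<eta> > 0" "\<delta> > 0"
    and separated: "\<And>K L k l. K \<in> comps \<Longrightarrow> L \<in> comps \<Longrightarrow> K \<noteq> L \<Longrightarrow> k \<in> K \<Longrightarrow> l \<in> L \<Longrightarrow> 3 * \<eta> < \<bar>snd k - snd l\<bar>"
    and covered: "\<And>z. z \<in> S \<Longrightarrow> \<bar>fst z - c\<bar> < \<delta> \<Longrightarrow> z \<in> (\<Union>K\<in>comps. nbhd K)"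
    and punctured: "\<And>x. x \<in> C \<Longrightarrow> x \<noteq> c \<Longrightarrow> \<delta> \<le> \<bar>x - c\<bar>"

text \<open>Finitely many compact components of one slice have a positive vertical distance. The
  points of \<open>S\<close> outside the open neighbourhoods form a compact set, so their abscissae
  stay away from \<open>c\<close>.\<close>

lemma isolated_fibre_exists:
  assumes S: "compact S" and sa: "semialgebraic S" and ad: "adapted S Q C"
  obtains \<eta> \<delta> where "isolated_fibre S Q C c \<eta> \<delta>"
proof -
  let ?X = "S \<inter> {p. fst p = c}"
  let ?\<K> = "components ?X"
  have fin: "finite ?\<K>" by (rule finite_slice_components[OF S sa])
  have "closed {p::plane. fst p = c}" by (intro closed_Collect_eq continuous_intros)
  then have cX: "compact ?X" using S by (rule compact_Int_closed[rotated])
  have fibre: "fst k = c" if "K \<in> ?\<K>" "k \<in> K" for K k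
    using in_components_subset[OF that(1)] that(2) by blast
  have "\<forall>\<^sub>F \<eta> in at_right 0. \<forall>K\<in>?\<K>. \<forall>L\<in>?\<K>. K \<noteq> L \<longrightarrow> (\<forall>k\<in>K. \<forall>l\<in>L. 3 * \<eta> < \<bar>snd k - snd l\<bar>)"
  proof (intro eventually_ball_finite fin ballI)
    fix K L assume KL: "K \<in> ?\<K>" "L \<in> ?\<K>"
    show "\<forall>\<^sub>F \<eta> in at_right 0. K \<noteq> L \<longrightarrow> (\<forall>k\<in>K. \<forall>l\<in>L. 3 * \<eta> < \<bar>snd k - snd l\<bar>)"
    proof (cases "K = L")
      case False
      then have "K \<inter> L = {}" using components_eq[OF KL] by blast
      then obtain d where d: "d > 0" "\<And>k l. k \<in> K \<Longrightarrow> l \<in> L \<Longrightarrow> d \<le> dist k l"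
        using separate_compact_closed[OF compact_components[OF cX KL(1)]
            compact_imp_closed[OF compact_components[OF cX KL(2)]]] by blast
      have "d \<le> \<bar>snd k - snd l\<bar>" if "k \<in> K" "l \<in> L" for k l
        using d(2)[OF that] fibre[OF KL(1) that(1)] fibre[OF KL(2) that(2)]
        by (simp add: dist_prod_def dist_real_def)
      then have "K \<noteq> L \<longrightarrow> (\<forall>k\<in>K. \<forall>l\<in>L. 3 * \<eta> < \<bar>snd k - snd l\<bar>)" if "\<eta> < d / 3" for \<eta>
        using that by fastforce
      moreover have "\<forall>\<^sub>F \<eta> in at_right 0. \<eta> < d / 3"
        using d(1) by (auto simp: eventually_at_right_field intro!: exI[of _ "d / 3"])
      ultimately show ?thesis by (rule eventually_mono[rotated])
    qed simp
  qed
  then have "\<forall>\<^sub>F \<eta> in at_right 0. \<eta> > 0 \<and> (\<forall>K\<in>?\<K>. \<forall>L\<in>?\<K>. K \<noteq> L \<longrightarrow> (\<forall>k\<in>K. \<forall>l\<in>L. 3 * \<eta> < \<bar>snd k - snd l\<bar>))"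
    by (intro eventually_conj eventually_at_right_less)
  from eventually_happens'[OF trivial_limit_at_right_real this]
  obtain \<eta> where \<eta>0: "\<eta> > 0"
    "\<forall>K\<in>?\<K>. \<forall>L\<in>?\<K>. K \<noteq> L \<longrightarrow> (\<forall>k\<in>K. \<forall>l\<in>L. 3 * \<eta> < \<bar>snd k - snd l\<bar>)"
    by (elim exE conjE)
  note \<eta> = \<eta>0(1) \<eta>0(2)[rule_format]
  define U where "U = (\<Union>K\<in>?\<K>. \<Union>k\<in>K. ball k \<eta>)"
  have "?X \<subseteq> U"
  proof
    fix z assume "z \<in> ?X"
    then obtain K where "K \<in> ?\<K>" "z \<in> K" using Union_components by blast
    then show "z \<in> U" unfolding U_def using \<eta>(1) by force
  qed
  have "compact (fst ` (S - U))"
    unfolding U_def by (intro compact_continuous_image compact_diff S continuous_intros open_UN ballI open_ball)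
  then have "open (- fst ` (S - U))" by (simp add: compact_imp_closed open_Compl)
  moreover have "c \<in> - fst ` (S - U)" using \<open>?X \<subseteq> U\<close> by auto
  ultimately obtain \<delta>1 where \<delta>1: "\<delta>1 > 0" "ball c \<delta>1 \<subseteq> - fst ` (S - U)"
    using open_contains_ball by blast
  have "finite C" using ad by (simp add: adapted_def)
  then obtain \<delta>2 where \<delta>2: "\<delta>2 > 0" "\<And>x. x \<in> C \<Longrightarrow> x \<noteq> c \<Longrightarrow> \<delta>2 \<le> dist c x"
    using finite_set_avoid[of C c] by blast
  show thesis
  proof (rule that[of \<eta> "min \<delta>1 \<delta>2"], unfold_locales)
    show "z \<in> (\<Union>K\<in>?\<K>. \<Union>k\<in>K. ball k \<eta>)" if "z \<in> S" "\<bar>fst z - c\<bar> < min \<delta>1 \<delta>2" for z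
    proof -
      have "fst z \<in> ball c \<delta>1" using that(2) by (simp add: dist_real_def abs_minus_commute)
      then show ?thesis using \<delta>1(2) that(1) unfolding U_def by blast
    qed
    show "min \<delta>1 \<delta>2 \<le> \<bar>x - c\<bar>" if "x \<in> C" "x \<noteq> c" for x
      using \<delta>2(2)[OF that] by (simp add: dist_real_def abs_minus_commute)
  qed (use S ad fin \<eta> \<delta>1 \<delta>2 in auto)
qed

section \<open>Components of a slice and the bands that approach them\<close>

context isolated_fibre
begin

lemma slice_components_c: "slice_components S c = card comps"
  by (simp add: slice_components_def comps_def)

lemma comps_props:
  assumes "K \<in> comps"
  shows "connected K" "K \<noteq> {}" "K \<subseteq> S" "\<And>k. k \<in> K \<Longrightarrow> fst k = c" "K \<subseteq> nbhd K"
proof -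
  show "connected K" "K \<noteq> {}"
    using assms in_components_connected in_components_nonempty unfolding comps_def by blast+
  have "K \<subseteq> S \<inter> {p. fst p = c}" using assms in_components_subset unfolding comps_def by blast
  then show "K \<subseteq> S" "\<And>k. k \<in> K \<Longrightarrow> fst k = c" by blast+
  show "K \<subseteq> nbhd K" unfolding nbhd_def using pos(1) by (meson UN_I centre_in_ball subsetI)
qed

lemma fibre_covered:
  assumes "z \<in> S" "fst z = c"
  obtains K where "K \<in> comps" "z \<in> K"
proof -
  have "z \<in> \<Union>comps" using assms Union_components[of "S \<inter> {p. fst p = c}"] by (simp add: comps_def)
  then show thesis using that by blast
qed

lemma open_nbhd: "open (nbhd K)"
  unfolding nbhd_def by blast

lemma nbhd_separated:
  assumes "K \<in> comps" "L \<in> comps" "K \<noteq> L" "z \<in> nbhd K" "w \<in> nbhd L"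
  shows "\<eta> < \<bar>snd z - snd w\<bar>"
proof -
  obtain k l where k: "k \<in> K" "dist k z < \<eta>" and l: "l \<in> L" "dist l w < \<eta>"
    using assms(4,5) by (auto simp: nbhd_def)
  have "\<bar>snd k - snd z\<bar> \<le> dist k z" "\<bar>snd l - snd w\<bar> \<le> dist l w"
    using dist_snd_le[of k z] dist_snd_le[of l w] by (simp_all add: dist_real_def)
  then show ?thesis using separated[OF assms(1-3) k(1) l(1)] k l by linarith
qed

lemma nbhd_disjoint:
  assumes "K \<in> comps" "L \<in> comps" "K \<noteq> L" shows "nbhd K \<inter> nbhd L = {}"
  using nbhd_separated[OF assms] pos by force

lemma connected_subset_nbhd:
  assumes "connected X" "X \<subseteq> S" "\<And>z. z \<in> X \<Longrightarrow> \<bar>fst z - c\<bar> < \<delta>" "K \<in> comps" "X \<inter> nbhd K \<noteq> {}"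
  shows "X \<subseteq> nbhd K"
proof (rule connected_in_disjoint_opens[where N = nbhd, OF assms(1) _ open_nbhd nbhd_disjoint assms(4,5)])
  show "X \<subseteq> (\<Union>K\<in>comps. nbhd K)" using covered assms(2,3) by blast
qed auto

text \<open>The point \<open>z\<close> is moved towards \<open>c\<close> inside its band at constant
  relative height \<open>t\<close>. The height need not converge: by compactness the graph has an
  accumulation point over \<open>c\<close>, and adding it keeps the graph connected.\<close>

lemma path_to_fibre:
  assumes I: "connected I" "I \<inter> C = {}" "c \<in> closure I" and z: "z \<in> S" "fst z \<in> I"
  shows "\<exists>X. connected X \<and> z \<in> X \<and> X \<subseteq> S \<and> fst ` X \<subseteq> insert c I \<and> (\<exists>w\<in>X. fst w = c)"
proof -
  obtain J :: "nat set" and a b where J: "finite J"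
    and cont: "\<And>j. j \<in> J \<Longrightarrow> continuous_on I (a j)" "\<And>j. j \<in> J \<Longrightarrow> continuous_on I (b j)"
    and ab: "\<And>j t. j \<in> J \<Longrightarrow> t \<in> I \<Longrightarrow> a j t \<le> b j t"
    and SJ: "\<And>t y. t \<in> I \<Longrightarrow> (t, y) \<in> S \<longleftrightarrow> (\<exists>j\<in>J. a j t \<le> y \<and> y \<le> b j t)"
    by (rule band_decomposition[OF adapted compact I(1,2)]) blast
  obtain j where j: "j \<in> J" "a j (fst z) \<le> snd z" "snd z \<le> b j (fst z)"
    using SJ[OF z(2), of "snd z"] z(1) by auto
  have "snd z \<in> closed_segment (a j (fst z)) (b j (fst z))"
    using j by (simp add: closed_segment_eq_real_ivl)
  then obtain t where t: "0 \<le> t" "t \<le> 1" "snd z = (1 - t) * a j (fst z) + t * b j (fst z)"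
    by (auto simp: in_segment)
  define s where "s = (\<lambda>x. (1 - t) * a j x + t * b j x)"
  have s: "continuous_on I s" unfolding s_def by (intro continuous_intros cont j(1))
  define G where "G = (\<lambda>x. (x, s x)) ` I"
  have G: "connected G" unfolding G_def by (intro connected_continuous_image continuous_intros s I(1))
  have "z \<in> G" unfolding G_def using z(2) t(3) by (intro image_eqI[of _ _ "fst z"]) (auto simp: s_def prod_eq_iff)
  have GS: "G \<subseteq> S"
  proof -
    have "(x, s x) \<in> S" if x: "x \<in> I" for x
    proof -
      have "t * a j x \<le> t * b j x" "(1 - t) * a j x \<le> (1 - t) * b j x"
        using t ab[OF j(1) x] by (intro mult_left_mono; simp)+
      then have "a j x \<le> s x" "s x \<le> b j x" by (simp_all add: s_def algebra_simps)
      then show ?thesis using SJ[OF x] j(1) by blast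
    qed
    then show ?thesis by (auto simp: G_def)
  qed
  obtain x where x: "\<And>n. x n \<in> I" "x \<longlonglongrightarrow> c" using I(3) closure_sequential by blast
  have "\<forall>n. (x n, s (x n)) \<in> S" using GS x(1) by (auto simp: G_def)
  then obtain w r where w: "w \<in> S" "strict_mono r" "((\<lambda>n. (x n, s (x n))) \<circ> r) \<longlonglongrightarrow> w"
    by (rule seq_compactE[OF compact_imp_seq_compact[OF compact]])
  have "(\<lambda>n. fst (((\<lambda>n. (x n, s (x n))) \<circ> r) n)) \<longlonglongrightarrow> fst w" by (intro tendsto_fst w(3))
  moreover have "(x \<circ> r) \<longlonglongrightarrow> c" by (rule LIMSEQ_subseq_LIMSEQ[OF x(2) w(2)])
  ultimately have fw: "fst w = c" by (intro LIMSEQ_unique[of "x \<circ> r"]) (simp_all add: o_def)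
  have "w \<in> closure G" unfolding closure_sequential
    using w(3) x(1) by (intro exI[of _ "(\<lambda>n. (x n, s (x n))) \<circ> r"]) (auto simp: G_def)
  then have "connected (insert w G)"
    by (intro connected_intermediate_closure[OF G]) (use closure_subset in auto)
  then show ?thesis using \<open>z \<in> G\<close> GS w(1) fw by (intro exI[of _ "insert w G"]) (auto simp: G_def)
qed

text \<open>Each point of \<open>S\<close> over the column is joined, over the column, to the
  component near which it lies. Hence mergers of bands at \<open>c\<close> and components that no
  band approaches do not affect the count as long as the column contains \<open>c\<close>.\<close>

lemma pixelation_slice_components_column:
  assumes "0 < \<epsilon>" "2 * \<epsilon> < \<delta>" "2 * \<epsilon> < \<eta>" and c: "c \<in> grid_column \<epsilon> x"
  shows "slice_components (pixelation \<epsilon> S) x = card comps"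
proof -
  let ?W = "grid_column \<epsilon> x"
  have W: "\<bar>t - c\<bar> < \<delta>" if "t \<in> ?W" for t
  proof -
    have "t \<in> {x - \<epsilon>..x + \<epsilon>}" "c \<in> {x - \<epsilon>..x + \<epsilon>}"
      using grid_column_bounds(2)[OF assms(1)] that c by blast+
    then show ?thesis using assms(2) by (auto simp: abs_less_iff)
  qed
  define T where "T = (\<lambda>K. {z\<in>S. fst z \<in> ?W} \<inter> nbhd K)"
  show ?thesis
  proof (rule slice_components_pixelation[OF assms(1) compact_imp_bounded[OF compact] finite_comps, where T = T])
    show "S \<inter> ?W \<times> UNIV = (\<Union>K\<in>comps. T K)" using covered W by (auto simp: T_def)
    show "\<bar>snd z - snd w\<bar> > 2 * \<epsilon>"
      if "K \<in> comps" "L \<in> comps" "K \<noteq> L" "z \<in> T K" "w \<in> T L" for K L z w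
      using nbhd_separated[OF that(1-3), of z w] that(4,5) assms(3) by (auto simp: T_def)
    fix K assume K: "K \<in> comps"
    have KT: "K \<subseteq> T K" using comps_props[OF K] c by (auto simp: T_def)
    have "connected (T K)"
    proof (rule connected_via_hub[OF comps_props(1)[OF K] KT comps_props(2)[OF K]])
      fix z assume z: "z \<in> T K"
      show "\<exists>X. connected X \<and> z \<in> X \<and> X \<subseteq> T K \<and> X \<inter> K \<noteq> {}"
      proof (cases "fst z = c")
        case True
        have "z \<in> S" using z by (simp add: T_def)
        from fibre_covered[OF this True] obtain L where L: "L \<in> comps" "z \<in> L" .
        have "L = K" using nbhd_disjoint[OF L(1) K] L comps_props(5)[OF L(1)] z by (auto simp: T_def)
        then show ?thesis using L comps_props(1)[OF K] KT by blast
      next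
        case False
        \<comment> \<open>The stretch from \<open>z\<close> to the line without its end
          \<open>c\<close>, so that it avoids \<open>C\<close> even when \<open>c\<close> is
          exceptional.\<close>
        define I where "I = (if fst z < c then {fst z..<c} else {c<..fst z})"
        have zW: "fst z \<in> ?W" "z \<in> S" using z by (auto simp: T_def)
        have IW: "insert c I \<subseteq> ?W" using zW(1) c by (auto simp: I_def grid_column_def split: if_splits)
        have "x \<notin> C" if "x \<in> I" for x
        proof
          assume "x \<in> C"
          moreover have "x \<noteq> c" using that by (auto simp: I_def split: if_splits)
          ultimately have "\<delta> \<le> \<bar>x - c\<bar>" by (rule punctured)
          moreover have "\<bar>x - c\<bar> < \<delta>" using W IW that by blast
          ultimately show False by simp
        qed
        then have "I \<inter> C = {}" by blast
        moreover have "connected I" "c \<in> closure I" "fst z \<in> I"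
          using False by (auto simp: I_def closure_greaterThanAtMost closure_atLeastLessThan)
        ultimately obtain X where X: "connected X" "z \<in> X" "X \<subseteq> S" "fst ` X \<subseteq> insert c I" "\<exists>w\<in>X. fst w = c"
          using path_to_fibre[of I z] zW(2) by blast
        have "\<bar>fst v - c\<bar> < \<delta>" if "v \<in> X" for v using X(4) IW W that by blast
        then have XN: "X \<subseteq> nbhd K"
          using connected_subset_nbhd[OF X(1,3) _ K] X(2) z by (auto simp: T_def)
        obtain w where w: "w \<in> X" "fst w = c" using X(5) by blast
        then have "w \<in> S" using X(3) by blast
        from fibre_covered[OF this w(2)] obtain L where L: "L \<in> comps" "w \<in> L" .
        have "L = K" using nbhd_disjoint[OF L(1) K] L comps_props(5)[OF L(1)] w XN by auto
        moreover have "X \<subseteq> T K" unfolding T_def using X(3,4) IW XN by blast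
        ultimately show ?thesis using X(1,2) w(1) L(2) by blast
      qed
    qed
    then show "connected (T K) \<and> T K \<noteq> {}" using KT comps_props(2)[OF K] by blast
  qed
qed

text \<open>A connected band close to the line stays near one component of the slice over
  \<open>c\<close>, which is its value under \<open>\<phi>\<close>. In general \<open>\<phi>\<close>
  is neither injective, as bands may merge, nor surjective, as a component may be missed from this
  side.\<close>

lemma bands_assigned:
  assumes I: "connected I" "I \<inter> C = {}" "I \<subseteq> {c - \<delta><..<c + \<delta>}" "I \<noteq> {}"
  obtains J :: "nat set" and a b \<phi> where "finite J"
    "\<And>j. j \<in> J \<Longrightarrow> continuous_on I (a j)" "\<And>j. j \<in> J \<Longrightarrow> continuous_on I (b j)"
    "\<And>j x. j \<in> J \<Longrightarrow> x \<in> I \<Longrightarrow> a j x \<le> b j x"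
    "\<And>i j x. i \<in> J \<Longrightarrow> j \<in> J \<Longrightarrow> i < j \<Longrightarrow> x \<in> I \<Longrightarrow> b i x < a j x"
    "\<And>x y. x \<in> I \<Longrightarrow> (x, y) \<in> S \<longleftrightarrow> (\<exists>j\<in>J. a j x \<le> y \<and> y \<le> b j x)"
    "\<And>j. j \<in> J \<Longrightarrow> \<phi> j \<in> comps"
    "\<And>j x y. j \<in> J \<Longrightarrow> x \<in> I \<Longrightarrow> a j x \<le> y \<Longrightarrow> y \<le> b j x \<Longrightarrow> (x, y) \<in> nbhd (\<phi> j)"
    "\<And>x. x \<in> I \<Longrightarrow> slice_components S x = card J"
proof -
  obtain J :: "nat set" and a b where J: "finite J"
    and cont: "\<And>j. j \<in> J \<Longrightarrow> continuous_on I (a j)" "\<And>j. j \<in> J \<Longrightarrow> continuous_on I (b j)"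
    and ab: "\<And>j t. j \<in> J \<Longrightarrow> t \<in> I \<Longrightarrow> a j t \<le> b j t"
    and ba: "\<And>i j t. i \<in> J \<Longrightarrow> j \<in> J \<Longrightarrow> i < j \<Longrightarrow> t \<in> I \<Longrightarrow> b i t < a j t"
    and SJ: "\<And>t y. t \<in> I \<Longrightarrow> (t, y) \<in> S \<longleftrightarrow> (\<exists>j\<in>J. a j t \<le> y \<and> y \<le> b j t)"
    by (rule band_decomposition[OF adapted compact I(1,2)]) blast
  have "\<exists>K\<in>comps. \<forall>x y. x \<in> I \<longrightarrow> a j x \<le> y \<longrightarrow> y \<le> b j x \<longrightarrow> (x, y) \<in> nbhd K" if j: "j \<in> J" for j
  proof -
    let ?B = "{(x, y). x \<in> I \<and> a j x \<le> y \<and> y \<le> b j x}"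
    have B: "connected ?B" by (rule connected_band[OF I(1) cont(1)[OF j] cont(2)[OF j] ab[OF j]])
    have BS: "?B \<subseteq> S" using SJ j by blast
    have near: "\<bar>fst z - c\<bar> < \<delta>" if "z \<in> ?B" for z using that I(3) by (force simp: abs_less_iff)
    obtain x0 where x0: "x0 \<in> I" using I(4) by blast
    then have mem: "(x0, a j x0) \<in> ?B" using ab[OF j] by simp
    then obtain K where K: "K \<in> comps" "(x0, a j x0) \<in> nbhd K" using covered near BS by blast
    have "?B \<subseteq> nbhd K" by (rule connected_subset_nbhd[OF B BS near K(1)]) (use mem K(2) in blast)+
    then show ?thesis using K(1) by blast
  qed
  then obtain \<phi> where \<phi>: "\<And>j. j \<in> J \<Longrightarrow> \<phi> j \<in> comps"
    "\<And>j x y. j \<in> J \<Longrightarrow> x \<in> I \<Longrightarrow> a j x \<le> y \<Longrightarrow> y \<le> b j x \<Longrightarrow> (x, y) \<in> nbhd (\<phi> j)"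
    by metis
  have "slice_components S x = card J" if x: "x \<in> I" for x
    by (rule slice_components_bands[OF J, of "\<lambda>j. a j x" "\<lambda>j. b j x"]) (use ab ba SJ x in auto)
  then show thesis using that J cont ab ba SJ \<phi> by blast
qed

text \<open>The map \<open>\<phi>\<close> is onto by \<open>hit\<close>, and its source and target
  have equal size by \<open>count\<close>, so it is a bijection. Different bands then lie near
  different components and are more than \<eta> apart, uniformly up to \<open>c\<close>.\<close>

lemma pixelation_slice_components_side:
  assumes I: "connected I" "I \<inter> C = {}" "I \<subseteq> {c - \<delta><..<c + \<delta>}"
    and count: "\<And>x. x \<in> I \<Longrightarrow> slice_components S x = card comps"
    and hit: "\<And>K. K \<in> comps \<Longrightarrow> \<exists>z\<in>S. fst z \<in> I \<and> z \<in> nbhd K"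
    and \<epsilon>: "0 < \<epsilon>" "2 * \<epsilon> < \<eta>" and col: "grid_column \<epsilon> x \<subseteq> I"
  shows "slice_components (pixelation \<epsilon> S) x = card comps"
proof -
  note xW = grid_column_bounds(1)[OF \<epsilon>(1), of x]
  then have xI: "x \<in> I" using col by blast
  then have ne: "I \<noteq> {}" by blast
  obtain J :: "nat set" and a b \<phi> where J: "finite J"
    and cont: "\<And>j. j \<in> J \<Longrightarrow> continuous_on I (a j)" "\<And>j. j \<in> J \<Longrightarrow> continuous_on I (b j)"
    and ab: "\<And>j t. j \<in> J \<Longrightarrow> t \<in> I \<Longrightarrow> a j t \<le> b j t"
    and SJ: "\<And>t y. t \<in> I \<Longrightarrow> (t, y) \<in> S \<longleftrightarrow> (\<exists>j\<in>J. a j t \<le> y \<and> y \<le> b j t)"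
    and \<phi>: "\<And>j. j \<in> J \<Longrightarrow> \<phi> j \<in> comps"
      "\<And>j x y. j \<in> J \<Longrightarrow> x \<in> I \<Longrightarrow> a j x \<le> y \<Longrightarrow> y \<le> b j x \<Longrightarrow> (x, y) \<in> nbhd (\<phi> j)"
    and cardJ: "\<And>x. x \<in> I \<Longrightarrow> slice_components S x = card J"
    by (rule bands_assigned[OF I ne]) blast
  have "comps \<subseteq> \<phi> ` J"
  proof
    fix K assume K: "K \<in> comps"
    then obtain z where z: "z \<in> S" "fst z \<in> I" "z \<in> nbhd K" using hit by blast
    then obtain j where j: "j \<in> J" "a j (fst z) \<le> snd z" "snd z \<le> b j (fst z)"
      using SJ[OF z(2), of "snd z"] by auto
    then have "z \<in> nbhd (\<phi> j)" using \<phi>(2)[OF j(1) z(2) j(2,3)] by simp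
    then have "\<phi> j = K" using nbhd_disjoint[OF \<phi>(1)[OF j(1)] K] z(3) by blast
    then show "K \<in> \<phi> ` J" using j(1) by blast
  qed
  then have "\<phi> ` J = comps" using \<phi>(1) by blast
  moreover have "card J = card comps" using cardJ[OF xI] count[OF xI] by simp
  ultimately have inj: "inj_on \<phi> J" by (intro eq_card_imp_inj_on[OF J]) simp
  let ?W = "grid_column \<epsilon> x"
  define T where "T = (\<lambda>j. {(t, y). t \<in> ?W \<and> a j t \<le> y \<and> y \<le> b j t})"
  have "slice_components (pixelation \<epsilon> S) x = card J"
  proof (rule slice_components_pixelation[OF \<epsilon>(1) compact_imp_bounded[OF compact] J, where T = T])
    show "connected (T j) \<and> T j \<noteq> {}" if j: "j \<in> J" for j
    proof
      show "connected (T j)" unfolding T_def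
        by (intro connected_band continuous_on_subset[OF cont(1)[OF j] col] continuous_on_subset[OF cont(2)[OF j] col])
          (use ab[OF j] col in \<open>auto simp: grid_column_def\<close>)
      show "T j \<noteq> {}" using xW ab[OF j xI] by (auto simp: T_def)
    qed
    show "S \<inter> ?W \<times> UNIV = (\<Union>j\<in>J. T j)" using SJ col by (auto simp: T_def)
    show "\<bar>snd z - snd w\<bar> > 2 * \<epsilon>" if ij: "i \<in> J" "j \<in> J" "i \<noteq> j" and z: "z \<in> T i" and w: "w \<in> T j" for i j z w
    proof -
      have "z \<in> nbhd (\<phi> i)" "w \<in> nbhd (\<phi> j)"
        using \<phi>(2)[OF ij(1), of "fst z" "snd z"] \<phi>(2)[OF ij(2), of "fst w" "snd w"] z w col by (auto simp: T_def)
      moreover have "\<phi> i \<noteq> \<phi> j" using inj ij by (meson inj_onD)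
      ultimately have "\<eta> < \<bar>snd z - snd w\<bar>" using nbhd_separated \<phi>(1) ij by blast
      then show ?thesis using \<epsilon>(2) by linarith
    qed
  qed
  then show ?thesis using \<open>card J = card comps\<close> by simp
qed

end

section \<open>Non-critical points\<close>


text \<open>Near \<open>t0\<close> the first coordinate is a power series, so its derivative is
  continuous; where the derivative has no zero, the mean value theorem excludes equal
  values.\<close>

lemma analytic_coordinate:
  assumes an: "real_analytic_on \<gamma> {0<..<1}" and t0: "t0 \<in> {0<..<1}"
  obtains D where "((fst \<circ> \<gamma>) has_real_derivative D) (at t0)"
    "D \<noteq> 0 \<Longrightarrow> \<exists>e>0. inj_on (fst \<circ> (\<gamma> :: real \<Rightarrow> plane)) (ball t0 e)"
proof -
  obtain a r where r: "r > 0" and sums: "\<And>s. \<bar>s - t0\<bar> < r \<Longrightarrow> (\<lambda>n. (s - t0) ^ n *\<^sub>R a n) sums \<gamma> s"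
    using an t0 unfolding real_analytic_on_def by meson
  define c where "c = (\<lambda>n. fst (a n))"
  have fsums: "(\<lambda>n. c n * (s - t0) ^ n) sums fst (\<gamma> s)" if "\<bar>s - t0\<bar> < r" for s
    using bounded_linear.sums[OF bounded_linear_fst sums[OF that]] by (simp add: c_def mult.commute)
  have summ: "summable (\<lambda>n. c n * u ^ n)" if "norm u < r" for u
    using sums_summable[OF fsums[of "t0 + u"]] that by simp
  define g where "g = (\<lambda>u. \<Sum>n. diffs c n * u ^ n)"
  have deriv: "((fst \<circ> \<gamma>) has_real_derivative g (s - t0)) (at s)" if s: "\<bar>s - t0\<bar> < r / 2" for s
  proof (rule has_field_derivative_transform_within_open)
    have "((\<lambda>u. \<Sum>n. c n * u ^ n) has_real_derivative g (s - t0)) (at (s - t0))"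
      unfolding g_def using s r summ[of "r / 2"] by (intro termdiffs_strong[of c "r / 2"]) auto
    moreover have "((\<lambda>s. s - t0) has_real_derivative 1) (at s)" by (auto intro!: derivative_eq_intros)
    ultimately show "((\<lambda>s. \<Sum>n. c n * (s - t0) ^ n) has_real_derivative g (s - t0)) (at s)"
      by (rule DERIV_chain2[where Db = 1, simplified])
    show "open (ball t0 r)" by simp
    show "s \<in> ball t0 r" using s r unfolding mem_ball dist_real_def by linarith
    show "(\<Sum>n. c n * (x - t0) ^ n) = (fst \<circ> \<gamma>) x" if "x \<in> ball t0 r" for x
      using fsums[of x] that by (simp add: sums_iff dist_real_def abs_minus_commute)
  qed
  show thesis
  proof (rule that[of "g 0"])
    show "((fst \<circ> \<gamma>) has_real_derivative g 0) (at t0)" using deriv[of t0] r by simp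
    assume g0: "g 0 \<noteq> 0"
    have "summable (\<lambda>n. diffs c n * (r / 2) ^ n)"
      using r by (intro termdiff_converges[where K = r] summ) auto
    then have "isCont g 0" unfolding g_def using r by (intro isCont_powser[where K = "r / 2"]) auto
    then have "\<forall>\<^sub>F u in nhds 0. g u \<noteq> 0"
      using g0 by (metis isCont_def tendsto_at_iff_tendsto_nhds tendsto_imp_eventually_ne)
    then obtain d where d: "d > 0" "\<And>u. dist u 0 < d \<Longrightarrow> g u \<noteq> 0"
      unfolding eventually_nhds_metric by blast
    have no: "(fst \<circ> \<gamma>) s \<noteq> (fst \<circ> \<gamma>) t"
      if st: "s < t" "s \<in> ball t0 (min d (r / 2))" "t \<in> ball t0 (min d (r / 2))" for s t
    proof
      assume eq: "(fst \<circ> \<gamma>) s = (fst \<circ> \<gamma>) t"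
      have near: "\<bar>z - t0\<bar> < min d (r / 2)" if "s \<le> z" "z \<le> t" for z
        using st that unfolding mem_ball dist_real_def by linarith
      obtain z where z: "s < z" "z < t" "(fst \<circ> \<gamma>) t - (fst \<circ> \<gamma>) s = (t - s) * g (z - t0)"
        using MVT2[OF st(1), of "fst \<circ> \<gamma>" "\<lambda>z. g (z - t0)"] deriv near by force
      then have "g (z - t0) = 0" using eq st(1) by simp
      moreover have "g (z - t0) \<noteq> 0" using near[of z] z by (intro d(2)) (simp add: dist_real_def)
      ultimately show False by simp
    qed
    have "inj_on (fst \<circ> \<gamma>) (ball t0 (min d (r / 2)))"
      by (intro linorder_inj_onI) (use no in auto)
    then show "\<exists>e>0. inj_on (fst \<circ> \<gamma>) (ball t0 e)" using d(1) r by (intro exI[of _ "min d (r / 2)"]) auto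
  qed
qed

text \<open>A point of \<open>S\<close> off \<open>F 1\<close> lies in a face, which is an open
  subset of \<open>S\<close>.\<close>

lemma frontier_subset_one_skeleton:
  assumes "good_stratification S F" shows "frontier S \<subseteq> F 1"
proof
  fix p assume p: "p \<in> frontier S"
  have F: "F 2 = S" "closed (F 2)" "\<And>U. U \<in> faces F \<Longrightarrow> open U" "F 1 \<subseteq> F 2"
    using assms unfolding good_stratification_def by auto
  have "p \<in> S" using p F(1,2) frontier_subset_closed by blast
  show "p \<in> F 1"
  proof (rule ccontr)
    assume "p \<notin> F 1"
    then have "p \<in> \<Union>(components (F 2 - F 1))" using \<open>p \<in> S\<close> F(1) Union_components[of "F 2 - F 1"] by simp
    then obtain U where U: "U \<in> faces F" "p \<in> U" unfolding faces_def by blast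
    have "U \<subseteq> S" using U(1) in_components_subset F(1) unfolding faces_def by blast
    then have "p \<in> interior S" using F(3)[OF U(1)] U(2) by (meson interiorI)
    then show False using p by (simp add: frontier_def)
  qed
qed

text \<open>A point of \<open>S\<close> that is not interior lies in \<open>F 1\<close>. Vertices
  count as critical, so it lies on an arc, and because it is not critical there either,
  \<open>fst\<close> is a local coordinate of that arc.\<close>

lemma noncritical_point_cases:
  assumes gs: "good_stratification S F" and p: "p \<in> S" "\<not> critical_point fst F p"
  obtains "p \<in> interior S"
  | A \<gamma> g t0 D e where "A \<in> arcs F" "A \<subseteq> S" "homeomorphism {0<..<1} A \<gamma> g" "t0 \<in> {0<..<1}" "\<gamma> t0 = p"
      "((fst \<circ> \<gamma>) has_real_derivative D) (at t0)" "D \<noteq> 0" "e > 0" "inj_on (fst \<circ> \<gamma>) (ball t0 e)"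
proof (cases "p \<in> interior S")
  case False
  have F: "F 2 = S" "closed S" "F 1 \<subseteq> F 2" and arc: "\<And>A. A \<in> arcs F \<Longrightarrow> \<exists>\<gamma>. arc_parametrization \<gamma> A"
    using gs unfolding good_stratification_def by auto
  have "p \<in> frontier S" using False p(1) F(2) by (simp add: frontier_def)
  then have "p \<in> F 1" using frontier_subset_one_skeleton[OF gs] by blast
  moreover have "p \<notin> F 0" using p(2) by (simp add: critical_point_def)
  ultimately have "p \<in> \<Union>(components (F 1 - F 0))" using Union_components[of "F 1 - F 0"] by simp
  then obtain A where A: "A \<in> arcs F" "p \<in> A" unfolding arcs_def by blast
  obtain \<gamma> where \<gamma>: "arc_parametrization \<gamma> A" using arc[OF A(1)] by blast
  then obtain g where an: "real_analytic_on \<gamma> {0<..<1}" and g: "homeomorphism {0<..<1} A \<gamma> g"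
    unfolding arc_parametrization_def by blast
  have "g p \<in> {0<..<1}" "\<gamma> (g p) = p" using g A(2) unfolding homeomorphism_def by blast+
  note t0 = this
  obtain D where D: "((fst \<circ> \<gamma>) has_real_derivative D) (at (g p))"
    "D \<noteq> 0 \<Longrightarrow> \<exists>e>0. inj_on (fst \<circ> \<gamma>) (ball (g p) e)"
    by (rule analytic_coordinate[OF an t0(1)]) blast
  have "D \<noteq> 0"
  proof
    assume "D = 0"
    then have "arc_critical fst A p" unfolding arc_critical_def using \<gamma> t0 D(1) by blast
    then show False using p(2) A(1) by (auto simp: critical_point_def)
  qed
  moreover have "A \<subseteq> S" using A(1) in_components_subset F(1,3) unfolding arcs_def by blast
  ultimately show thesis using that(2) A g t0 D by blast
qed (rule that(1))

text \<open>\<open>S\<close> continues to both sides of a noncritical point: along an arc the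
  abscissa passes strictly through \<open>fst p\<close>, and the intermediate value property gives a
  nearby point over every nearby \<open>x\<close>.\<close>

lemma noncritical_point_fibres_nonempty:
  assumes gs: "good_stratification S F" and p: "p \<in> S" "\<not> critical_point fst F p" and e: "e > 0"
  shows "\<exists>d>0. \<forall>x. \<bar>x - fst p\<bar> < d \<longrightarrow> (\<exists>y. \<bar>y - snd p\<bar> < e \<and> (x, y) \<in> S)"
  using gs p
proof (cases rule: noncritical_point_cases)
  case 1
  then obtain d where d: "d > 0" "ball p d \<subseteq> S" by (meson mem_interior)
  have "(x, snd p) \<in> S" if "\<bar>x - fst p\<bar> < d" for x
  proof -
    have "dist p (x, snd p) < d" using that by (simp add: dist_prod_def dist_real_def abs_minus_commute)
    then show ?thesis using d(2) by auto
  qed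
  then show ?thesis using d(1) e by (intro exI[of _ d]) force
next
  case (2 A \<gamma> g t0 D e')
  have cont: "continuous_on {0<..<1} \<gamma>" using 2(3) unfolding homeomorphism_def by blast
  have mem: "\<gamma> t \<in> S" if "t \<in> {0<..<1}" for t using 2(2,3) that unfolding homeomorphism_def by blast
  have "isCont \<gamma> t0" using cont 2(4) by (simp add: continuous_on_eq_continuous_at)
  then obtain d1 where d1: "d1 > 0" "\<And>t. dist t t0 < d1 \<Longrightarrow> dist (\<gamma> t) (\<gamma> t0) < e"
    using e unfolding continuous_at_eps_delta by blast
  define \<sigma> where "\<sigma> = sgn D"
  have "((\<lambda>t. \<sigma> * (fst \<circ> \<gamma>) t) has_real_derivative \<sigma> * D) (at t0)" by (intro DERIV_cmult 2(6))
  moreover have "\<sigma> * D > 0" using 2(7) by (cases "D > 0") (simp_all add: \<sigma>_def)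
  ultimately obtain d2 d3 where d2: "d2 > 0" "\<And>h. 0 < h \<Longrightarrow> h < d2 \<Longrightarrow> \<sigma> * (fst \<circ> \<gamma>) t0 < \<sigma> * (fst \<circ> \<gamma>) (t0 + h)"
    and d3: "d3 > 0" "\<And>h. 0 < h \<Longrightarrow> h < d3 \<Longrightarrow> \<sigma> * (fst \<circ> \<gamma>) (t0 - h) < \<sigma> * (fst \<circ> \<gamma>) t0"
    using DERIV_pos_inc_right[of "\<lambda>t. \<sigma> * (fst \<circ> \<gamma>) t" "\<sigma> * D" t0]
      DERIV_pos_inc_left[of "\<lambda>t. \<sigma> * (fst \<circ> \<gamma>) t" "\<sigma> * D" t0] by blast
  \<comment> \<open>Small enough to stay within \<open>e\<close> of \<open>p\<close>, to use the
    strict growth on both sides of \<open>t0\<close>, and to remain in the parameter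
    interval.\<close>
  define h where "h = min (min d1 (min d2 d3)) (min t0 (1 - t0)) / 2"
  have h: "0 < h" "h < d1" "h < d2" "h < d3" "h < t0" "h < 1 - t0"
    using d1(1) d2(1) d3(1) 2(4) by (simp_all add: h_def min_def)
  let ?T = "{t0 - h..t0 + h}"
  have T: "?T \<subseteq> {0<..<1}" using h by auto
  have conn: "connected ((\<lambda>t. fst (\<gamma> t)) ` ?T)"
    by (intro connected_continuous_image continuous_intros continuous_on_subset[OF cont T]) simp
  have "\<exists>u\<in>?T. \<exists>v\<in>?T. fst (\<gamma> u) < fst p \<and> fst p < fst (\<gamma> v)"
  proof (cases "D > 0")
    case True
    then have "\<sigma> = 1" by (simp add: \<sigma>_def)
    then show ?thesis using d2(2)[of h] d3(2)[of h] h 2(5)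
      by (intro bexI[of _ "t0 - h"] bexI[of _ "t0 + h"]) auto
  next
    case False
    then have "\<sigma> = -1" using 2(7) by (simp add: \<sigma>_def)
    then show ?thesis using d2(2)[of h] d3(2)[of h] h 2(5)
      by (intro bexI[of _ "t0 + h"] bexI[of _ "t0 - h"]) auto
  qed
  then obtain u v where uv: "u \<in> ?T" "v \<in> ?T" "fst (\<gamma> u) < fst p" "fst p < fst (\<gamma> v)" by blast
  show ?thesis
  proof (rule exI[of _ "min (fst p - fst (\<gamma> u)) (fst (\<gamma> v) - fst p)"], intro conjI allI impI)
    show "min (fst p - fst (\<gamma> u)) (fst (\<gamma> v) - fst p) > 0" using uv by simp
    fix x assume x: "\<bar>x - fst p\<bar> < min (fst p - fst (\<gamma> u)) (fst (\<gamma> v) - fst p)"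
    then have "fst (\<gamma> u) \<le> x" "x \<le> fst (\<gamma> v)" by auto
    then have "x \<in> (\<lambda>t. fst (\<gamma> t)) ` ?T"
      using conn uv(1,2) unfolding connected_iff_interval by blast
    then obtain t where t: "t \<in> ?T" "x = fst (\<gamma> t)" by blast
    have "dist t t0 < d1" using t(1) h(2) by (auto simp: dist_real_def)
    then have "dist (\<gamma> t) p < e" using d1(2) 2(5) by blast
    then have "\<bar>snd (\<gamma> t) - snd p\<bar> < e" using dist_snd_le[of "\<gamma> t" p] by (simp add: dist_real_def)
    moreover have "(x, snd (\<gamma> t)) \<in> S" using mem[of t] t T by auto
    ultimately show "\<exists>y. \<bar>y - snd p\<bar> < e \<and> (x, y) \<in> S" by blast
  qed
qed

text \<open>Each graph, completed by \<open>p\<close>, is a connected subset of \<open>F 1\<close>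
  without vertices, so both lie in the arc through \<open>p\<close>. Two of their points over the
  same abscissa close to \<open>p\<close> have parameters near \<open>t0\<close>, where
  \<open>fst\<close> is injective along the arc, and so coincide.\<close>

lemma no_merge_at_noncritical_point:
  assumes gs: "good_stratification S F" and p: "p \<in> S" "\<not> critical_point fst F p"
    and I: "connected I" "I \<inter> fst ` F 0 = {}"
    and ab: "continuous_on I a" "continuous_on I b" "\<And>x. x \<in> I \<Longrightarrow> b x < a x"
    and fr: "\<And>x. x \<in> I \<Longrightarrow> (x, a x) \<in> frontier S" "\<And>x. x \<in> I \<Longrightarrow> (x, b x) \<in> frontier S"
    and x: "\<And>n. x n \<in> I" and lim: "(\<lambda>n. (x n, a (x n))) \<longlonglongrightarrow> p" "(\<lambda>n. (x n, b (x n))) \<longlonglongrightarrow> p"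
  shows False
proof -
  have F1: "frontier S \<subseteq> F 1" by (rule frontier_subset_one_skeleton[OF gs])
  have "p \<in> frontier S"
    by (rule closed_sequentially[OF frontier_closed _ lim(1)]) (use fr x in blast)
  then have "p \<notin> interior S" by (simp add: frontier_def)
  with gs p obtain A g t0 e and \<gamma> :: "real \<Rightarrow> plane" where A: "A \<in> arcs F" and hom: "homeomorphism {0<..<1} A \<gamma> g"
    and t0: "t0 \<in> {0<..<1}" "\<gamma> t0 = p" and e: "e > 0" "inj_on (fst \<circ> \<gamma>) (ball t0 e)"
  proof (cases rule: noncritical_point_cases)
    case (2 A \<gamma> g t0 D e)
    then show ?thesis using that[of A \<gamma> g t0 e] by simp
  qed simp
  have pA: "p \<in> A" using hom t0 unfolding homeomorphism_def by blast
  have in_A: "(x', s x') \<in> A"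
    if s: "continuous_on I s" "\<And>x. x \<in> I \<Longrightarrow> (x, s x) \<in> frontier S" "(\<lambda>n. (x n, s (x n))) \<longlonglongrightarrow> p"
      and x': "x' \<in> I" for s x'
  proof -
    let ?G = "(\<lambda>x. (x, s x)) ` I"
    have G: "connected ?G" by (intro connected_continuous_image continuous_intros s I(1))
    have "p \<in> closure ?G" unfolding closure_sequential using s(3) x by (intro exI[of _ "\<lambda>n. (x n, s (x n))"]) auto
    then have "connected (insert p ?G)"
      using closure_subset[of ?G] by (intro connected_intermediate_closure[OF G]) blast+
    moreover have "insert p ?G \<subseteq> F 1 - F 0"
    proof -
      have "?G \<subseteq> F 1" using s(2) F1 by blast
      moreover have "z \<notin> F 0" if "z \<in> ?G" for z
        using that I(2) by force
      moreover have "p \<in> F 1 - F 0" using pA A in_components_subset unfolding arcs_def by blast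
      ultimately show ?thesis by blast
    qed
    ultimately have "insert p ?G \<subseteq> A"
      using components_maximal[of A "F 1 - F 0" "insert p ?G"] A pA unfolding arcs_def by blast
    then show ?thesis using x' by blast
  qed
  have aA: "(x n, a (x n)) \<in> A" and bA: "(x n, b (x n)) \<in> A" for n
    using in_A[OF ab(1) fr(1) lim(1) x] in_A[OF ab(2) fr(2) lim(2) x] by blast+
  have gcont: "continuous_on A g" and g\<gamma>: "\<And>z. z \<in> A \<Longrightarrow> \<gamma> (g z) = z" and gp: "g p = t0"
    using hom t0 unfolding homeomorphism_def by auto
  \<comment> \<open>This uses the continuity of the inverse parametrization: the arc cannot pass
    close to \<open>p\<close> a second time at parameters far from \<open>t0\<close>.\<close>
  have conv: "\<forall>\<^sub>F n in sequentially. g (z n) \<in> ball t0 e" if z: "\<And>n. z n \<in> A" "z \<longlonglongrightarrow> p" for z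
  proof -
    have "(\<lambda>n. g (z n)) \<longlonglongrightarrow> g p"
      by (rule continuous_on_tendsto_compose[OF gcont z(2) pA]) (simp add: z(1))
    then show ?thesis unfolding gp using e(1) by (intro topological_tendstoD) auto
  qed
  have "\<forall>\<^sub>F n in sequentially. False"
    using conv[of "\<lambda>n. (x n, a (x n))", OF aA lim(1)] conv[of "\<lambda>n. (x n, b (x n))", OF bA lim(2)]
  proof eventually_elim
    case (elim n)
    have "(fst \<circ> \<gamma>) (g (x n, a (x n))) = (fst \<circ> \<gamma>) (g (x n, b (x n)))"
      by (simp add: g\<gamma>[OF aA] g\<gamma>[OF bA])
    then have "g (x n, a (x n)) = g (x n, b (x n))" using inj_onD[OF e(2)] elim by blast
    then have "(x n, a (x n)) = (x n, b (x n))" using g\<gamma>[OF aA] g\<gamma>[OF bA] by metis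
    then show False using ab(3)[OF x[of n]] by simp
  qed
  then show False by simp
qed

section \<open>Exceptional abscissae without a jump\<close>


text \<open>Allows the abscissae of the vertices to be added to the exceptional set.\<close>

lemma adapted_mono:
  assumes "adapted S Q C" "C \<subseteq> C'" "finite C'" shows "adapted S Q C'"
proof -
  have "\<And>X. X \<inter> C' = {} \<Longrightarrow> X \<inter> C = {}" using assms(2) by blast
  moreover have "\<And>x. x \<notin> C' \<Longrightarrow> x \<notin> C" using assms(2) by blast
  ultimately show ?thesis using assms(1,3) unfolding adapted_def
    by (elim conjE) (intro conjI; meson)
qed

lemma isCont_nat_iff:
  "isCont (f :: real \<Rightarrow> nat) x \<longleftrightarrow> (\<forall>\<^sub>F y in nhds x. f y = f x)"
  by (simp add: isCont_def tendsto_discrete eventually_nhds_conv_at)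

context isolated_fibre
begin

text \<open>The limit lies in some component, whose open neighbourhood then contains some
  \<open>z n\<close>; disjointness of the neighbourhoods identifies that component with
  \<open>K\<close>.\<close>

lemma limit_in_component:
  assumes "K \<in> comps" "\<And>n. z n \<in> S" "\<And>n. z n \<in> nbhd K" "z \<longlonglongrightarrow> w" "fst w = c"
  shows "w \<in> K"
proof -
  have "w \<in> S" by (rule closed_sequentially[OF compact_imp_closed[OF compact] assms(2,4)])
  then obtain L where L: "L \<in> comps" "w \<in> L" using fibre_covered assms(5) by blast
  then have "w \<in> nbhd L" using comps_props(5) by blast
  then have "\<forall>\<^sub>F n in sequentially. z n \<in> nbhd L" by (rule topological_tendstoD[OF assms(4) open_nbhd])
  then obtain n where "z n \<in> nbhd L" by (meson eventually_sequentially order_refl)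
  then have "L = K" using nbhd_disjoint[OF L(1) assms(1)] assms(3) by blast
  then show ?thesis using L(2) by simp
qed

text \<open>If a component of the fibre were missed from one side, it would contain a critical point, and
  by counting, two bands would merge at another component, which is then free of critical points.\<close>

lemma all_components_hit:
  assumes gs: "good_stratification S F" and sm: "stratified_morse fst F" and F0: "fst ` F 0 \<subseteq> C"
    and I: "connected I" "I \<inter> C = {}" "I \<subseteq> {c - \<delta><..<c + \<delta>}" "c \<in> closure I"
    and count: "\<And>x. x \<in> I \<Longrightarrow> slice_components S x = card comps"
    and K0: "K0 \<in> comps"
  shows "\<exists>z\<in>S. fst z \<in> I \<and> z \<in> nbhd K0"
proof (rule ccontr)
  assume miss: "\<not> ?thesis"
  obtain x where x: "\<And>n. x n \<in> I" "x \<longlonglongrightarrow> c" using I(4) closure_sequential by blast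
  have ne: "I \<noteq> {}" using x(1) by blast
  \<comment> \<open>Around a noncritical point of \<open>K0\<close> there would be points of
    \<open>S\<close> over every nearby abscissa, in particular over some \<open>x n\<close>, and
    within \<eta> of \<open>K0\<close>.\<close>
  have crit0: "critical_point fst F p" if p: "p \<in> K0" for p
  proof (rule ccontr)
    assume "\<not> critical_point fst F p"
    moreover have pS: "p \<in> S" "fst p = c" using comps_props[OF K0] p by blast+
    ultimately obtain d where d: "d > 0" "\<And>x. \<bar>x - c\<bar> < d \<Longrightarrow> \<exists>y. \<bar>y - snd p\<bar> < \<eta> / 2 \<and> (x, y) \<in> S"
      using noncritical_point_fibres_nonempty[OF gs pS(1), of "\<eta> / 2"] pos by auto
    have "\<forall>\<^sub>F n in sequentially. dist (x n) c < min d (\<eta> / 2)"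
      using x(2) d(1) pos by (intro tendstoD) auto
    then obtain n where n: "dist (x n) c < min d (\<eta> / 2)" by (meson eventually_sequentially order_refl)
    then obtain y where y: "\<bar>y - snd p\<bar> < \<eta> / 2" "(x n, y) \<in> S" using d(2)[of "x n"] by (auto simp: dist_real_def)
    have "dist p (x n, y) \<le> \<bar>c - x n\<bar> + \<bar>snd p - y\<bar>"
      using pS(2) by (simp add: dist_prod_def dist_real_def sqrt_sum_squares_le_sum_abs)
    also have "\<dots> < \<eta>" using n y(1) unfolding dist_real_def by linarith
    finally have "(x n, y) \<in> nbhd K0" unfolding nbhd_def using p by auto
    then show False using miss y(2) x(1)[of n] by force
  qed
  obtain p0 where p0: "p0 \<in> K0" "critical_point fst F p0" using comps_props(2)[OF K0] crit0 by blast
  \<comment> \<open>\<open>K0\<close> uses up the one critical point allowed over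
    \<open>c\<close>.\<close>
  have noncrit: "\<not> critical_point fst F p" if K: "K \<in> comps" "K \<noteq> K0" and p: "p \<in> K" for K p
  proof
    assume "critical_point fst F p"
    moreover have "fst p = fst p0" using comps_props(4)[OF K(1) p] comps_props(4)[OF K0 p0(1)] by simp
    ultimately have "p = p0" using sm p0(2) unfolding stratified_morse_def by blast
    then show False
      using nbhd_disjoint[OF K(1) K0 K(2)] comps_props(5)[OF K(1)] comps_props(5)[OF K0] p p0(1) by blast
  qed
  obtain J :: "nat set" and a b \<phi> where J: "finite J"
    and cont: "\<And>j. j \<in> J \<Longrightarrow> continuous_on I (a j)" "\<And>j. j \<in> J \<Longrightarrow> continuous_on I (b j)"
    and ab: "\<And>j t. j \<in> J \<Longrightarrow> t \<in> I \<Longrightarrow> a j t \<le> b j t"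
    and ba: "\<And>i j t. i \<in> J \<Longrightarrow> j \<in> J \<Longrightarrow> i < j \<Longrightarrow> t \<in> I \<Longrightarrow> b i t < a j t"
    and SJ: "\<And>t y. t \<in> I \<Longrightarrow> (t, y) \<in> S \<longleftrightarrow> (\<exists>j\<in>J. a j t \<le> y \<and> y \<le> b j t)"
    and \<phi>: "\<And>j. j \<in> J \<Longrightarrow> \<phi> j \<in> comps"
      "\<And>j x y. j \<in> J \<Longrightarrow> x \<in> I \<Longrightarrow> a j x \<le> y \<Longrightarrow> y \<le> b j x \<Longrightarrow> (x, y) \<in> nbhd (\<phi> j)"
    and cardJ: "\<And>x. x \<in> I \<Longrightarrow> slice_components S x = card J"
    by (rule bands_assigned[OF I(1-3) ne]) blast
  have "\<phi> j \<noteq> K0" if j: "j \<in> J" for j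
  proof
    assume "\<phi> j = K0"
    then have "(x 0, a j (x 0)) \<in> nbhd K0" "(x 0, a j (x 0)) \<in> S"
      using \<phi>(2)[OF j x(1)] ab[OF j x(1)] SJ[OF x(1)] j by blast+
    then show False using miss x(1)[of 0] by force
  qed
  then have "\<phi> ` J \<subseteq> comps - {K0}" using \<phi>(1) by blast
  then have "card (\<phi> ` J) \<le> card (comps - {K0})" using finite_comps by (intro card_mono) auto
  also have "\<dots> < card comps" using K0 finite_comps by (meson card_Diff1_less)
  also have "\<dots> = card J" using cardJ[OF x(1)[of 0]] count[OF x(1)[of 0]] by simp
  finally have "\<not> inj_on \<phi> J" by (rule pigeonhole)
  then obtain i' j' where "i' \<in> J" "j' \<in> J" "i' \<noteq> j'" "\<phi> i' = \<phi> j'" unfolding inj_on_def by blast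
  then obtain i j where ij: "i \<in> J" "j \<in> J" "i < j" "\<phi> i = \<phi> j"
    using that[of i' j'] that[of j' i'] by (cases i' j' rule: linorder_cases) simp_all
  define K1 where "K1 = \<phi> i"
  have K1: "K1 \<in> comps" "K1 \<noteq> K0" using \<phi>(1) \<open>\<And>j. j \<in> J \<Longrightarrow> \<phi> j \<noteq> K0\<close> ij(1) by (auto simp: K1_def)
  \<comment> \<open>The band next above \<open>i\<close>, so that no point of \<open>S\<close> lies
    between the two. It is not known to be assigned to \<open>K1\<close>, but its lower edge is
    squeezed in the limit between edges of the bands \<open>i\<close> and \<open>j\<close>, which
    are.\<close>
  define k where "k = Min {k\<in>J. i < k}"
  have fin: "finite {k\<in>J. i < k}" and "{k\<in>J. i < k} \<noteq> {}" using J ij by auto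
  then have "k \<in> {k\<in>J. i < k}" unfolding k_def by (rule Min_in)
  moreover have kmin: "k \<le> l" if "l \<in> J" "i < l" for l
    unfolding k_def using fin that by (intro Min_le) auto
  ultimately have k: "k \<in> J" "i < k" "k \<le> j" using ij by auto
  have gap: "(t, y) \<notin> S" if t: "t \<in> I" and y: "b i t < y" "y < a k t" for t y
  proof
    assume "(t, y) \<in> S"
    then obtain l where l: "l \<in> J" "a l t \<le> y" "y \<le> b l t" using SJ[OF t] by blast
    consider "l < i" | "l = i" | "l = k" | "k < l" using kmin[OF l(1)] k by linarith
    then show False
    proof cases
      case 1
      then show False using ba[OF l(1) ij(1) 1 t] ab[OF ij(1) t] l y by linarith
    next
      case 4
      then show False using ba[OF k(1) l(1) 4 t] ab[OF k(1) t] l y by linarith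
    qed (use l y in auto)
  qed
  have in_S: "(t, a l t) \<in> S" "(t, b l t) \<in> S" if "t \<in> I" "l \<in> J" for t l
    using SJ[OF that(1)] ab[OF that(2,1)] that(2) by blast+
  have "compact (snd ` S)" by (intro compact_continuous_image compact continuous_intros)
  then have "compact (snd ` S \<times> snd ` S \<times> snd ` S)" by (intro compact_Times)
  moreover have "\<forall>n. (b i (x n), a k (x n), a j (x n)) \<in> snd ` S \<times> snd ` S \<times> snd ` S"
  proof -
    have "y \<in> snd ` S" if "(t, y) \<in> S" for t y using that by (rule image_eqI[rotated]) simp
    then show ?thesis using in_S[OF x(1)] ij k by (meson SigmaI)
  qed
  ultimately obtain w r where w: "strict_mono r" "((\<lambda>n. (b i (x n), a k (x n), a j (x n))) \<circ> r) \<longlonglongrightarrow> w"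
    by (rule seq_compactE[OF compact_imp_seq_compact])
  obtain \<beta> \<alpha> \<alpha>' where "w = (\<beta>, \<alpha>, \<alpha>')" by (cases w)
  then have lim3: "(\<lambda>n. (b i (x (r n)), a k (x (r n)), a j (x (r n)))) \<longlonglongrightarrow> (\<beta>, \<alpha>, \<alpha>')"
    using w(2) by (simp add: o_def)
  have lim: "(\<lambda>n. b i (x (r n))) \<longlonglongrightarrow> \<beta>" "(\<lambda>n. a k (x (r n))) \<longlonglongrightarrow> \<alpha>" "(\<lambda>n. a j (x (r n))) \<longlonglongrightarrow> \<alpha>'"
    using tendsto_fst[OF lim3] tendsto_fst[OF tendsto_snd[OF lim3]] tendsto_snd[OF tendsto_snd[OF lim3]] by simp_all
  have xr: "(\<lambda>n. x (r n)) \<longlonglongrightarrow> c" using LIMSEQ_subseq_LIMSEQ[OF x(2) w(1)] by (simp add: o_def)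
  have le: "\<beta> \<le> \<alpha>" "\<alpha> \<le> \<alpha>'"
  proof -
    show "\<beta> \<le> \<alpha>" using ba[OF ij(1) k(1,2) x(1)] by (intro LIMSEQ_le[OF lim(1,2)]) (auto intro: less_imp_le)
    have "a k t \<le> a j t" if "t \<in> I" for t
      using ba[OF k(1) ij(2) _ that] ab[OF k(1) that] k(3) by (cases "k = j") fastforce+
    then show "\<alpha> \<le> \<alpha>'" using x(1) by (intro LIMSEQ_le[OF lim(2,3)]) auto
  qed
  have "(c, \<beta>) \<in> K1"
    using in_S(2)[OF x(1) ij(1)] \<phi>(2)[OF ij(1) x(1) ab[OF ij(1) x(1)] order_refl] tendsto_Pair[OF xr lim(1)]
    by (intro limit_in_component[of K1 "\<lambda>n. (x (r n), b i (x (r n)))"] K1) (simp_all add: K1_def)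
  moreover have "(c, \<alpha>') \<in> K1"
    using in_S(1)[OF x(1) ij(2)] \<phi>(2)[OF ij(2) x(1) order_refl ab[OF ij(2) x(1)]] tendsto_Pair[OF xr lim(3)] ij(4)
    by (intro limit_in_component[of K1 "\<lambda>n. (x (r n), a j (x (r n)))"] K1) (simp_all add: K1_def)
  moreover have "connected (snd ` K1)"
    by (intro connected_continuous_image comps_props(1)[OF K1(1)] continuous_intros)
  ultimately have between: "(c, y) \<in> K1" if "\<beta> \<le> y" "y \<le> \<alpha>'" for y
  proof -
    have "y \<in> snd ` K1"
      using that \<open>(c, \<beta>) \<in> K1\<close> \<open>(c, \<alpha>') \<in> K1\<close> \<open>connected (snd ` K1)\<close> unfolding connected_iff_interval
      by (metis imageI snd_conv)
    then show ?thesis using comps_props(4)[OF K1(1)] by (metis imageE prod.collapse)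
  qed
  \<comment> \<open>If the gap stayed open in the limit, its midpoint would be a noncritical point
    of \<open>K1\<close>, and \<open>S\<close> would have points near it over abscissae in
    \<open>I\<close>, inside the gap. The tolerance \<open>e\<close> is a quarter of the limiting
    gap.\<close>
  have "\<beta> = \<alpha>"
  proof (rule ccontr)
    assume "\<beta> \<noteq> \<alpha>"
    then have lt: "\<beta> < \<alpha>" using le by simp
    define q where "q = (\<beta> + \<alpha>) / 2"
    define e where "e = (\<alpha> - \<beta>) / 4"
    have "e > 0" using lt by (simp add: e_def)
    have q: "(c, q) \<in> K1" using between[of q] lt le by (simp add: q_def)
    then have "(c, q) \<in> S" "\<not> critical_point fst F (c, q)"
      using comps_props(3)[OF K1(1)] noncrit[OF K1] by auto
    from noncritical_point_fibres_nonempty[OF gs this \<open>e > 0\<close>]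
    obtain d where d: "d > 0" "\<And>t. \<bar>t - c\<bar> < d \<Longrightarrow> \<exists>y. \<bar>y - q\<bar> < e \<and> (t, y) \<in> S"
      unfolding fst_conv snd_conv by blast
    have "\<forall>\<^sub>F n in sequentially. dist (x (r n)) c < d \<and> dist (b i (x (r n))) \<beta> < e \<and> dist (a k (x (r n))) \<alpha> < e"
      using d(1) \<open>e > 0\<close> by (intro eventually_conj tendstoD xr lim)
    from eventually_happens'[OF sequentially_bot this]
    obtain n where n: "dist (x (r n)) c < d" "dist (b i (x (r n))) \<beta> < e" "dist (a k (x (r n))) \<alpha> < e"
      by (elim exE conjE)
    obtain y where y: "\<bar>y - q\<bar> < e" "(x (r n), y) \<in> S" using d(2) n(1) unfolding dist_real_def by blast
    have e4: "\<alpha> = \<beta> + 4 * e" "q = \<beta> + 2 * e" by (simp_all add: e_def q_def field_simps)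
    have "b i (x (r n)) < y" "y < a k (x (r n))"
      using y(1) n(2,3) e4 unfolding dist_real_def by linarith+
    then show False using gap[OF x(1)] y(2) by blast
  qed
  show False
  proof (rule no_merge_at_noncritical_point[OF gs _ _ I(1) _ cont(1)[OF k(1)] cont(2)[OF ij(1)]])
    have "(c, \<beta>) \<in> K1" using between le by auto
    then show "(c, \<beta>) \<in> S" "\<not> critical_point fst F (c, \<beta>)"
      using comps_props(3)[OF K1(1)] noncrit[OF K1] by auto
    show "I \<inter> fst ` F 0 = {}" using I(2) F0 by blast
    show "b i t < a k t" if "t \<in> I" for t using ba[OF ij(1) k(1,2) that] .
    have interior: "\<exists>s>0. \<forall>y. \<bar>y - y0\<bar> < s \<longrightarrow> (t, y) \<in> S" if "(t, y0) \<in> interior S" for t y0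
    proof -
      obtain s where s: "s > 0" "ball (t, y0) s \<subseteq> S" using \<open>(t, y0) \<in> interior S\<close> by (meson mem_interior)
      have "(t, y) \<in> S" if "\<bar>y - y0\<bar> < s" for y
        using s(2) that by (auto simp: subset_iff dist_prod_def dist_real_def abs_minus_commute)
      then show ?thesis using s(1) by blast
    qed
    \<comment> \<open>The points just below this edge are in the gap; likewise for those just above
      \<open>b i t\<close>.\<close>
    show "(t, a k t) \<in> frontier S" if t: "t \<in> I" for t
    proof -
      have "(t, a k t) \<notin> interior S"
      proof
        assume "(t, a k t) \<in> interior S"
        then obtain s where s: "s > 0" "\<And>y. \<bar>y - a k t\<bar> < s \<Longrightarrow> (t, y) \<in> S" using interior by blast
        have lt: "b i t < a k t" by (rule ba[OF ij(1) k(1,2) t])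
        obtain m where m: "0 < m" "m < s" "m < a k t - b i t"
          using dense[of 0 "min s (a k t - b i t)"] s(1) lt by auto
        have "\<bar>(a k t - m) - a k t\<bar> < s" using m s(1) by linarith
        moreover have "b i t < a k t - m" using m lt by linarith
        moreover have "a k t - m < a k t" using m lt by linarith
        ultimately show False using gap[OF t] s(2) by blast
      qed
      then show ?thesis using in_S(1)[OF t k(1)] closure_subset[of S] by (simp add: frontier_def subset_iff)
    qed
    show "(t, b i t) \<in> frontier S" if t: "t \<in> I" for t
    proof -
      have "(t, b i t) \<notin> interior S"
      proof
        assume "(t, b i t) \<in> interior S"
        then obtain s where s: "s > 0" "\<And>y. \<bar>y - b i t\<bar> < s \<Longrightarrow> (t, y) \<in> S" using interior by blast
        have lt: "b i t < a k t" by (rule ba[OF ij(1) k(1,2) t])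
        obtain m where m: "0 < m" "m < s" "m < a k t - b i t"
          using dense[of 0 "min s (a k t - b i t)"] s(1) lt by auto
        have "\<bar>(b i t + m) - b i t\<bar> < s" using m s(1) by linarith
        moreover have "b i t < b i t + m" using m lt by linarith
        moreover have "b i t + m < a k t" using m lt by linarith
        ultimately show False using gap[OF t] s(2) by blast
      qed
      then show ?thesis using in_S(2)[OF t ij(1)] closure_subset[of S] by (simp add: frontier_def subset_iff)
    qed
    show "x (r n) \<in> I" for n by (rule x(1))
    show "(\<lambda>n. (x (r n), a k (x (r n)))) \<longlonglongrightarrow> (c, \<beta>)"
      using tendsto_Pair[OF xr lim(2)] \<open>\<beta> = \<alpha>\<close> by simp
    show "(\<lambda>n. (x (r n), b i (x (r n)))) \<longlonglongrightarrow> (c, \<beta>)"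
      by (rule tendsto_Pair[OF xr lim(1)])
  qed
qed

end

section \<open>Hausdorff distance of the jumping sets\<close>


context isolated_fibre
begin

text \<open>The column of \<open>x\<close> either contains \<open>c\<close>, and everything over it
  is joined to the slice over \<open>c\<close>, or lies strictly on one side, where bands and
  components correspond. Both cases give \<open>card comps\<close>, uniformly in \<open>x\<close>
  and \<epsilon>.\<close>

lemma pixelation_constant_near_nonjump:
  assumes gs: "good_stratification S F" and sm: "stratified_morse fst F" and F0: "fst ` F 0 \<subseteq> C"
    and nonjump: "isCont (slice_components S) c"
  shows "\<exists>d>0. \<exists>e>0. \<forall>\<epsilon> x. 0 < \<epsilon> \<longrightarrow> \<epsilon> < e \<longrightarrow> \<bar>x - c\<bar> < d \<longrightarrow>
           slice_components (pixelation \<epsilon> S) x = card comps"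
proof -
  have "\<forall>\<^sub>F x in nhds c. slice_components S x = card comps"
    using nonjump by (simp add: isCont_nat_iff slice_components_c)
  then obtain d1 where d1: "d1 > 0" "\<And>x. dist x c < d1 \<Longrightarrow> slice_components S x = card comps"
    unfolding eventually_nhds_metric by blast
  define d0 where "d0 = min d1 \<delta>"
  have d0: "d0 > 0" "d0 \<le> d1" "d0 \<le> \<delta>" using d1 pos by (simp_all add: d0_def)
  \<comment> \<open>The factor 1/2 provides \<open>2 * \<epsilon> < \<eta>\<close> and
    \<open>2 * \<epsilon> < \<delta>\<close> for the two counts, and keeps the column of any
    \<open>x\<close> within \<open>d0 / 2\<close> of \<open>c\<close> inside the range
    \<open>d0\<close>.\<close>
  define e where "e = min (min \<eta> \<delta>) d0 / 2"
  have e: "e > 0" "2 * e \<le> \<eta>" "2 * e \<le> \<delta>" "2 * e \<le> d0" using pos d0 by (simp_all add: e_def)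
  have side: "slice_components (pixelation \<epsilon> S) x = card comps"
    if I: "connected I" "c \<notin> I" "c \<in> closure I" "I \<subseteq> {c - d0<..<c + d0}"
      and \<epsilon>: "0 < \<epsilon>" "\<epsilon> < e" "grid_column \<epsilon> x \<subseteq> I" for I \<epsilon> x
  proof -
    have abs: "\<bar>t - c\<bar> < d0" if "t \<in> I" for t using I(4) that by (force simp: abs_less_iff)
    have IC: "I \<inter> C = {}"
    proof -
      have "t \<notin> C" if "t \<in> I" for t using punctured[of t] abs[OF that] I(2) that d0(3) by force
      then show ?thesis by blast
    qed
    have I\<delta>: "I \<subseteq> {c - \<delta><..<c + \<delta>}" using abs d0(3) by (force simp: abs_less_iff)
    have count: "slice_components S t = card comps" if "t \<in> I" for t
      using d1(2)[of t] abs[OF that] d0(2) by (simp add: dist_real_def)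
    show ?thesis
      by (rule pixelation_slice_components_side[OF I(1) IC I\<delta> count])
        (use all_components_hit[OF gs sm F0 I(1) IC I\<delta> I(3) count] \<epsilon> e(2) in auto)
  qed
  have "slice_components (pixelation \<epsilon> S) x = card comps"
    if \<epsilon>: "0 < \<epsilon>" "\<epsilon> < e" and x: "\<bar>x - c\<bar> < d0 / 2" for \<epsilon> x
  proof (cases "c \<in> grid_column \<epsilon> x")
    case True
    then show ?thesis using \<epsilon> e by (intro pixelation_slice_components_column) auto
  next
    case False
    have near: "\<bar>t - c\<bar> < d0" if "t \<in> grid_column \<epsilon> x" for t
    proof -
      have "t \<in> {x - \<epsilon>..x + \<epsilon>}" using that grid_column_bounds(2)[OF \<epsilon>(1)] by blast
      then have "\<bar>t - x\<bar> \<le> \<epsilon>" by (auto simp: abs_le_iff)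
      then show ?thesis using x \<epsilon>(2) e(4) by linarith
    qed
    have "grid_column \<epsilon> x \<subseteq> {c - d0<..<c} \<or> grid_column \<epsilon> x \<subseteq> {c<..<c + d0}"
    proof (cases "(of_int \<lfloor>x / \<epsilon>\<rfloor> + 1) * \<epsilon> < c")
      case True
      then show ?thesis using near by (intro disjI1 subsetI) (force simp: grid_column_def abs_less_iff)
    next
      case not_less: False
      then have "c < (of_int \<lceil>x / \<epsilon>\<rceil> - 1) * \<epsilon>" using False by (auto simp: grid_column_def)
      then show ?thesis using near by (intro disjI2 subsetI) (force simp: grid_column_def abs_less_iff)
    qed
    then show ?thesis
    proof
      assume "grid_column \<epsilon> x \<subseteq> {c - d0<..<c}"
      then show ?thesis by (intro side[OF _ _ _ _ \<epsilon>]) (use d0(1) in auto)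
    next
      assume "grid_column \<epsilon> x \<subseteq> {c<..<c + d0}"
      then show ?thesis by (intro side[OF _ _ _ _ \<epsilon>]) (use d0(1) in auto)
    qed
  qed
  then show ?thesis using d0(1) e(1) by (intro exI[of _ "d0 / 2"] exI[of _ e] conjI) auto
qed

text \<open>On each side of \<open>c\<close>, up to distance \<delta>, the count is constant, so a
  side where it differs from the count at \<open>c\<close> does so at every distance. The comparison
  point may therefore depend on \<epsilon>.\<close>

lemma slice_components_jump_one_sided:
  assumes "\<not> isCont (slice_components S) c"
  shows "\<exists>d>0. (\<forall>s. 0 < s \<longrightarrow> s < d \<longrightarrow> slice_components S (c + s) \<noteq> slice_components S c) \<or>
               (\<forall>s. 0 < s \<longrightarrow> s < d \<longrightarrow> slice_components S (c - s) \<noteq> slice_components S c)"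
proof -
  let ?n = "slice_components S"
  have const: "?n s = ?n t"
    if I: "connected I" "c \<notin> I" "I \<subseteq> {c - \<delta><..<c + \<delta>}" and st: "s \<in> I" "t \<in> I" for I s t
  proof -
    have "I \<inter> C = {}" using punctured I(2,3) by (force simp: abs_less_iff abs_le_iff)
    moreover have "I \<noteq> {}" using st by blast
    ultimately obtain m where "\<And>x. x \<in> I \<Longrightarrow> ?n x = m"
      by (rule bands_assigned[OF I(1) _ I(3)]) blast
    then show ?thesis using st by simp
  qed
  have "\<not> (\<forall>x. dist x c < \<delta> \<longrightarrow> ?n x = ?n c)"
    using assms pos(2) unfolding isCont_nat_iff eventually_nhds_metric by blast
  then obtain x where x: "dist x c < \<delta>" "?n x \<noteq> ?n c" by blast
  have sub: "{c<..<c + \<delta>} \<subseteq> {c - \<delta><..<c + \<delta>}" "{c - \<delta><..<c} \<subseteq> {c - \<delta><..<c + \<delta>}"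
    using pos(2) by (intro subsetI; simp)+
  consider "x \<in> {c<..<c + \<delta>}" | "x \<in> {c - \<delta><..<c}"
    using x by (cases x c rule: linorder_cases) (auto simp: dist_real_def)
  then show ?thesis
  proof cases
    case 1
    have "?n (c + s) \<noteq> ?n c" if "0 < s" "s < \<delta>" for s
      using const[OF _ _ sub(1), of "c + s" x] 1 that x(2) by simp
    then show ?thesis using pos(2) by blast
  next
    case 2
    have "?n (c - s) \<noteq> ?n c" if "0 < s" "s < \<delta>" for s
      using const[OF _ _ sub(2), of "c - s" x] 2 that x(2) by simp
    then show ?thesis using pos(2) by blast
  qed
qed

end

lemma isCont_slice_components_off_adapted:
  assumes S: "compact S" and ad: "adapted S Q C" and x: "x \<notin> C"
  shows "isCont (slice_components S) x"
proof -
  have "closed C" using ad by (simp add: adapted_def finite_imp_closed)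
  then obtain d where d: "d > 0" "ball x d \<subseteq> - C" using x open_contains_ball[of "- C"] by (auto simp: open_Compl)
  have I: "connected (ball x d)" "ball x d \<inter> C = {}" using d(2) by auto
  obtain J :: "nat set" and a b where J: "finite J"
    and ab: "\<And>j t. j \<in> J \<Longrightarrow> t \<in> ball x d \<Longrightarrow> a j t \<le> b j t"
    and ba: "\<And>i j t. i \<in> J \<Longrightarrow> j \<in> J \<Longrightarrow> i < j \<Longrightarrow> t \<in> ball x d \<Longrightarrow> b i t < a j t"
    and SJ: "\<And>t y. t \<in> ball x d \<Longrightarrow> (t, y) \<in> S \<longleftrightarrow> (\<exists>j\<in>J. a j t \<le> y \<and> y \<le> b j t)"
    by (rule band_decomposition[OF ad S I]) blast
  have "slice_components S t = card J" if t: "t \<in> ball x d" for t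
    by (rule slice_components_bands[OF J, of "\<lambda>j. a j t" "\<lambda>j. b j t"]) (use ab ba SJ t in auto)
  moreover have "\<forall>\<^sub>F t in nhds x. t \<in> ball x d" using d(1) by (intro eventually_nhds_in_open) auto
  ultimately show ?thesis unfolding isCont_nat_iff using d(1)
    by (auto elim!: eventually_mono)
qed

section \<open>Comparison of the two jumping sets\<close>

lemma discontinuity_between:
  fixes f :: "real \<Rightarrow> nat"
  assumes "f x \<noteq> f y" shows "\<exists>z. \<not> isCont f z \<and> \<bar>z - x\<bar> \<le> \<bar>y - x\<bar>"
proof (rule ccontr)
  assume neg: "\<not> ?thesis"
  have "f x = f y"
  proof (rule connected_local_const[of "closed_segment x y"])
    show "\<forall>a\<in>closed_segment x y. \<forall>\<^sub>F b in at a within closed_segment x y. f a = f b"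
    proof
      fix a assume "a \<in> closed_segment x y"
      then have "\<bar>a - x\<bar> \<le> \<bar>y - x\<bar>" using segment_bound1[of a x y] by simp
      then have "\<forall>\<^sub>F b in nhds a. f b = f a" using neg isCont_nat_iff by blast
      then show "\<forall>\<^sub>F b in at a within closed_segment x y. f a = f b"
        unfolding eventually_at_filter by eventually_elim simp
    qed
  qed auto
  then show False using assms by simp
qed

lemma hausdorff_distance_le:
  assumes "\<And>a. a \<in> A \<Longrightarrow> \<exists>b\<in>B. dist a b \<le> \<rho>" "\<And>b. b \<in> B \<Longrightarrow> \<exists>a\<in>A. dist a b \<le> \<rho>"
  shows "hausdorff_distance A B \<le> ennreal \<rho>"
  unfolding hausdorff_distance_def
proof (intro max.boundedI SUP_least)
  fix a assume "a \<in> A"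
  then obtain b where "b \<in> B" "dist a b \<le> \<rho>" using assms(1) by blast
  then show "(INF b\<in>B. ennreal (dist a b)) \<le> ennreal \<rho>" by (intro INF_lower2[of b]) (auto intro: ennreal_leI)
next
  fix b assume "b \<in> B"
  then obtain a where "a \<in> A" "dist a b \<le> \<rho>" using assms(2) by blast
  then show "(INF a\<in>A. ennreal (dist a b)) \<le> ennreal \<rho>" by (intro INF_lower2[of a]) (auto intro: ennreal_leI)
qed

text \<open>For a jump \<open>c\<close> of \<open>S\<close>, the counts of \<open>P\<close> at
  \<open>c\<close> and at one of \<open>c \<plusminus> \<rho>\<close> are those of \<open>S\<close>
  and differ, so \<open>P\<close> jumps in between. A jump \<open>z\<close> of \<open>P\<close>
  within \<rho> of a point of \<open>C\<close> forces that point to be a jump of \<open>S\<close>;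
  at a \<open>z\<close> farther from \<open>C\<close>, \<open>P\<close> agrees with \<open>S\<close>
  all around and \<open>S\<close> does not jump. Agreement already from distance
  \<open>\<rho> / 2\<close> on provides the room around \<open>z\<close>.\<close>

lemma hausdorff_jumping_sets_le:
  fixes S P :: "plane set"
  assumes fin: "finite C" and \<rho>: "\<rho> > 0"
    and jumps: "jumping_set S \<subseteq> C"
    and away: "\<And>x. (\<forall>c\<in>C. \<rho> / 2 \<le> \<bar>x - c\<bar>) \<Longrightarrow> slice_components P x = slice_components S x"
    and fibre: "\<And>c. c \<in> C \<Longrightarrow> slice_components P c = slice_components S c"
    and nonjump: "\<And>c x. c \<in> C \<Longrightarrow> c \<notin> jumping_set S \<Longrightarrow> \<bar>x - c\<bar> < \<rho> \<Longrightarrow> slice_components P x = slice_components S c"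
    and jump: "\<And>c. c \<in> jumping_set S \<Longrightarrow>
      slice_components S (c + \<rho>) \<noteq> slice_components S c \<or> slice_components S (c - \<rho>) \<noteq> slice_components S c"
    and sep: "\<And>c c'. c \<in> C \<Longrightarrow> c' \<in> C \<Longrightarrow> c \<noteq> c' \<Longrightarrow> 2 * \<rho> \<le> \<bar>c - c'\<bar>"
  shows "hausdorff_distance (jumping_set S) (jumping_set P) \<le> ennreal \<rho>"
proof (rule hausdorff_distance_le)
  fix c assume c: "c \<in> jumping_set S"
  then have cC: "c \<in> C" using jumps by blast
  obtain y where y: "\<bar>y - c\<bar> = \<rho>" "slice_components S y \<noteq> slice_components S c"
    using jump[OF c]
  proof
    assume "slice_components S (c + \<rho>) \<noteq> slice_components S c"
    then show thesis using that[of "c + \<rho>"] \<rho> by simp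
  next
    assume "slice_components S (c - \<rho>) \<noteq> slice_components S c"
    then show thesis using that[of "c - \<rho>"] \<rho> by simp
  qed
  have "\<rho> / 2 \<le> \<bar>y - c'\<bar>" if "c' \<in> C" for c'
  proof (cases "c' = c")
    case False
    then show ?thesis using sep[OF cC that] y(1) \<rho> by linarith
  qed (use y \<rho> in simp)
  then have "slice_components P y \<noteq> slice_components P c" using away[of y] fibre[OF cC] y(2) by simp
  then obtain z where "\<not> isCont (slice_components P) z" "\<bar>z - c\<bar> \<le> \<bar>y - c\<bar>"
    using discontinuity_between[of "slice_components P" c y] by metis
  then show "\<exists>b\<in>jumping_set P. dist c b \<le> \<rho>"
    using y(1) by (intro bexI[of _ z]) (auto simp: jumping_set_def dist_real_def abs_minus_commute)
next
  fix z assume z: "z \<in> jumping_set P"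
  show "\<exists>c\<in>jumping_set S. dist c z \<le> \<rho>"
  proof (rule ccontr)
    assume far: "\<not> ?thesis"
    have "isCont (slice_components P) z"
    proof (cases "\<exists>c\<in>C. \<bar>z - c\<bar> < \<rho>")
      case True
      then obtain c where c: "c \<in> C" "\<bar>z - c\<bar> < \<rho>" by blast
      have cJ: "c \<notin> jumping_set S" using far c(2) by (force simp: dist_real_def abs_minus_commute)
      have "\<forall>\<^sub>F x in nhds z. x \<in> ball c \<rho>"
        using c(2) by (intro eventually_nhds_in_open) (auto simp: dist_real_def abs_minus_commute)
      then show ?thesis unfolding isCont_nat_iff
      proof eventually_elim
        case (elim x)
        then show ?case using nonjump[OF c(1) cJ, of x] nonjump[OF c(1) cJ c(2)]
          by (simp add: dist_real_def abs_minus_commute)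
      qed
    next
      case False
      then have "z \<notin> C" using \<rho> by force
      then have "isCont (slice_components S) z" using jumps by (auto simp: jumping_set_def)
      then have "\<forall>\<^sub>F x in nhds z. slice_components S x = slice_components S z" by (simp add: isCont_nat_iff)
      moreover have "\<forall>\<^sub>F x in nhds z. x \<in> ball z (\<rho> / 2)" using \<rho> by (intro eventually_nhds_in_open) auto
      ultimately show ?thesis unfolding isCont_nat_iff
      proof eventually_elim
        case (elim x)
        have eq: "slice_components P t = slice_components S t" if "\<bar>t - z\<bar> < \<rho> / 2" for t
        proof (intro away ballI)
          fix c assume "c \<in> C"
          then have "\<rho> \<le> \<bar>z - c\<bar>" using False by fastforce
          then show "\<rho> / 2 \<le> \<bar>t - c\<bar>" using that by linarith
        qed
        show ?case using elim eq[of x] eq[of z] \<rho> by (simp add: dist_real_def abs_minus_commute)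
      qed
    qed
    then show False using z by (simp add: jumping_set_def)
  qed
qed

theorem mainTheorem2:
  fixes S :: "plane set"
  assumes "compact S" and "semialgebraic S" and "generic S"
  shows "\<exists>\<h>>0. \<exists>\<nu>\<^sub>0>0. \<exists>\<kappa>\<^sub>0. 0 < \<kappa>\<^sub>0 \<and> \<kappa>\<^sub>0 \<le> 1 \<and>
           (\<forall>\<epsilon>::real. 0 < \<epsilon> \<and> \<epsilon> < \<h> \<longrightarrow>
              hausdorff_distance (jumping_set S) (jumping_set (pixelation \<epsilon> S))
                < ennreal (\<nu>\<^sub>0 * \<epsilon> powr \<kappa>\<^sub>0))"
proof -
  obtain F where gs: "good_stratification S F" and sm: "stratified_morse fst F"
    using assms(3) by (auto simp: generic_def)
  obtain Q C1 where ad1: "adapted S Q C1" by (rule semialgebraic_adapted[OF assms(2)])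
  \<comment> \<open>With the abscissae of the vertices included, graphs over an interval that misses
    \<open>C\<close> contain no vertex.\<close>
  define C where "C = C1 \<union> fst ` F 0"
  have "finite (F 0)" using gs by (simp add: good_stratification_def)
  moreover have "finite C1" using ad1 by (simp add: adapted_def)
  ultimately have fin: "finite C" by (simp add: C_def)
  have ad: "adapted S Q C" by (rule adapted_mono[OF ad1 _ fin]) (simp add: C_def)
  have F0: "fst ` F 0 \<subseteq> C" by (simp add: C_def)
  have jumps: "jumping_set S \<subseteq> C"
    using isCont_slice_components_off_adapted[OF assms(1) ad] by (auto simp: jumping_set_def)
  obtain c0 q where c0: "c0 > 0" and q: "q \<ge> 1"
    and away: "\<And>x d \<epsilon>. 0 < d \<Longrightarrow> d \<le> 1 \<Longrightarrow> \<forall>c\<in>C. d \<le> \<bar>x - c\<bar> \<Longrightarrow> 0 < \<epsilon> \<Longrightarrow> \<epsilon> < c0 * d ^ q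
           \<Longrightarrow> slice_components (pixelation \<epsilon> S) x = slice_components S x"
    using pixelation_slice_components_away[OF assms(1) ad] by blast
  \<comment> \<open>Chosen to solve
    \<open>c0 * (\<rho> \<epsilon> / 2) ^ q = 2 * \<epsilon>\<close>, which exceeds \<epsilon>, so
    the count away from \<open>C\<close> applies at distance
    \<open>\<rho> \<epsilon> / 2\<close>.\<close>
  define \<kappa> where "\<kappa> = 1 / real q"
  define A where "A = 2 * (2 / c0) powr \<kappa>"
  define \<rho> where "\<rho> = (\<lambda>\<epsilon>. A * \<epsilon> powr \<kappa>)"
  have \<kappa>: "0 < \<kappa>" "\<kappa> \<le> 1" using q by (simp_all add: \<kappa>_def)
  have A: "A > 0" using c0 by (simp add: A_def)
  have \<rho>_pos: "\<rho> \<epsilon> > 0" if "\<epsilon> > 0" for \<epsilon> using A that by (simp add: \<rho>_def)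
  have \<rho>_pow: "c0 * (\<rho> \<epsilon> / 2) ^ q = 2 * \<epsilon>" if "\<epsilon> > 0" for \<epsilon>
  proof -
    have "(2 / c0 * \<epsilon>) powr \<kappa> = (2 / c0) powr \<kappa> * \<epsilon> powr \<kappa>" by (rule powr_mult)
    then have "\<rho> \<epsilon> / 2 = (2 / c0 * \<epsilon>) powr \<kappa>" unfolding \<rho>_def A_def by linarith
    then have "(\<rho> \<epsilon> / 2) ^ q = (2 / c0 * \<epsilon>) powr (\<kappa> * real q)"
      using c0 that by (simp add: powr_powr powr_realpow[symmetric])
    also have "\<dots> = 2 / c0 * \<epsilon>" using c0 that q by (simp add: \<kappa>_def)
    finally show ?thesis using c0 by simp
  qed
  \<comment> \<open>As \<rho> tends to 0 with \<epsilon>, the conditions at the finitely many points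
    of \<open>C\<close> hold together for small \<epsilon>, although each point has its own
    scale.\<close>
  have \<rho>_lim: "\<forall>\<^sub>F \<epsilon> in at_right 0. \<rho> \<epsilon> < d" if "d > 0" for d
  proof -
    have "((\<lambda>\<epsilon>. A * \<epsilon> powr \<kappa>) \<longlongrightarrow> A * 0 powr \<kappa>) (at_right 0)"
      using \<kappa> by (intro tendsto_intros tendsto_powr2) (auto simp: eventually_at_right_less eventually_at_filter)
    then show ?thesis using that \<kappa> unfolding \<rho>_def by (intro order_tendstoD(2)) auto
  qed
  have below: "\<forall>\<^sub>F \<epsilon> in at_right (0::real). \<epsilon> < e" if "e > 0" for e
    using that by (auto simp: eventually_at_right_field intro!: exI[of _ e])
  have pos: "\<forall>\<^sub>F \<epsilon> in at_right (0::real). 0 < \<epsilon>" by (rule eventually_at_right_less)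
  have fibre_c: "\<exists>\<eta> \<delta>. isolated_fibre S Q C c \<eta> \<delta>" for c
    using isolated_fibre_exists[OF assms(1,2) ad] by blast
  have E1: "\<forall>\<^sub>F \<epsilon> in at_right 0. \<forall>c\<in>C. slice_components (pixelation \<epsilon> S) c = slice_components S c"
  proof (intro eventually_ball_finite fin ballI)
    fix c
    obtain \<eta> \<delta> where iso: "isolated_fibre S Q C c \<eta> \<delta>" using fibre_c by blast
    have "min \<delta> \<eta> / 2 > 0" using isolated_fibre.pos[OF iso] by simp
    from pos below[OF this]
    show "\<forall>\<^sub>F \<epsilon> in at_right 0. slice_components (pixelation \<epsilon> S) c = slice_components S c"
    proof eventually_elim
      case (elim \<epsilon>)
      then have "0 < \<epsilon>" "2 * \<epsilon> < \<delta>" "2 * \<epsilon> < \<eta>" by auto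
      then show ?case
        using isolated_fibre.pixelation_slice_components_column[OF iso, of \<epsilon> c] grid_column_bounds(1)[of \<epsilon> c]
          isolated_fibre.slice_components_c[OF iso] by simp
    qed
  qed
  have E2: "\<forall>\<^sub>F \<epsilon> in at_right 0. \<forall>c\<in>C. c \<notin> jumping_set S \<longrightarrow>
      (\<forall>x. \<bar>x - c\<bar> < \<rho> \<epsilon> \<longrightarrow> slice_components (pixelation \<epsilon> S) x = slice_components S c)"
  proof (intro eventually_ball_finite fin ballI)
    fix c
    obtain \<eta> \<delta> where iso: "isolated_fibre S Q C c \<eta> \<delta>" using fibre_c by blast
    show "\<forall>\<^sub>F \<epsilon> in at_right 0. c \<notin> jumping_set S \<longrightarrow>
      (\<forall>x. \<bar>x - c\<bar> < \<rho> \<epsilon> \<longrightarrow> slice_components (pixelation \<epsilon> S) x = slice_components S c)"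
    proof (cases "c \<in> jumping_set S")
      case False
      then have "isCont (slice_components S) c" by (simp add: jumping_set_def)
      from isolated_fibre.pixelation_constant_near_nonjump[OF iso gs sm F0 this]
      obtain d e where de: "d > 0" "e > 0" "\<And>\<epsilon> x. 0 < \<epsilon> \<Longrightarrow> \<epsilon> < e \<Longrightarrow> \<bar>x - c\<bar> < d \<Longrightarrow>
          slice_components (pixelation \<epsilon> S) x = slice_components S c"
        unfolding isolated_fibre.slice_components_c[OF iso, symmetric] by blast
      show ?thesis using pos below[OF de(2)] \<rho>_lim[OF de(1)]
        by eventually_elim (use de(3) in auto)
    qed simp
  qed
  have E3: "\<forall>\<^sub>F \<epsilon> in at_right 0. \<forall>c\<in>C. c \<in> jumping_set S \<longrightarrow>
      slice_components S (c + \<rho> \<epsilon>) \<noteq> slice_components S c \<or> slice_components S (c - \<rho> \<epsilon>) \<noteq> slice_components S c"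
  proof (intro eventually_ball_finite fin ballI)
    fix c
    obtain \<eta> \<delta> where iso: "isolated_fibre S Q C c \<eta> \<delta>" using fibre_c by blast
    show "\<forall>\<^sub>F \<epsilon> in at_right 0. c \<in> jumping_set S \<longrightarrow>
      slice_components S (c + \<rho> \<epsilon>) \<noteq> slice_components S c \<or> slice_components S (c - \<rho> \<epsilon>) \<noteq> slice_components S c"
    proof (cases "c \<in> jumping_set S")
      case True
      then have "\<not> isCont (slice_components S) c" by (simp add: jumping_set_def)
      from isolated_fibre.slice_components_jump_one_sided[OF iso this]
      obtain d where d: "d > 0" "(\<forall>s. 0 < s \<longrightarrow> s < d \<longrightarrow> slice_components S (c + s) \<noteq> slice_components S c) \<or>
               (\<forall>s. 0 < s \<longrightarrow> s < d \<longrightarrow> slice_components S (c - s) \<noteq> slice_components S c)"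
        by blast
      show ?thesis using pos \<rho>_lim[OF d(1)]
        by eventually_elim (use d(2) \<rho>_pos in blast)
    qed simp
  qed
  have E4: "\<forall>\<^sub>F \<epsilon> in at_right 0. \<forall>c\<in>C. \<forall>c'\<in>C. c \<noteq> c' \<longrightarrow> 2 * \<rho> \<epsilon> \<le> \<bar>c - c'\<bar>"
  proof (intro eventually_ball_finite fin ballI)
    fix c c'
    show "\<forall>\<^sub>F \<epsilon> in at_right 0. c \<noteq> c' \<longrightarrow> 2 * \<rho> \<epsilon> \<le> \<bar>c - c'\<bar>"
    proof (cases "c = c'")
      case False
      then have "\<bar>c - c'\<bar> / 2 > 0" by simp
      from \<rho>_lim[OF this] show ?thesis by eventually_elim simp
    qed simp
  qed
  have "\<forall>\<^sub>F \<epsilon> in at_right 0. hausdorff_distance (jumping_set S) (jumping_set (pixelation \<epsilon> S)) \<le> ennreal (\<rho> \<epsilon>)"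
    using pos \<rho>_lim[OF zero_less_one] E1 E2 E3 E4
  proof eventually_elim
    case (elim \<epsilon>)
    show ?case
    proof (rule hausdorff_jumping_sets_le[OF fin \<rho>_pos[OF elim(1)] jumps])
      show "slice_components (pixelation \<epsilon> S) x = slice_components S x" if "\<forall>c\<in>C. \<rho> \<epsilon> / 2 \<le> \<bar>x - c\<bar>" for x
        using elim(1,2) \<rho>_pos[OF elim(1)] \<rho>_pow[OF elim(1)] by (intro away[OF _ _ that]) auto
    qed (use elim jumps in blast)+
  qed
  then obtain h where h: "h > 0" "\<And>\<epsilon>. 0 < \<epsilon> \<Longrightarrow> \<epsilon> < h \<Longrightarrow>
      hausdorff_distance (jumping_set S) (jumping_set (pixelation \<epsilon> S)) \<le> ennreal (\<rho> \<epsilon>)"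
    unfolding eventually_at_right_field by blast
  \<comment> \<open>Doubling \<open>A\<close> makes the inequality strict, since
    \<open>\<rho> \<epsilon>\<close> is positive.\<close>
  have "hausdorff_distance (jumping_set S) (jumping_set (pixelation \<epsilon> S)) < ennreal (2 * A * \<epsilon> powr \<kappa>)"
    if "0 < \<epsilon>" "\<epsilon> < h" for \<epsilon>
  proof -
    have "ennreal (\<rho> \<epsilon>) < ennreal (2 * A * \<epsilon> powr \<kappa>)"
      using \<rho>_pos[OF that(1)] by (intro ennreal_lessI) (simp_all add: \<rho>_def)
    with h(2)[OF that] show ?thesis by (rule le_less_trans)
  qed
  then show ?thesis using h(1) A \<kappa>
    by (intro exI[of _ h] exI[of _ "2 * A"] exI[of _ \<kappa>] conjI) auto
qed

end
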